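(* Let $0<p<1$. Then (i) $(H^{p,\infty})^a=H(\infty,1,1,1/p)$; (ii) $(H^{p,\infty})^{aa}=H(1,\infty,1/p-1)$.
   Context: $\mathbb{D}$ is the open unit disk, $\mathbb{T}$ its boundary, $m$ normalized Lebesgue measure on $\mathbb{T}$, $H(\mathbb{D})$ the analytic functions on $\mathbb{D}$. $W$ is the space of complex sequences indexed by $\mathbb{N}_0=\{0,1,2,\dots\}$; $f(z)=\sum a_nz^n\in H(\mathbb{D})$ is identified with $\{a_n\}\in W$, and equalities are between subspaces of $W$. Abel dual: $w\in W$ is Abel summable if $\lim_{r\to1^-}\sum_{n}w_nr^n$ exists (the series converging for $0<r<1$); $AS(\mathbb{D})$ is the space of Abel summable sequences. For a vector subspace $E$ of $W$, $E^a=\{\lambda\in W:\{\lambda_nw_n\}\in AS(\mathbb{D})\text{ for all }w\in E\}$ and $E^{aa}=(E^a)^a$. $H^{p,\infty}$: for measurable $f$ on $\mathbb{T}$ let $\lambda_f(s)=m(\{|f|>s\})$, $f^*(s)=\inf\{t\ge0:\lambda_f(t)\le s\}$. The Smirnov class $N^+$ consists of $f\in H(\mathbb{D})$ in the Nevanlinna class with $\lim_{r\to1^-}\int_{\mathbb{T}}\log^+|f(rz)|\,dm=\int_{\mathbb{T}}\log^+|f|\,dm$, where $f$ on $\mathbb{T}$ is the nontangential boundary function. $H^{p,\infty}$ is the set of $f\in N^+$ with $\sup_{s>0}f^*(s)s^{1/p}<\infty$ for the boundary function. Mixed norm spaces: $M_p(r,f)=(\int_{\mathbb{T}}|f(rz)|^p\,dm(z))^{1/p}$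 for $p<\infty$, $M_\infty(r,f)=\sup_{z\in\mathbb{T}}|f(rz)|$. For $0<p,q\le\infty$, $0<\alpha<\infty$: $H(p,q,\alpha)$ is the set of $f\in H(\mathbb{D})$ with $(\int_0^1M_p(r,f)^q(1-r)^{q\alpha-1}dr)^{1/q}<\infty$ (if $q=\infty$: $\sup_{0<r<1}M_p(r,f)(1-r)^\alpha<\infty$). For $\beta>0$ and $f=\sum a_nz^n$, $f^{[\beta]}(z)=\sum\frac{\Gamma(n+\beta+1)}{n!}a_nz^n$, and $H(p,q,\alpha,\beta)=\{f\in H(\mathbb{D}):f^{[\beta]}\in H(p,q,\alpha)\}$. *)

theory Defs
  imports "HOL-Complex_Analysis.Complex_Analysis" "HOL-Probability.Probability"
begin

section \<open>The unit circle and boundary values\<close>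

abbreviation unit_disk :: "complex set" where "unit_disk \<equiv> ball 0 1"

abbreviation unit_circle :: "complex set" where "unit_circle \<equiv> sphere 0 1"

definition circle_measure :: "complex measure" where
  "circle_measure =
     completion (distr (uniform_measure lborel {0..<2 * pi}) (restrict_space borel unit_circle) cis)"

definition stolz_region :: "real \<Rightarrow> complex \<Rightarrow> complex set" where
  "stolz_region a \<zeta> = {z \<in> unit_disk. dist z \<zeta> < a * (1 - norm z)}"

definition has_nontangential_limit :: "(complex \<Rightarrow> complex) \<Rightarrow> complex \<Rightarrow> complex \<Rightarrow> bool" where
  "has_nontangential_limit f \<zeta> L \<longleftrightarrow> (\<forall>a>1. (f \<longlongrightarrow> L) (at \<zeta> within stolz_region a \<zeta>))"

text \<open>The value 0 is a convention at points without a nontangential limit; for functions of the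
  Nevanlinna class these points form a null set.\<close>

definition boundary_fun :: "(complex \<Rightarrow> complex) \<Rightarrow> complex \<Rightarrow> complex" where
  "boundary_fun f \<zeta> =
     (if \<exists>L. has_nontangential_limit f \<zeta> L then THE L. has_nontangential_limit f \<zeta> L else 0)"


section \<open>The Smirnov class and the weak Hardy spaces\<close>

definition log_plus :: "real \<Rightarrow> real" where
  "log_plus x = max 0 (ln x)"

definition log_mean :: "(complex \<Rightarrow> complex) \<Rightarrow> ennreal" where
  "log_mean g = (\<integral>\<^sup>+\<zeta>. ennreal (log_plus (norm (g \<zeta>))) \<partial>circle_measure)"

definition nevanlinna_class :: "(complex \<Rightarrow> complex) set" where
  "nevanlinna_class =
     {f. f holomorphic_on unit_disk \<and>
         (SUP r\<in>{0<..<1::real}. log_mean (\<lambda>\<zeta>. f (of_real r * \<zeta>))) < \<infinity>}"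

definition smirnov_class :: "(complex \<Rightarrow> complex) set" where
  "smirnov_class =
     {f \<in> nevanlinna_class.
        ((\<lambda>r::real. log_mean (\<lambda>\<zeta>. f (of_real r * \<zeta>))) \<longlongrightarrow> log_mean (boundary_fun f)) (at_left 1)}"

definition distribution_fun :: "(complex \<Rightarrow> complex) \<Rightarrow> real \<Rightarrow> real" where
  "distribution_fun g s = measure circle_measure {\<zeta> \<in> unit_circle. norm (g \<zeta>) > s}"

definition decreasing_rearrangement :: "(complex \<Rightarrow> complex) \<Rightarrow> real \<Rightarrow> ennreal" where
  "decreasing_rearrangement g s = (INF t\<in>{t. 0 \<le> t \<and> distribution_fun g t \<le> s}. ennreal t)"

definition weak_hardy :: "real \<Rightarrow> (complex \<Rightarrow> complex) set" where
  "weak_hardy p =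
     {f \<in> smirnov_class.
        (SUP s\<in>{0<..}. decreasing_rearrangement (boundary_fun f) s * ennreal (s powr (1 / p))) < \<infinity>}"


section \<open>Mixed norm spaces\<close>

definition integral_mean :: "ennreal \<Rightarrow> real \<Rightarrow> (complex \<Rightarrow> complex) \<Rightarrow> real" where
  "integral_mean p r f =
     (if p = \<infinity> then (SUP \<zeta>\<in>unit_circle. norm (f (of_real r * \<zeta>)))
      else (\<integral>\<zeta>. norm (f (of_real r * \<zeta>)) powr enn2real p \<partial>circle_measure) powr (1 / enn2real p))"

text \<open>For finite \<open>q\<close> the outer power \<open>1 / q\<close> of the norm does not affect finiteness and is
  omitted.\<close>

definition mixed_norm_space :: "ennreal \<Rightarrow> ennreal \<Rightarrow> real \<Rightarrow> (complex \<Rightarrow> complex) set" where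
  "mixed_norm_space p q \<alpha> =
     {f. f holomorphic_on unit_disk \<and>
         (if q = \<infinity> then (SUP r\<in>{0<..<1}. ennreal (integral_mean p r f * (1 - r) powr \<alpha>)) < \<infinity>
          else (\<integral>\<^sup>+r\<in>{0<..<1}. ennreal (integral_mean p r f powr enn2real q
                  * (1 - r) powr (enn2real q * \<alpha> - 1)) \<partial>lborel) < \<infinity>)}"

definition taylor_coeff :: "(complex \<Rightarrow> complex) \<Rightarrow> nat \<Rightarrow> complex" where
  "taylor_coeff f n = (deriv ^^ n) f 0 / fact n"

definition frac_deriv :: "real \<Rightarrow> (complex \<Rightarrow> complex) \<Rightarrow> complex \<Rightarrow> complex" where
  "frac_deriv \<beta> f z =
     (\<Sum>n. of_real (Gamma (real n + \<beta> + 1) / fact n) * taylor_coeff f n * z ^ n)"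

definition mixed_norm_deriv_space ::
    "ennreal \<Rightarrow> ennreal \<Rightarrow> real \<Rightarrow> real \<Rightarrow> (complex \<Rightarrow> complex) set" where
  "mixed_norm_deriv_space p q \<alpha> \<beta> =
     {f. f holomorphic_on unit_disk \<and> frac_deriv \<beta> f \<in> mixed_norm_space p q \<alpha>}"


section \<open>Sequence spaces and the Abel dual\<close>

text \<open>The identification of a space of analytic functions on the disk with a space of sequences.\<close>

definition coeff_space :: "(complex \<Rightarrow> complex) set \<Rightarrow> (nat \<Rightarrow> complex) set" where
  "coeff_space F = taylor_coeff ` F"

definition abel_summable :: "(nat \<Rightarrow> complex) \<Rightarrow> bool" where
  "abel_summable w \<longleftrightarrow>
     (\<forall>r::real. 0 < r \<and> r < 1 \<longrightarrow> summable (\<lambda>n. w n * of_real r ^ n)) \<and>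
     (\<exists>L. ((\<lambda>r::real. \<Sum>n. w n * of_real r ^ n) \<longlongrightarrow> L) (at_left 1))"

definition abel_dual :: "(nat \<Rightarrow> complex) set \<Rightarrow> (nat \<Rightarrow> complex) set" where
  "abel_dual E = {l. \<forall>w\<in>E. abel_summable (\<lambda>n. l n * w n)}"

end

theory Submission
  imports Defs
begin

text \<open>
  Write \<open>b = 1/p > 1\<close>, \<open>B\<^sub>n = \<Gamma>(n + b + 1)/n!\<close>, and \<open>F(z) = \<Sum> B\<^sub>n \<lambda>\<^sub>n z\<^sup>n\<close> for the fractional derivative
  attached to a sequence \<open>\<lambda>\<close>. Two growth conditions are dual to each other:
  \<open>M\<^sub>1(r,f) = O((1-r) powr (1-b))\<close> for functions \<open>f = \<Sum> a\<^sub>n z\<^sup>n\<close>, and \<open>\<integral> M\<^sub>\<infinity>(r,F) dr < \<infinity>\<close> for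
  multipliers \<open>\<lambda>\<close>.

  \<^emph>\<open>They are sufficient.\<close> The Beta integral of \<open>u\<^sup>n (1-u) powr (b-1)\<close> over the unit interval equals
  \<open>\<Gamma>(b)/B\<^sub>n\<close>, so \<open>\<Gamma>(b) \<Sum> \<lambda>\<^sub>n a\<^sub>n \<rho>\<^sup>n\<close> is the integral over \<open>0 < u < 1\<close> of \<open>(1-u) powr (b-1)\<close> times the mean
  over the circle of \<open>f(\<surd>u \<zeta>) F(\<rho> \<surd>u cnj \<zeta>)\<close>. The two conditions dominate the integrand by a multiple of
  \<open>M\<^sub>\<infinity>((1+u)/2, F)\<close> uniformly in \<open>\<rho>\<close>, and dominated convergence gives the Abel limit
  (\<open>abel_summable_pairing\<close>). Functions in the weak Hardy space satisfy the first condition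
  (\<open>weak_hardy_subset_mixed_norm\<close>): the Smirnov condition and Fatou's lemma bound \<open>log\<^sup>+ |f(z)|\<close> by the
  Poisson integral of \<open>log\<^sup>+\<close> of the boundary function \<open>g\<close>; splitting \<open>log max(1,|g|)\<close> at the height
  \<open>H = (1-r) powr (-b)\<close> and using Jensen's inequality gives \<open>|f(z)| \<le> C P\<^sub>z[min(max(1,|g|), H)]\<close> for
  \<open>|z| = r\<close>, where \<open>P\<^sub>z\<close> averages against the Poisson kernel at \<open>z\<close>; the right side has a mean over the
  circle that is \<open>O(H powr (1-p)) = O((1-r) powr (1-b))\<close>.

  \<^emph>\<open>They are necessary.\<close> If \<open>\<lambda>\<close> is in the dual of the weak Hardy space, it is tested on
  \<open>f(z) = \<Sum> 2\<^sup>-\<^sup>k\<^sup>-\<^sup>1 c\<^sub>k (1 - w\<^sub>k z) powr (-b-1)\<close> with \<open>1 - |w\<^sub>k| = 2\<^sup>-\<^sup>k\<^sup>-\<^sup>1\<close> and \<open>|c\<^sub>k| \<le> 1\<close>. Each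
  summand has \<open>L\<^sup>p\<close> size of order at most 1, and because they live at different scales their sum has weak type
  \<open>p\<close> (\<open>atom_sum_weak_hardy\<close>). The pairing with \<open>f\<close> is, up to \<open>\<Gamma>(b+1)\<close>, the sum of
  \<open>2\<^sup>-\<^sup>k\<^sup>-\<^sup>1 c\<^sub>k F(w\<^sub>k)\<close>, so the uniform boundedness principle on bounded sequences \<open>c\<close> makes
  \<open>\<Sum> 2\<^sup>-\<^sup>k\<^sup>-\<^sup>1 |F(w\<^sub>k)|\<close> finite. Taking \<open>w\<^sub>k\<close> where \<open>|F|\<close> is maximal turns this into
  \<open>\<integral> M\<^sub>\<infinity>(r,F) dr < \<infinity>\<close>. In the same way, a sequence \<open>\<mu>\<close> in the dual of the multiplier space is tested on
  mixtures of the multipliers \<open>(1 - r\<^sub>j) powr (b-1) r\<^sub>j\<^sup>n \<integral> \<zeta>\<^sup>n \<phi>\<^sub>j\<close>, where \<open>\<phi>\<^sub>j\<close> is the conjugate phase of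
  \<open>f(r\<^sub>j \<zeta>)\<close> for \<open>f = \<Sum> \<mu>\<^sub>n z\<^sup>n\<close>; their pairing with \<open>\<mu>\<close> is \<open>(1 - r\<^sub>j) powr (b-1) M\<^sub>1(r\<^sub>j, f)\<close>.
\<close>


section \<open>The normalized circle measure\<close>

lemma measurable_cis_circle:
  "cis \<in> uniform_measure lborel {0..<2 * pi} \<rightarrow>\<^sub>M restrict_space borel unit_circle"
proof -
  have "cis \<in> borel_measurable borel"
    by (intro borel_measurable_continuous_onI continuous_intros)
  then show ?thesis
    by (intro measurable_restrict_space2) auto
qed

lemma emeasure_period: "emeasure lborel {0..<2 * pi} = ennreal (2 * pi)"
  by (subst emeasure_lborel_Ico) auto

lemma prob_space_uncompleted_circle:
  "prob_space (distr (uniform_measure lborel {0..<2 * pi}) (restrict_space borel unit_circle) cis)"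
  by (intro prob_space.prob_space_distr prob_space_uniform_measure measurable_cis_circle)
     (auto simp: emeasure_period)

lemma prob_space_circle_measure: "prob_space circle_measure"
  unfolding circle_measure_def
  by (intro prob_space.prob_space_completion prob_space_uncompleted_circle)

interpretation circle: prob_space circle_measure
  by (rule prob_space_circle_measure)

lemma space_circle_measure [simp]: "space circle_measure = unit_circle"
  by (simp add: circle_measure_def space_restrict_space)

lemma measure_unit_circle [simp]: "measure circle_measure unit_circle = 1"
  using circle.prob_space by simp

lemma emeasure_unit_circle [simp]: "emeasure circle_measure unit_circle = 1"
  using circle.emeasure_space_1 by simp

lemma measurable_circleI:
  assumes "g \<in> restrict_space borel unit_circle \<rightarrow>\<^sub>M N"
  shows "g \<in> circle_measure \<rightarrow>\<^sub>M N"
  unfolding circle_measure_def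
  using assms by (intro measurable_completion) (simp cong: measurable_cong_sets)

lemma measurable_circle_ident: "(\<lambda>\<zeta>. \<zeta>) \<in> borel_measurable circle_measure"
  by (rule measurable_circleI) (simp add: measurable_restrict_space1)

lemma measurable_cnj [measurable]: "cnj \<in> borel_measurable borel"
  by (intro borel_measurable_continuous_onI continuous_intros)

lemma measurable_circle_continuous:
  "continuous_on unit_circle g \<Longrightarrow> g \<in> borel_measurable circle_measure"
  by (intro measurable_circleI borel_measurable_continuous_on_restrict)

lemma integrable_circle_continuous:
  fixes h :: "complex \<Rightarrow> 'a::{banach,second_countable_topology}"
  assumes "continuous_on unit_circle h"
  shows "integrable circle_measure h"
proof -
  have "compact (h ` unit_circle)"
    by (rule compact_continuous_image[OF assms]) auto
  then obtain B where "\<forall>x\<in>h ` unit_circle. norm x \<le> B"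
    using compact_imp_bounded bounded_iff by blast
  then show ?thesis
    by (intro circle.integrable_const_bound[of _ B] measurable_circle_continuous assms AE_I2) auto
qed

lemma nn_integral_circle:
  assumes "g \<in> borel_measurable (restrict_space borel unit_circle)"
  shows "(\<integral>\<^sup>+\<zeta>. g \<zeta> \<partial>circle_measure)
    = (\<integral>\<^sup>+t. g (cis t) * indicator {0..<2 * pi} t \<partial>lborel) / ennreal (2 * pi)"
proof -
  have [measurable]: "(\<lambda>t. g (cis t)) \<in> borel_measurable lborel"
    using measurable_compose[OF measurable_cis_circle assms] by simp
  have "(\<integral>\<^sup>+\<zeta>. g \<zeta> \<partial>circle_measure) = (\<integral>\<^sup>+t. g (cis t) \<partial>uniform_measure lborel {0..<2 * pi})"
    unfolding circle_measure_def nn_integral_completion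
    by (rule nn_integral_distr[OF measurable_cis_circle]) (use assms in simp)
  also have "\<dots> = (\<integral>\<^sup>+t. g (cis t) * indicator {0..<2 * pi} t \<partial>lborel) / ennreal (2 * pi)"
    by (subst nn_integral_uniform_measure) (auto simp: emeasure_period)
  finally show ?thesis .
qed

lemma integral_circle:
  fixes g :: "complex \<Rightarrow> complex"
  assumes "continuous_on unit_circle g"
  shows "(\<integral>\<zeta>. g \<zeta> \<partial>circle_measure) = (\<integral>t\<in>{0..2 * pi}. g (cis t) \<partial>lborel) / of_real (2 * pi)"
proof -
  have g: "g \<in> borel_measurable (restrict_space borel unit_circle)"
    using assms by (rule borel_measurable_continuous_on_restrict)
  have [measurable]: "(\<lambda>t. g (cis t)) \<in> borel_measurable lborel"
    using measurable_compose[OF measurable_cis_circle g] by simp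
  have "(\<integral>\<zeta>. g \<zeta> \<partial>circle_measure) = (\<integral>t. g (cis t) \<partial>uniform_measure lborel {0..<2 * pi})"
    unfolding circle_measure_def
    by (subst integral_completion) (use g in \<open>auto intro!: integral_distr[OF measurable_cis_circle]\<close>)
  also have "\<dots> = (\<integral>t. (indicator {0..<2 * pi} t / (2 * pi)) *\<^sub>R g (cis t) \<partial>lborel)"
  proof -
    have "uniform_measure lborel {0..<2 * pi}
        = density lborel (\<lambda>t. ennreal (indicator {0..<2 * pi} t / (2 * pi)))"
      unfolding uniform_measure_def emeasure_period
      by (intro density_cong) (auto simp: indicator_def divide_ennreal simp flip: ennreal_1)
    then show ?thesis
      by (simp add: integral_density)
  qed
  also have "\<dots> = (\<integral>t. (indicator {0..2 * pi} t *\<^sub>R g (cis t)) / of_real (2 * pi) \<partial>lborel)"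
  proof (rule integral_cong_AE)
    show "AE t in lborel. (indicator {0..<2 * pi} t / (2 * pi)) *\<^sub>R g (cis t)
        = indicator {0..2 * pi} t *\<^sub>R g (cis t) / of_real (2 * pi)"
      using AE_lborel_singleton[of "2 * pi"]
      by eventually_elim (auto simp: indicator_def scaleR_conv_of_real)
  qed auto
  finally show ?thesis
    by (simp add: set_lebesgue_integral_def)
qed

lemma integral_circle_power:
  "(\<integral>\<zeta>. \<zeta> ^ n * cnj \<zeta> ^ m \<partial>circle_measure) = (if n = m then 1 else 0)"
proof -
  define k where "k = real n - real m"
  have cis: "cis t ^ n * cnj (cis t) ^ m = cis (k * t)" for t
    by (simp add: k_def Complex.DeMoivre cis_cnj cis_mult algebra_simps)
  have "(\<integral>\<zeta>. \<zeta> ^ n * cnj \<zeta> ^ m \<partial>circle_measure)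
      = (\<integral>t\<in>{0..2 * pi}. cis (k * t) \<partial>lborel) / of_real (2 * pi)"
    by (subst integral_circle) (auto intro!: continuous_intros simp: cis)
  also have "(\<integral>t\<in>{0..2 * pi}. cis (k * t) \<partial>lborel) = (if n = m then 2 * pi else 0)"
  proof (cases "n = m")
    case True
    then show ?thesis
      by (simp add: k_def set_lebesgue_integral_def scaleR_conv_of_real)
  next
    case False
    then have k: "k \<noteq> 0"
      by (simp add: k_def)
    have "(\<integral>t. indicator {0..2 * pi} t *\<^sub>R cis (k * t) \<partial>lborel)
        = cis (k * (2 * pi)) / (\<i> * k) - cis (k * 0) / (\<i> * k)"
    proof (rule integral_FTC_Icc)
      fix t :: real
      show "((\<lambda>t. cis (k * t) / (\<i> * k)) has_vector_derivative cis (k * t)) (at t within {0..2 * pi})"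
      proof -
        have "((\<lambda>z. exp (\<i> * (k * z)) / (\<i> * k)) has_field_derivative exp (\<i> * (k * t))) (at (of_real t))"
          using k by (auto intro!: derivative_eq_intros simp: mult_ac)
        from has_vector_derivative_real_field[OF this] show ?thesis
          by (simp add: cis_conv_exp)
      qed
    qed (auto intro!: continuous_intros)
    also have "cis (k * (2 * pi)) = 1"
      using cis_multiple_2pi[of k] by (simp add: k_def mult_ac)
    finally show ?thesis
      using False by (simp add: set_lebesgue_integral_def)
  qed
  finally show ?thesis by auto
qed


text \<open>This is the one interchange of sum and circle integral that is used: with \<open>g\<close> a power of \<open>cnj \<zeta>\<close> it yields
  the coefficient formula, with \<open>g\<close> a conjugate phase it computes integral means.\<close>

lemma integral_circle_power_series:
  fixes b :: "nat \<Rightarrow> complex" and g :: "complex \<Rightarrow> complex"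
  assumes b: "summable (\<lambda>n. norm (b n))"
    and g [measurable]: "g \<in> borel_measurable circle_measure"
    and K: "\<And>\<zeta>. \<zeta> \<in> unit_circle \<Longrightarrow> norm (g \<zeta>) \<le> K"
  shows "(\<lambda>n. b n * (\<integral>\<zeta>. \<zeta> ^ n * g \<zeta> \<partial>circle_measure)) sums
      (\<integral>\<zeta>. (\<Sum>n. b n * \<zeta> ^ n) * g \<zeta> \<partial>circle_measure)"
proof -
  note [measurable] = measurable_circle_ident
  have K0: "0 \<le> K"
    using K[of 1] norm_ge_zero[of "g 1"] by (simp del: norm_ge_zero)
  have int: "integrable circle_measure (\<lambda>\<zeta>. b n * \<zeta> ^ n * g \<zeta>)" for n
    by (rule circle.integrable_const_bound[where B = "norm (b n) * K"])
       (auto intro!: AE_I2 mult_left_mono K simp: norm_mult norm_power)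
  have summ: "summable (\<lambda>n. norm (b n * \<zeta> ^ n * g \<zeta>))" if "\<zeta> \<in> unit_circle" for \<zeta>
    using that by (auto simp: norm_mult norm_power intro!: summable_mult2 b)
  have "(\<lambda>n. \<integral>\<zeta>. b n * \<zeta> ^ n * g \<zeta> \<partial>circle_measure) sums
      (\<integral>\<zeta>. (\<Sum>n. b n * \<zeta> ^ n * g \<zeta>) \<partial>circle_measure)"
  proof (rule sums_integral[OF int])
    show "AE \<zeta> in circle_measure. summable (\<lambda>n. norm (b n * \<zeta> ^ n * g \<zeta>))"
      by (rule AE_I2) (use summ in auto)
    show "summable (\<lambda>n. \<integral>\<zeta>. norm (b n * \<zeta> ^ n * g \<zeta>) \<partial>circle_measure)"
    proof (rule summable_comparison_test')
      show "summable (\<lambda>n. norm (b n) * K)"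
        by (intro summable_mult2 b)
      show "norm (\<integral>\<zeta>. norm (b n * \<zeta> ^ n * g \<zeta>) \<partial>circle_measure) \<le> norm (b n) * K" for n
      proof -
        have "(\<integral>\<zeta>. norm (b n * \<zeta> ^ n * g \<zeta>) \<partial>circle_measure) \<le> (\<integral>\<zeta>. norm (b n) * K \<partial>circle_measure)"
          by (intro integral_mono integrable_norm int)
             (auto intro!: mult_left_mono K simp: norm_mult norm_power)
        then show ?thesis
          by simp
      qed
    qed
  qed
  moreover have "(\<integral>\<zeta>. b n * \<zeta> ^ n * g \<zeta> \<partial>circle_measure) = b n * (\<integral>\<zeta>. \<zeta> ^ n * g \<zeta> \<partial>circle_measure)" for n
    by (simp add: mult.assoc)
  moreover have "(\<integral>\<zeta>. (\<Sum>n. b n * \<zeta> ^ n * g \<zeta>) \<partial>circle_measure)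
      = (\<integral>\<zeta>. (\<Sum>n. b n * \<zeta> ^ n) * g \<zeta> \<partial>circle_measure)"
  proof (rule Bochner_Integration.integral_cong)
    fix \<zeta> assume "\<zeta> \<in> space circle_measure"
    then have "summable (\<lambda>n. norm (b n * \<zeta> ^ n))"
      using b by (simp add: norm_mult norm_power)
    from suminf_mult2[OF summable_norm_cancel[OF this], of "g \<zeta>"]
    show "(\<Sum>n. b n * \<zeta> ^ n * g \<zeta>) = (\<Sum>n. b n * \<zeta> ^ n) * g \<zeta>" by simp
  qed auto
  ultimately show ?thesis by simp
qed

lemma sin_ge_chord:
  assumes "0 \<le> x" "x \<le> pi / 2"
  shows "2 / pi * x \<le> sin x"
proof -
  have "convex_on {0..pi / 2} (\<lambda>x. - sin x)"
  proof (rule f''_ge0_imp_convex)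
    fix x assume "x \<in> {0..pi / 2}"
    then show "0 \<le> sin x" using sin_ge_zero[of x] pi_gt_zero by simp
    show "((\<lambda>x. - sin x) has_real_derivative - cos x) (at x)"
      by (auto intro!: derivative_eq_intros)
    show "((\<lambda>x. - cos x) has_real_derivative sin x) (at x)"
      by (auto intro!: derivative_eq_intros)
  qed auto
  from convex_onD[OF this, of "2 * x / pi" 0 "pi / 2"] assms pi_gt_zero
  show ?thesis by (simp add: field_simps)
qed

text \<open>The chord is \<open>2 sin(\<bar>t - s\<bar>/2)\<close>; the second alternative occurs when the short arc passes through the point 1,
  where the angle jumps by \<open>2\<pi>\<close>.\<close>

lemma chord_small_imp_angle_small:
  assumes t: "t \<in> {0..<2 * pi}" and s: "s \<in> {0..<2 * pi}" and d: "dist (cis t) (cis s) < d"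
  shows "\<bar>t - s\<bar> < pi / 2 * d \<or> \<bar>t - s\<bar> > 2 * pi - pi / 2 * d"
proof -
  define u where "u = \<bar>t - s\<bar> / 2"
  have u: "0 \<le> u" "u < pi" using t s by (auto simp: u_def)
  have "(dist (cis t) (cis s))\<^sup>2 = (cos t - cos s)\<^sup>2 + (sin t - sin s)\<^sup>2"
    by (simp add: dist_complex_def cmod_power2)
  also have "\<dots> = (sin t ^ 2 + cos t ^ 2) + (sin s ^ 2 + cos s ^ 2) - 2 * cos (t - s)"
    unfolding cos_diff by (simp add: power2_eq_square algebra_simps)
  also have "\<dots> = 2 - 2 * cos (2 * u)"
    by (simp add: u_def)
  also have "\<dots> = (2 * sin u)\<^sup>2"
    unfolding cos_double_sin by (simp add: power2_eq_square)
  finally have eq: "dist (cis t) (cis s) = 2 * sin u"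
    by (rule power2_eq_imp_eq) (use sin_ge_zero u in auto)
  show ?thesis
  proof (cases "u \<le> pi / 2")
    case True
    then have "2 / pi * u < d / 2"
      using sin_ge_chord[of u] u d unfolding eq by simp
    then show ?thesis
      using pi_gt_zero by (simp add: u_def field_simps)
  next
    case False
    then have "2 / pi * (pi - u) \<le> sin (pi - u)"
      using u by (intro sin_ge_chord) auto
    then have "2 / pi * (pi - u) < d / 2"
      using d unfolding eq sin_pi_minus by linarith
    then show ?thesis
      using pi_gt_zero by (simp add: u_def field_simps)
  qed
qed

text \<open>The angles of such points lie in an interval of length \<open>\<pi>d\<close> or in one of its translates by \<open>\<plusminus>2\<pi>\<close>,
  which gives the bound \<open>3d/2\<close>.\<close>

lemma measure_arc_le:
  assumes "\<eta> \<in> unit_circle" "0 < d"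
  shows "measure circle_measure {\<zeta>\<in>unit_circle. dist \<zeta> \<eta> < d} \<le> 2 * d"
proof -
  note [measurable] = measurable_circle_ident
  define s where "s = Arg2pi \<eta>"
  have s: "s \<in> {0..<2 * pi}" "cis s = \<eta>"
    using assms Arg2pi_eq[of \<eta>] Arg2pi_ge_0[of \<eta>] Arg2pi_lt_2pi[of \<eta>]
    by (auto simp: s_def cis_conv_exp)
  define A where "A = {\<zeta>. dist \<zeta> \<eta> < d}"
  have A [measurable]: "A \<in> sets borel" unfolding A_def by measurable
  define I where "I c = {c - pi / 2 * d <..< c + pi / 2 * d}" for c
  have "emeasure circle_measure {\<zeta>\<in>unit_circle. dist \<zeta> \<eta> < d} = (\<integral>\<^sup>+\<zeta>. indicator A \<zeta> \<partial>circle_measure)"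
  proof -
    have "{\<zeta>\<in>unit_circle. dist \<zeta> \<eta> < d} = A \<inter> space circle_measure"
      by (auto simp: A_def)
    moreover have "A \<inter> space circle_measure \<in> sets circle_measure"
      using measurable_sets[OF measurable_circle_ident A] by simp
    ultimately show ?thesis
      by (simp add: nn_integral_indicator')
  qed
  also have "\<dots> = (\<integral>\<^sup>+t. indicator A (cis t) * indicator {0..<2 * pi} t \<partial>lborel) / ennreal (2 * pi)"
    by (rule nn_integral_circle) (auto intro!: measurable_restrict_space1)
  also have "(\<integral>\<^sup>+t. indicator A (cis t) * indicator {0..<2 * pi} t \<partial>lborel)
      \<le> (\<integral>\<^sup>+t. indicator (I s \<union> I (s + 2 * pi) \<union> I (s - 2 * pi)) t \<partial>lborel)"
  proof (rule nn_integral_mono)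
    fix t :: real
    show "(indicator A (cis t) * indicator {0..<2 * pi} t :: ennreal)
      \<le> indicator (I s \<union> I (s + 2 * pi) \<union> I (s - 2 * pi)) t"
      using chord_small_imp_angle_small[of t s d] s
      by (auto simp: indicator_def A_def I_def abs_if split: if_splits)
  qed
  also have "\<dots> = emeasure lborel (I s \<union> I (s + 2 * pi) \<union> I (s - 2 * pi))"
    by (rule nn_integral_indicator) (auto simp: I_def)
  also have "\<dots> \<le> ennreal (pi * d) + ennreal (pi * d) + ennreal (pi * d)"
    using assms
    by (intro order.trans[OF emeasure_subadditive] add_mono order.refl) (auto simp: I_def)
  also have "\<dots> = ennreal (3 * pi * d)"
    using assms by (simp flip: ennreal_plus)
  finally have "emeasure circle_measure {\<zeta>\<in>unit_circle. dist \<zeta> \<eta> < d} \<le> ennreal (3 * pi * d) / ennreal (2 * pi)"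
    by (simp add: divide_right_mono_ennreal)
  also have "\<dots> = ennreal (3 / 2 * d)"
    using assms by (simp add: divide_ennreal)
  also have "\<dots> \<le> ennreal (2 * d)"
    using assms by (intro ennreal_leI) auto
  finally show ?thesis
    using assms by (simp add: circle.emeasure_eq_measure)
qed


section \<open>Truncated integrals of functions of weak type\<close>

lemma dyadic_floor:
  assumes "1 \<le> (x :: real)"
  obtains j :: nat where "2 ^ j \<le> x" "x < 2 * 2 ^ j"
proof
  let ?j = "nat \<lfloor>log 2 x\<rfloor>"
  have "0 \<le> log 2 x" using assms by simp
  then have j: "real ?j \<le> log 2 x" "log 2 x < real ?j + 1" by linarith+
  have "2 powr real ?j \<le> x" "x < 2 powr (real ?j + 1)"
    using j assms le_log_iff[of 2 x "real ?j"] log_less_iff[of 2 x "real ?j + 1"] by auto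
  then show "2 ^ ?j \<le> x" "x < 2 * 2 ^ ?j"
    by (simp_all add: powr_add powr_realpow)
qed

text \<open>The constant in the two truncated estimates below: \<open>4 powr s\<close> is the price of replacing \<open>w\<close> by the next dyadic
  level below it, \<open>2 powr (p - s)\<close> comes from starting the levels at \<open>H/2\<close>, and the denominator sums the
  geometric series over the levels.\<close>

definition weak_const :: "real \<Rightarrow> real \<Rightarrow> real" where
  "weak_const s p = 4 powr s * 2 powr (p - s) / (1 - 2 powr (- \<bar>s - p\<bar>))"

lemma weak_const_nonneg: "s \<noteq> p \<Longrightarrow> 0 \<le> weak_const s p"
  using powr_less_mono[of "- \<bar>s - p\<bar>" 0 2] by (simp add: weak_const_def)

text \<open>Layers of \<open>w\<close> at the geometric levels \<open>y \<theta>\<^sup>j\<close>: on each layer \<open>h\<close> is comparable to the level, and the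
  weak type bound turns the sum over \<open>j\<close> into a geometric series with ratio \<open>\<theta> powr (s - p)\<close>. The levels descend
  (\<open>\<theta> = 1/2\<close>) when \<open>s > p\<close> and ascend (\<open>\<theta> = 2\<close>) when \<open>s < p\<close>.\<close>

lemma nn_integral_level_sum_le:
  fixes w :: "'a \<Rightarrow> real"
  assumes w [measurable]: "w \<in> borel_measurable M"
    and weak: "\<And>x. 0 < x \<Longrightarrow> emeasure M {\<zeta>\<in>space M. x < w \<zeta>} \<le> ennreal (A * x powr (- p))"
    and A: "0 \<le> A" and y: "0 < y" and \<theta>: "0 < \<theta>" "\<theta> powr (s - p) < 1"
    and dom: "\<And>\<zeta>. \<zeta> \<in> space M \<Longrightarrow> h \<zeta> \<noteq> 0 \<Longrightarrow>
      \<exists>j. y * \<theta> ^ j < w \<zeta> \<and> h \<zeta> \<le> ennreal ((4 * (y * \<theta> ^ j)) powr s)"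
  shows "(\<integral>\<^sup>+\<zeta>. h \<zeta> \<partial>M) \<le> ennreal (A * (4 powr s / (1 - \<theta> powr (s - p))) * y powr (s - p))"
proof -
  define x where "x j = y * \<theta> ^ j" for j :: nat
  have x: "0 < x j" for j using y \<theta> by (simp add: x_def)
  have "(\<integral>\<^sup>+\<zeta>. h \<zeta> \<partial>M)
      \<le> (\<integral>\<^sup>+\<zeta>. (\<Sum>j. ennreal ((4 * x j) powr s) * indicator {\<zeta>\<in>space M. x j < w \<zeta>} \<zeta>) \<partial>M)"
  proof (rule nn_integral_mono)
    fix \<zeta> assume \<zeta>: "\<zeta> \<in> space M"
    let ?g = "\<lambda>j. ennreal ((4 * x j) powr s) * indicator {\<zeta>\<in>space M. x j < w \<zeta>} \<zeta>"
    show "h \<zeta> \<le> suminf ?g"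
    proof (cases "h \<zeta> = 0")
      case False
      from dom[OF \<zeta> False] obtain j where j: "x j < w \<zeta>" "h \<zeta> \<le> ennreal ((4 * x j) powr s)"
        unfolding x_def by blast
      then have "h \<zeta> \<le> sum ?g {j}"
        using \<zeta> by simp
      also have "\<dots> \<le> suminf ?g"
        by (rule sum_le_suminf) auto
      finally show ?thesis .
    qed auto
  qed
  also have "\<dots> = (\<Sum>j. ennreal ((4 * x j) powr s) * emeasure M {\<zeta>\<in>space M. x j < w \<zeta>})"
    by (subst nn_integral_suminf) (auto intro!: suminf_cong nn_integral_cmult_indicator)
  also have "\<dots> \<le> (\<Sum>j. ennreal (A * 4 powr s * y powr (s - p) * (\<theta> powr (s - p)) ^ j))"
  proof (rule suminf_le)
    fix j
    have "ennreal ((4 * x j) powr s) * emeasure M {\<zeta>\<in>space M. x j < w \<zeta>}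
        \<le> ennreal ((4 * x j) powr s) * ennreal (A * x j powr (- p))"
      by (intro mult_left_mono weak x) auto
    also have "\<dots> = ennreal ((4 * x j) powr s * (A * x j powr (- p)))"
      by (rule ennreal_mult[symmetric]) (use A in auto)
    also have "(4 * x j) powr s * (A * x j powr (- p)) = A * 4 powr s * x j powr (s - p)"
      using x[of j] by (simp add: powr_mult flip: powr_add)
    also have "x j powr (s - p) = y powr (s - p) * (\<theta> powr (s - p)) ^ j"
    proof -
      have "(\<theta> ^ j) powr (s - p) = (\<theta> powr real j) powr (s - p)"
        using \<theta> by (simp add: powr_realpow)
      also have "\<dots> = (\<theta> powr (s - p)) powr real j"
        unfolding powr_powr by (simp only: mult.commute)
      also have "\<dots> = (\<theta> powr (s - p)) ^ j"
        using \<theta> by (intro powr_realpow) auto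
      finally show ?thesis
        using y \<theta> by (simp add: x_def powr_mult)
    qed
    finally show "ennreal ((4 * x j) powr s) * emeasure M {\<zeta>\<in>space M. x j < w \<zeta>}
        \<le> ennreal (A * 4 powr s * y powr (s - p) * (\<theta> powr (s - p)) ^ j)"
      by (simp add: mult_ac)
  qed auto
  also have "\<dots> = ennreal (\<Sum>j. A * 4 powr s * y powr (s - p) * (\<theta> powr (s - p)) ^ j)"
    by (rule suminf_ennreal2) (use A \<theta> in \<open>auto intro!: summable_mult summable_geometric\<close>)
  also have "(\<Sum>j. A * 4 powr s * y powr (s - p) * (\<theta> powr (s - p)) ^ j)
      = A * (4 powr s / (1 - \<theta> powr (s - p))) * y powr (s - p)"
    using \<theta> by (subst suminf_mult) (auto intro!: summable_geometric simp: suminf_geometric)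
  finally show ?thesis .
qed

lemma weak_type_below:
  fixes w :: "'a \<Rightarrow> real"
  assumes w: "w \<in> borel_measurable M"
    and weak: "\<And>x. 0 < x \<Longrightarrow> emeasure M {\<zeta>\<in>space M. x < w \<zeta>} \<le> ennreal (A * x powr (- p))"
    and A: "0 \<le> A" and H: "0 < H" and s: "p < s" "0 < s"
  shows "(\<integral>\<^sup>+\<zeta>. ennreal (w \<zeta> powr s) * indicator {\<zeta>. 0 \<le> w \<zeta> \<and> w \<zeta> \<le> H} \<zeta> \<partial>M)
    \<le> ennreal (A * weak_const s p * H powr (s - p))"
proof -
  have less1: "(1 / 2 :: real) powr (s - p) < 1"
    using s powr_less_mono[of 0 "s - p" 2] by (simp add: powr_divide)
  have "(\<integral>\<^sup>+\<zeta>. ennreal (w \<zeta> powr s) * indicator {\<zeta>. 0 \<le> w \<zeta> \<and> w \<zeta> \<le> H} \<zeta> \<partial>M)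
     \<le> ennreal (A * (4 powr s / (1 - (1 / 2) powr (s - p))) * (H / 2) powr (s - p))"
  proof (rule nn_integral_level_sum_le[OF w weak A])
    fix \<zeta> assume *: "ennreal (w \<zeta> powr s) * indicator {\<zeta>. 0 \<le> w \<zeta> \<and> w \<zeta> \<le> H} \<zeta> \<noteq> 0"
    then have wH: "0 < w \<zeta>" "w \<zeta> \<le> H"
      by (auto simp: indicator_def split: if_splits)
    then have "1 \<le> H / w \<zeta>" by simp
    then obtain j :: nat where j: "2 ^ j \<le> H / w \<zeta>" "H / w \<zeta> < 2 * 2 ^ j"
      by (rule dyadic_floor)
    show "\<exists>j. H / 2 * (1 / 2) ^ j < w \<zeta> \<and>
       ennreal (w \<zeta> powr s) * indicator {\<zeta>. 0 \<le> w \<zeta> \<and> w \<zeta> \<le> H} \<zeta>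
         \<le> ennreal ((4 * (H / 2 * (1 / 2) ^ j)) powr s)"
    proof (intro exI[of _ j] conjI)
      show "H / 2 * (1 / 2) ^ j < w \<zeta>"
        using j wH by (simp add: field_simps power_divide)
      have "w \<zeta> \<le> H / 2 ^ j"
        using j(1) wH by (simp add: field_simps)
      also have "\<dots> \<le> 4 * (H / 2 * (1 / 2) ^ j)"
        using H by (simp add: power_divide divide_simps)
      finally have "w \<zeta> powr s \<le> (4 * (H / 2 * (1 / 2) ^ j)) powr s"
        using wH s by (intro powr_mono2) auto
      then show "ennreal (w \<zeta> powr s) * indicator {\<zeta>. 0 \<le> w \<zeta> \<and> w \<zeta> \<le> H} \<zeta>
         \<le> ennreal ((4 * (H / 2 * (1 / 2) ^ j)) powr s)"
        using wH by (simp add: ennreal_leI)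
    qed
  qed (use H less1 in auto)
  also have "A * (4 powr s / (1 - (1 / 2) powr (s - p))) * (H / 2) powr (s - p)
      = A * weak_const s p * H powr (s - p)"
  proof -
    have "(1 / 2 :: real) powr (s - p) = 2 powr (- \<bar>s - p\<bar>)"
      using s powr_minus_divide[of 2 "s - p"] by (simp add: powr_divide)
    moreover have "(H / 2) powr (s - p) = 2 powr (p - s) * H powr (s - p)"
      using H powr_minus_divide[of 2 "s - p"] by (simp add: powr_divide)
    ultimately show ?thesis
      by (simp add: weak_const_def)
  qed
  finally show ?thesis .
qed

lemma weak_type_above:
  fixes w :: "'a \<Rightarrow> real"
  assumes w: "w \<in> borel_measurable M"
    and weak: "\<And>x. 0 < x \<Longrightarrow> emeasure M {\<zeta>\<in>space M. x < w \<zeta>} \<le> ennreal (A * x powr (- p))"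
    and A: "0 \<le> A" and H: "0 < H" and s: "s < p" "0 < s"
  shows "(\<integral>\<^sup>+\<zeta>. ennreal (w \<zeta> powr s) * indicator {\<zeta>. H < w \<zeta>} \<zeta> \<partial>M)
    \<le> ennreal (A * weak_const s p * H powr (s - p))"
proof -
  have less1: "(2 :: real) powr (s - p) < 1"
    using s powr_less_mono[of "s - p" 0 2] by simp
  have "(\<integral>\<^sup>+\<zeta>. ennreal (w \<zeta> powr s) * indicator {\<zeta>. H < w \<zeta>} \<zeta> \<partial>M)
     \<le> ennreal (A * (4 powr s / (1 - 2 powr (s - p))) * (H / 2) powr (s - p))"
  proof (rule nn_integral_level_sum_le[OF w weak A])
    fix \<zeta> assume *: "ennreal (w \<zeta> powr s) * indicator {\<zeta>. H < w \<zeta>} \<zeta> \<noteq> 0"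
    then have wH: "H < w \<zeta>"
      by (auto simp: indicator_def split: if_splits)
    then have "1 \<le> w \<zeta> / H" using H by simp
    then obtain j :: nat where j: "2 ^ j \<le> w \<zeta> / H" "w \<zeta> / H < 2 * 2 ^ j"
      by (rule dyadic_floor)
    show "\<exists>j. H / 2 * 2 ^ j < w \<zeta> \<and>
       ennreal (w \<zeta> powr s) * indicator {\<zeta>. H < w \<zeta>} \<zeta> \<le> ennreal ((4 * (H / 2 * 2 ^ j)) powr s)"
    proof (intro exI[of _ j] conjI)
      have "H / 2 * 2 ^ j < H * 2 ^ j" using H by simp
      also have "\<dots> \<le> w \<zeta>" using j H by (simp add: field_simps)
      finally show "H / 2 * 2 ^ j < w \<zeta>" .
      have "w \<zeta> \<le> 4 * (H / 2 * 2 ^ j)"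
        using j H by (simp add: field_simps)
      then have "w \<zeta> powr s \<le> (4 * (H / 2 * 2 ^ j)) powr s"
        using wH H s by (intro powr_mono2) auto
      then show "ennreal (w \<zeta> powr s) * indicator {\<zeta>. H < w \<zeta>} \<zeta> \<le> ennreal ((4 * (H / 2 * 2 ^ j)) powr s)"
        using wH by (simp add: ennreal_leI)
    qed
  qed (use H less1 in auto)
  also have "A * (4 powr s / (1 - 2 powr (s - p))) * (H / 2) powr (s - p)
      = A * weak_const s p * H powr (s - p)"
  proof -
    have "2 powr (s - p) = (2 :: real) powr (- \<bar>s - p\<bar>)"
      using s by simp
    moreover have "(H / 2) powr (s - p) = 2 powr (p - s) * H powr (s - p)"
      using H powr_minus_divide[of 2 "s - p"] by (simp add: powr_divide)
    ultimately show ?thesis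
      by (simp add: weak_const_def)
  qed
  finally show ?thesis .
qed

lemma emeasure_circle_eq_measure: "emeasure circle_measure A = ennreal (measure circle_measure A)"
  by (rule circle.emeasure_eq_measure)

text \<open>The point \<open>\<eta>\<close> is the conjugate of the direction of \<open>w\<close>, where \<open>1/(1 - w\<zeta>)\<close> peaks. Replacing \<open>w\<close> by its
  radial projection changes \<open>1 - w\<zeta>\<close> by \<open>1 - |w|\<close>, which is itself at most \<open>|1 - w\<zeta>|\<close>.\<close>

lemma norm_diff_unit_le:
  fixes w :: complex
  assumes "norm w < 1"
  obtains \<eta> where "\<eta> \<in> unit_circle" "\<And>\<zeta>. \<zeta> \<in> unit_circle \<Longrightarrow> dist \<zeta> \<eta> \<le> 2 * norm (1 - w * \<zeta>)"
proof -
  define \<eta> where "\<eta> = (if w = 0 then 1 else cnj (sgn w))"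
  have \<eta>: "norm \<eta> = 1" by (simp add: \<eta>_def norm_sgn)
  have w: "w = of_real (norm w) * cnj \<eta>"
    by (simp add: \<eta>_def sgn_eq)
  have "dist \<zeta> \<eta> \<le> 2 * norm (1 - w * \<zeta>)" if \<zeta>: "\<zeta> \<in> unit_circle" for \<zeta>
  proof -
    have "norm (w * \<zeta>) \<le> norm w" using \<zeta> by (simp add: norm_mult)
    then have ge: "1 - norm w \<le> norm (1 - w * \<zeta>)"
      using norm_triangle_ineq2[of 1 "w * \<zeta>"] by simp
    have "\<eta> * cnj \<eta> = 1" using \<eta> by (simp add: complex_norm_square[symmetric])
    then have "\<zeta> - \<eta> = \<eta> * (cnj \<eta> * \<zeta> - 1)"
      by (simp add: right_diff_distrib mult.assoc[symmetric])
    then have "dist \<zeta> \<eta> = norm (cnj \<eta> * \<zeta> - 1)"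
      using \<eta> by (simp add: dist_norm norm_mult)
    also have "cnj \<eta> * \<zeta> - 1 = of_real (1 - norm w) * cnj \<eta> * \<zeta> - (1 - w * \<zeta>)"
      by (subst (2) w) (simp add: algebra_simps)
    also have "norm \<dots> \<le> norm (of_real (1 - norm w) * cnj \<eta> * \<zeta>) + norm (1 - w * \<zeta>)"
      by (rule norm_triangle_ineq4)
    also have "norm (of_real (1 - norm w) * cnj \<eta> * \<zeta>) = 1 - norm w"
      using \<zeta> \<eta> assms by (simp add: norm_mult del: of_real_diff)
    finally show ?thesis using ge by simp
  qed
  with \<eta> show ?thesis by (intro that[of \<eta>]) auto
qed

lemma norm_one_minus_ge:
  assumes "\<zeta> \<in> unit_circle"
  shows "1 - norm z \<le> norm (1 - z * \<zeta>)"
  using norm_triangle_ineq2[of 1 "z * \<zeta>"] assms by (simp add: norm_mult)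

lemma measure_cauchy_kernel_level:
  assumes w: "norm w < 1" and d: "0 < d"
  shows "measure circle_measure {\<zeta>\<in>unit_circle. norm (1 - w * \<zeta>) < d} \<le> 4 * d"
    and "{\<zeta>\<in>unit_circle. norm (1 - w * \<zeta>) < d} \<in> sets circle_measure"
proof -
  note [measurable] = measurable_circle_ident
  obtain \<eta> where \<eta>: "\<eta> \<in> unit_circle" "\<And>\<zeta>. \<zeta> \<in> unit_circle \<Longrightarrow> dist \<zeta> \<eta> \<le> 2 * norm (1 - w * \<zeta>)"
    using norm_diff_unit_le[OF w] by blast
  have "{\<zeta>\<in>space circle_measure. norm (1 - w * \<zeta>) < d} \<in> sets circle_measure" by measurable
  then show "{\<zeta>\<in>unit_circle. norm (1 - w * \<zeta>) < d} \<in> sets circle_measure" by simp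
  have "{\<zeta>\<in>space circle_measure. dist \<zeta> \<eta> < 2 * d} \<in> sets circle_measure" by measurable
  then have "measure circle_measure {\<zeta>\<in>unit_circle. norm (1 - w * \<zeta>) < d}
      \<le> measure circle_measure {\<zeta>\<in>unit_circle. dist \<zeta> \<eta> < 2 * d}"
    using \<eta>(2) by (intro circle.finite_measure_mono) force+
  also have "\<dots> \<le> 2 * (2 * d)"
    using \<eta>(1) d by (intro measure_arc_le) auto
  finally show "measure circle_measure {\<zeta>\<in>unit_circle. norm (1 - w * \<zeta>) < d} \<le> 4 * d" by simp
qed

text \<open>The function \<open>1/|1 - w\<zeta>|\<close> has weak type 1 with constant 4 for every \<open>w\<close>, and it never exceeds
  \<open>1/(1 - |w|)\<close>; so the estimate below the level \<open>1/(1 - |w|)\<close> covers the whole circle.\<close>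

lemma nn_integral_cauchy_kernel_le:
  fixes w :: complex
  assumes w: "norm w < 1" and s: "1 < s"
  shows "(\<integral>\<^sup>+\<zeta>. ennreal (norm (1 - w * \<zeta>) powr (- s)) \<partial>circle_measure)
    \<le> ennreal (4 * weak_const s 1 * (1 - norm w) powr (1 - s))"
proof -
  note [measurable] = measurable_circle_ident
  define W where "W \<zeta> = 1 / norm (1 - w * \<zeta>)" for \<zeta>
  have meas: "W \<in> borel_measurable circle_measure"
    unfolding W_def by measurable
  have pos: "0 < norm (1 - w * \<zeta>)" if "\<zeta> \<in> unit_circle" for \<zeta>
    using norm_one_minus_ge[OF that, of w] w by linarith
  have weak: "emeasure circle_measure {\<zeta>\<in>space circle_measure. x < W \<zeta>} \<le> ennreal (4 * x powr (- 1))"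
    if x: "0 < x" for x
  proof -
    have "{\<zeta>\<in>space circle_measure. x < W \<zeta>} = {\<zeta>\<in>unit_circle. norm (1 - w * \<zeta>) < 1 / x}"
      using pos x by (auto simp: W_def field_simps)
    then show ?thesis
      using measure_cauchy_kernel_level(1)[OF w, of "1 / x"] x
      unfolding emeasure_circle_eq_measure by (intro ennreal_leI) (simp add: powr_minus_divide)
  qed
  have "(\<integral>\<^sup>+\<zeta>. ennreal (norm (1 - w * \<zeta>) powr (- s)) \<partial>circle_measure)
      = (\<integral>\<^sup>+\<zeta>. ennreal (W \<zeta> powr s) * indicator {\<zeta>. 0 \<le> W \<zeta> \<and> W \<zeta> \<le> 1 / (1 - norm w)} \<zeta> \<partial>circle_measure)"
  proof (rule nn_integral_cong)
    fix \<zeta> assume "\<zeta> \<in> space circle_measure"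
    then have \<zeta>: "\<zeta> \<in> unit_circle" by simp
    have "W \<zeta> \<le> 1 / (1 - norm w)"
      unfolding W_def using norm_one_minus_ge[OF \<zeta>] pos[OF \<zeta>] w by (intro divide_left_mono mult_pos_pos) auto
    then show "ennreal (norm (1 - w * \<zeta>) powr (- s))
        = ennreal (W \<zeta> powr s) * indicator {\<zeta>. 0 \<le> W \<zeta> \<and> W \<zeta> \<le> 1 / (1 - norm w)} \<zeta>"
      by (simp add: W_def powr_divide powr_minus_divide)
  qed
  also have "\<dots> \<le> ennreal (4 * weak_const s 1 * (1 / (1 - norm w)) powr (s - 1))"
    by (rule weak_type_below[OF meas weak]) (use s w in auto)
  also have "(1 / (1 - norm w)) powr (s - 1) = (1 - norm w) powr (1 - s)"
    using w powr_minus_divide[of "1 - norm w" "s - 1"] by (simp add: powr_divide)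
  finally show ?thesis .
qed


section \<open>Measurability of boundary functions\<close>

lemma radial_in_stolz_region:
  assumes "\<zeta> \<in> unit_circle" "0 \<le> r" "r < 1" "1 < a"
  shows "of_real r * \<zeta> \<in> stolz_region a \<zeta>"
proof -
  have "of_real r * \<zeta> - \<zeta> = of_real (r - 1) * \<zeta>"
    by (simp add: algebra_simps)
  then have "dist (of_real r * \<zeta>) \<zeta> = 1 - r"
    using assms by (simp add: dist_norm norm_mult del: of_real_diff)
  then show ?thesis
    using assms by (simp add: stolz_region_def norm_mult)
qed

lemma has_nontangential_limit_radial:
  assumes "has_nontangential_limit f \<zeta> L" "\<zeta> \<in> unit_circle"
  shows "((\<lambda>r. f (of_real r * \<zeta>)) \<longlongrightarrow> L) (at_left 1)"
proof (rule filterlim_compose[where g = f and f = "\<lambda>r. of_real r * \<zeta>"])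
  show "(f \<longlongrightarrow> L) (at \<zeta> within stolz_region 2 \<zeta>)"
    using assms by (simp add: has_nontangential_limit_def)
  have ev: "eventually (\<lambda>r::real. 0 < r \<and> r < 1) (at_left 1)"
    using eventually_at_left_real[of 0 1] by simp
  show "filterlim (\<lambda>r. of_real r * \<zeta>) (at \<zeta> within stolz_region 2 \<zeta>) (at_left 1)"
    unfolding filterlim_at
  proof
    show "eventually (\<lambda>r. of_real r * \<zeta> \<in> stolz_region 2 \<zeta> \<and> of_real r * \<zeta> \<noteq> \<zeta>) (at_left 1)"
      using ev
    proof eventually_elim
      case (elim r)
      then show ?case
        using radial_in_stolz_region[of \<zeta> r 2] assms by (auto simp: stolz_region_def)
    qed
    have "((\<lambda>r. of_real r * \<zeta>) \<longlongrightarrow> of_real 1 * \<zeta>) (at_left 1)"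
      by (intro tendsto_intros)
    then show "((\<lambda>r. of_real r * \<zeta>) \<longlongrightarrow> \<zeta>) (at_left 1)" by simp
  qed
qed

lemma boundary_fun_eqI:
  assumes "has_nontangential_limit f \<zeta> L" "\<zeta> \<in> unit_circle"
  shows "boundary_fun f \<zeta> = L"
proof -
  have "L' = L" if "has_nontangential_limit f \<zeta> L'" for L'
    by (rule tendsto_unique[OF _ has_nontangential_limit_radial[OF that assms(2)]
          has_nontangential_limit_radial[OF assms]]) simp
  with assms(1) have "(THE L. has_nontangential_limit f \<zeta> L) = L"
    by (intro the_equality)
  with assms(1) show ?thesis
    unfolding boundary_fun_def by (simp add: exI[of _ L])
qed

definition radius_seq :: "nat \<Rightarrow> real" where
  "radius_seq n = 1 - 1 / (real n + 2)"

lemma radius_seq: "0 < radius_seq n" "radius_seq n < 1"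
  by (simp_all add: radius_seq_def field_simps)

lemma radius_seq_tendsto: "radius_seq \<longlonglongrightarrow> 1"
  unfolding radius_seq_def by real_asymp

lemma filterlim_radius_seq: "filterlim radius_seq (at_left 1) sequentially"
  unfolding filterlim_at
proof
  show "eventually (\<lambda>n. radius_seq n \<in> {..<1} \<and> radius_seq n \<noteq> 1) sequentially"
    using radius_seq(2) by (intro always_eventually allI) (auto simp: less_le)
qed (rule radius_seq_tendsto)

lemma radius_seq_boundary_fun:
  assumes "has_nontangential_limit f \<zeta> L" "\<zeta> \<in> unit_circle"
  shows "(\<lambda>n. f (of_real (radius_seq n) * \<zeta>)) \<longlonglongrightarrow> boundary_fun f \<zeta>"
  using filterlim_compose[OF has_nontangential_limit_radial[OF assms] filterlim_radius_seq]
  by (simp add: boundary_fun_eqI[OF assms])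

text \<open>The condition fails at \<open>\<zeta>\<close> exactly when some pair \<open>z, w\<close> with \<open>dist (f z) (f w) > e\<close> lies in the truncated
  Stolz region of \<open>\<zeta>\<close>. Membership of a fixed point in that region is an open condition on \<open>\<zeta>\<close>, so the set is
  closed for every \<open>f\<close>.\<close>

definition small_oscillation :: "(complex \<Rightarrow> complex) \<Rightarrow> real \<Rightarrow> real \<Rightarrow> real \<Rightarrow> complex set" where
  "small_oscillation f a d e =
     {\<zeta>. \<forall>z\<in>stolz_region a \<zeta> \<inter> ball \<zeta> d. \<forall>w\<in>stolz_region a \<zeta> \<inter> ball \<zeta> d. dist (f z) (f w) \<le> e}"

lemma closed_small_oscillation: "closed (small_oscillation f a d e)"
proof -
  define O' :: "complex \<Rightarrow> complex set" where "O' z = {\<zeta>. dist z \<zeta> < a * (1 - norm z)} \<inter> ball z d" for z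
  have "- small_oscillation f a d e
      = (\<Union>(z, w)\<in>{(z, w). z \<in> unit_disk \<and> w \<in> unit_disk \<and> \<not> dist (f z) (f w) \<le> e}. O' z \<inter> O' w)"
    by (auto simp: small_oscillation_def stolz_region_def O'_def dist_commute)
  moreover have "open (O' z)" for z
    unfolding O'_def by (intro open_Int open_Collect_less continuous_intros open_ball)
  ultimately have "open (- small_oscillation f a d e)"
    by (auto intro!: open_UN)
  then show ?thesis
    by (simp add: closed_def)
qed

text \<open>The Cauchy criterion, with countably many apertures and scales so that it describes a Borel set. All Stolz
  regions with aperture at least 2 contain the radius, which forces the limits for different apertures to
  agree.\<close>

lemma nontangential_limit_iff_oscillation:
  assumes \<zeta>: "\<zeta> \<in> unit_circle"
  shows "(\<exists>L. has_nontangential_limit f \<zeta> L) \<longleftrightarrow>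
    (\<forall>n k. \<exists>m. \<zeta> \<in> small_oscillation f (real n + 2) (1 / (real m + 1)) (1 / (real k + 1)))"
    (is "?lhs \<longleftrightarrow> ?rhs")
proof
  assume ?lhs
  then obtain L where L: "has_nontangential_limit f \<zeta> L" ..
  show ?rhs
  proof (intro allI)
    fix n k
    let ?a = "real n + 2" and ?e = "1 / (real k + 1)"
    have "(f \<longlongrightarrow> L) (at \<zeta> within stolz_region ?a \<zeta>)"
      using L by (simp add: has_nontangential_limit_def)
    then have "eventually (\<lambda>z. dist (f z) L < ?e / 2) (at \<zeta> within stolz_region ?a \<zeta>)"
      by (rule tendstoD) auto
    then obtain d where d: "0 < d"
        "\<And>z. z \<in> stolz_region ?a \<zeta> \<Longrightarrow> z \<noteq> \<zeta> \<Longrightarrow> dist z \<zeta> < d \<Longrightarrow> dist (f z) L < ?e / 2"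
      unfolding eventually_at by blast
    obtain m where m: "1 / (real m + 1) < d"
      using nat_approx_posE[OF d(1)] by (auto simp: add.commute)
    have "\<zeta> \<in> small_oscillation f ?a (1 / (real m + 1)) ?e"
      unfolding small_oscillation_def
    proof (intro CollectI ballI)
      fix z w assume zw: "z \<in> stolz_region ?a \<zeta> \<inter> ball \<zeta> (1 / (real m + 1))"
        "w \<in> stolz_region ?a \<zeta> \<inter> ball \<zeta> (1 / (real m + 1))"
      have "z \<noteq> \<zeta>" "w \<noteq> \<zeta>" using zw \<zeta> by (auto simp: stolz_region_def)
      then have "dist (f z) L < ?e / 2" "dist (f w) L < ?e / 2"
        using d(2)[of z] d(2)[of w] zw m by (auto simp: dist_commute)
      then show "dist (f z) (f w) \<le> ?e"
        using dist_triangle2[of "f z" "f w" L] by linarith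
    qed
    then show "\<exists>m. \<zeta> \<in> small_oscillation f ?a (1 / (real m + 1)) ?e" ..
  qed
next
  assume rhs: ?rhs
  let ?x = "\<lambda>j. of_real (radius_seq j) * \<zeta>"
  have in_stolz: "?x j \<in> stolz_region (real n + 2) \<zeta>" for j n
    using radial_in_stolz_region[OF \<zeta>, of "radius_seq j" "real n + 2"] radius_seq[of j] by simp
  have "?x \<longlonglongrightarrow> of_real 1 * \<zeta>"
    by (intro tendsto_intros radius_seq_tendsto)
  then have x: "eventually (\<lambda>j. ?x j \<in> ball \<zeta> d) sequentially" if "0 < d" for d
    using tendstoD[OF _ that, of ?x "\<zeta>"] by (simp add: dist_commute)
  have close: "\<exists>d>0. \<zeta> \<in> small_oscillation f (real n + 2) d e" if e: "0 < e" for n e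
  proof -
    obtain k where k: "1 / (real k + 1) < e"
      using nat_approx_posE[OF e] by (auto simp: add.commute)
    obtain m where "\<zeta> \<in> small_oscillation f (real n + 2) (1 / (real m + 1)) (1 / (real k + 1))"
      using rhs by blast
    then have "\<zeta> \<in> small_oscillation f (real n + 2) (1 / (real m + 1)) e"
      using k unfolding small_oscillation_def by force
    then show ?thesis by (intro exI[of _ "1 / (real m + 1)"]) auto
  qed
  have "Cauchy (\<lambda>j. f (?x j))"
  proof (rule metric_CauchyI)
    fix e :: real assume e: "0 < e"
    then obtain d where d: "0 < d" "\<zeta> \<in> small_oscillation f (real 0 + 2) d (e / 2)"
      using close[of "e / 2" 0] by auto
    from x[OF d(1)] obtain N where N: "\<And>j. N \<le> j \<Longrightarrow> ?x j \<in> ball \<zeta> d"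
      unfolding eventually_sequentially by blast
    have "dist (f (?x i)) (f (?x j)) < e" if "N \<le> i" "N \<le> j" for i j
    proof -
      have "dist (f (?x i)) (f (?x j)) \<le> e / 2"
        using d(2) N[OF that(1)] N[OF that(2)] in_stolz[of i 0] in_stolz[of j 0]
        unfolding small_oscillation_def by blast
      then show ?thesis using e by simp
    qed
    then show "\<exists>M. \<forall>m\<ge>M. \<forall>n\<ge>M. dist (f (?x m)) (f (?x n)) < e" by blast
  qed
  then obtain L where L: "(\<lambda>j. f (?x j)) \<longlonglongrightarrow> L"
    by (meson Cauchy_convergent convergentD)
  have "has_nontangential_limit f \<zeta> L"
    unfolding has_nontangential_limit_def
  proof (intro allI impI)
    fix a :: real
    obtain n :: nat where n: "a \<le> real n + 2"
      using real_arch_simple[of a] by (metis add.commute add_increasing zero_le_numeral)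
    have sub: "stolz_region a \<zeta> \<subseteq> stolz_region (real n + 2) \<zeta>"
    proof
      fix z assume z: "z \<in> stolz_region a \<zeta>"
      then have "a * (1 - norm z) \<le> (real n + 2) * (1 - norm z)"
        using n by (intro mult_right_mono) (auto simp: stolz_region_def)
      with z show "z \<in> stolz_region (real n + 2) \<zeta>"
        unfolding stolz_region_def mem_Collect_eq by linarith
    qed
    show "(f \<longlongrightarrow> L) (at \<zeta> within stolz_region a \<zeta>)"
    proof (rule tendstoI)
      fix e :: real assume e: "0 < e"
      then obtain d where d: "0 < d" "\<zeta> \<in> small_oscillation f (real n + 2) d (e / 2)"
        using close[of "e / 2" n] by auto
      have "dist (f z) L < e" if z: "z \<in> stolz_region a \<zeta>" "dist z \<zeta> < d" for z
      proof -
        have "dist (f z) L \<le> e / 2"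
        proof (rule tendsto_upperbound)
          show "(\<lambda>j. dist (f z) (f (?x j))) \<longlonglongrightarrow> dist (f z) L"
            by (intro tendsto_intros L)
          show "eventually (\<lambda>j. dist (f z) (f (?x j)) \<le> e / 2) sequentially"
            using x[OF d(1)]
          proof eventually_elim
            case (elim j)
            then show ?case
              using d(2) z sub in_stolz[of j n] unfolding small_oscillation_def
              by (auto simp: dist_commute)
          qed
        qed simp
        then show ?thesis using e by simp
      qed
      with d(1) show "eventually (\<lambda>z. dist (f z) L < e) (at \<zeta> within stolz_region a \<zeta>)"
        unfolding eventually_at by blast
    qed
  qed
  then show ?lhs ..
qed

lemma measurable_nontangential_set:
  "{\<zeta>\<in>unit_circle. \<exists>L. has_nontangential_limit f \<zeta> L} \<in> sets circle_measure"
proof -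
  define B where "B = (\<Inter>n. \<Inter>k. \<Union>m.
    small_oscillation f (real n + 2) (1 / (real m + 1)) (1 / (real k + 1)))"
  have "B \<in> sets borel"
    unfolding B_def
    by (intro sets.countable_INT'' sets.countable_UN) (auto intro!: borel_closed closed_small_oscillation)
  then have "{\<zeta>\<in>space circle_measure. \<zeta> \<in> B} \<in> sets circle_measure"
    by (intro measurable_sets_Collect[OF measurable_circle_ident]) simp
  also have "{\<zeta>\<in>space circle_measure. \<zeta> \<in> B} = {\<zeta>\<in>unit_circle. \<exists>L. has_nontangential_limit f \<zeta> L}"
    unfolding B_def space_circle_measure
    by (intro Collect_cong conj_cong refl) (simp add: nontangential_limit_iff_oscillation)
  finally show ?thesis .
qed

lemma measurable_dilation:
  assumes "continuous_on unit_disk f" "0 \<le> r" "r < 1"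
  shows "(\<lambda>\<zeta>. f (of_real r * \<zeta>)) \<in> borel_measurable circle_measure"
  using assms
  by (intro measurable_circle_continuous continuous_on_compose2[OF assms(1)] continuous_intros)
     (auto simp: norm_mult)

lemma measurable_boundary_fun:
  assumes "continuous_on unit_disk f"
  shows "boundary_fun f \<in> borel_measurable circle_measure"
proof (rule borel_measurable_LIMSEQ_metric)
  let ?E = "{\<zeta>\<in>unit_circle. \<exists>L. has_nontangential_limit f \<zeta> L}"
  show "(\<lambda>\<zeta>. indicator ?E \<zeta> * f (of_real (radius_seq n) * \<zeta>)) \<in> borel_measurable circle_measure" for n
    using measurable_dilation[OF assms, of "radius_seq n"] radius_seq[of n]
    by (intro borel_measurable_times borel_measurable_indicator measurable_nontangential_set) auto
  fix \<zeta> assume \<zeta>: "\<zeta> \<in> space circle_measure"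
  show "(\<lambda>n. indicator ?E \<zeta> * f (of_real (radius_seq n) * \<zeta>)) \<longlonglongrightarrow> boundary_fun f \<zeta>"
  proof (cases "\<zeta> \<in> ?E")
    case True
    then show ?thesis using radius_seq_boundary_fun[of f \<zeta>] by auto
  next
    case False
    then show ?thesis using \<zeta> by (auto simp: boundary_fun_def)
  qed
qed


section \<open>The Smirnov condition\<close>

lemma log_plus_nonneg: "0 \<le> log_plus x"
  by (simp add: log_plus_def)

lemma log_plus_eq: "0 \<le> x \<Longrightarrow> log_plus x = ln (max 1 x)"
  by (cases "x = 0") (auto simp: log_plus_def max_def)

lemma log_plus_mono: "0 \<le> x \<Longrightarrow> x \<le> y \<Longrightarrow> log_plus x \<le> log_plus y"
  by (simp add: log_plus_eq)

lemma norm_le_exp_log_plus: "norm (z :: complex) \<le> exp (log_plus (norm z))"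
proof (cases "z = 0")
  case False
  then have "norm z = exp (ln (norm z))" by simp
  also have "\<dots> \<le> exp (log_plus (norm z))"
    unfolding log_plus_def by (subst exp_le_cancel_iff) simp
  finally show ?thesis .
qed auto

lemma continuous_log_plus: "continuous_on {0..} log_plus"
proof -
  have "continuous_on {0..} (\<lambda>x::real. ln (max 1 x))"
    by (intro continuous_on_ln continuous_on_max continuous_on_const continuous_on_id) auto
  then show ?thesis
    by (rule continuous_on_eq) (simp add: log_plus_eq)
qed

lemma tendsto_log_plus_norm:
  assumes "(g \<longlongrightarrow> (l :: complex)) F"
  shows "((\<lambda>x. log_plus (norm (g x))) \<longlongrightarrow> log_plus (norm l)) F"
  by (rule continuous_on_tendsto_compose[OF continuous_log_plus tendsto_norm[OF assms]]) auto

lemma measurable_log_plus_norm: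
  fixes g :: "'a \<Rightarrow> complex"
  assumes "g \<in> borel_measurable M"
  shows "(\<lambda>x. log_plus (norm (g x))) \<in> borel_measurable M"
  unfolding log_plus_def
  using assms by measurable

text \<open>Passage to the boundary in an inequality \<open>c\<^sub>n \<le> \<integral> k u\<^sub>n\<close>, where \<open>u\<^sub>n\<close> is \<open>log\<^sup>+ |f|\<close> on the circle of radius
  \<open>radius_seq n\<close> and \<open>v\<close> is \<open>log\<^sup>+\<close> of the boundary function. Fatou's lemma bounds \<open>\<integral> (K - k) v\<close> from above by the
  lower limit of \<open>\<integral> (K - k) u\<^sub>n\<close>, and the Smirnov condition says that \<open>\<integral> K u\<^sub>n\<close> converges to \<open>\<integral> K v\<close>; subtracting gives
  the inequality in the limit. The convention that the boundary function is 0 where there is no nontangential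
  limit makes \<open>v\<close> at most the lower limit of \<open>u\<^sub>n\<close> at every point of the circle, so the hypothesis of Fatou's
  lemma holds everywhere.\<close>

lemma smirnov_kernel_ge:
  fixes k :: "complex \<Rightarrow> real" and c :: "nat \<Rightarrow> real"
  assumes f: "f \<in> smirnov_class"
    and k [measurable]: "k \<in> borel_measurable circle_measure"
    and kK: "\<And>\<zeta>. \<zeta> \<in> unit_circle \<Longrightarrow> 0 \<le> k \<zeta>" "\<And>\<zeta>. \<zeta> \<in> unit_circle \<Longrightarrow> k \<zeta> \<le> K"
    and c: "\<And>n. 0 \<le> c n" "c \<longlonglongrightarrow> C"
    and le: "\<And>n. ennreal (c n)
      \<le> (\<integral>\<^sup>+\<zeta>. ennreal (k \<zeta> * log_plus (norm (f (of_real (radius_seq n) * \<zeta>)))) \<partial>circle_measure)"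
  shows "ennreal C \<le> (\<integral>\<^sup>+\<zeta>. ennreal (k \<zeta> * log_plus (norm (boundary_fun f \<zeta>))) \<partial>circle_measure)"
proof -
  define u where "u n \<zeta> = log_plus (norm (f (of_real (radius_seq n) * \<zeta>)))" for n \<zeta>
  define v where "v \<zeta> = log_plus (norm (boundary_fun f \<zeta>))" for \<zeta>
  have cont: "continuous_on unit_disk f"
    using f by (auto simp: smirnov_class_def nevanlinna_class_def holomorphic_on_imp_continuous_on)
  have u [measurable]: "u n \<in> borel_measurable circle_measure" for n
    unfolding u_def using radius_seq[of n]
    by (intro measurable_log_plus_norm measurable_dilation cont) auto
  have v [measurable]: "v \<in> borel_measurable circle_measure"
    unfolding v_def by (intro measurable_log_plus_norm measurable_boundary_fun cont)
  have nonneg: "0 \<le> u n \<zeta>" "0 \<le> v \<zeta>" for n \<zeta>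
    by (simp_all add: u_def v_def log_plus_nonneg)
  have "0 \<le> K" using kK[of 1] by simp
  have I: "(\<lambda>n. \<integral>\<^sup>+\<zeta>. ennreal (u n \<zeta>) \<partial>circle_measure) \<longlonglongrightarrow> (\<integral>\<^sup>+\<zeta>. ennreal (v \<zeta>) \<partial>circle_measure)"
    using f filterlim_compose[OF _ filterlim_radius_seq]
    unfolding smirnov_class_def log_mean_def u_def v_def by blast
  have fin: "(\<integral>\<^sup>+\<zeta>. ennreal (v \<zeta>) \<partial>circle_measure) < \<infinity>"
  proof -
    have "(\<integral>\<^sup>+\<zeta>. ennreal (v \<zeta>) \<partial>circle_measure)
        \<le> (SUP r\<in>{0<..<1::real}. log_mean (\<lambda>\<zeta>. f (of_real r * \<zeta>)))"
    proof (rule LIMSEQ_le_const2[OF I], intro exI[of _ 0] allI impI)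
      fix n
      show "(\<integral>\<^sup>+\<zeta>. ennreal (u n \<zeta>) \<partial>circle_measure)
          \<le> (SUP r\<in>{0<..<1::real}. log_mean (\<lambda>\<zeta>. f (of_real r * \<zeta>)))"
        unfolding u_def log_mean_def[symmetric] using radius_seq[of n] by (intro SUP_upper) auto
    qed
    also have "\<dots> < \<infinity>"
      using f by (simp add: smirnov_class_def nevanlinna_class_def)
    finally show ?thesis .
  qed
  have split: "(\<integral>\<^sup>+\<zeta>. ennreal (k \<zeta> * h \<zeta>) \<partial>circle_measure) + (\<integral>\<^sup>+\<zeta>. ennreal ((K - k \<zeta>) * h \<zeta>) \<partial>circle_measure)
      = ennreal K * (\<integral>\<^sup>+\<zeta>. ennreal (h \<zeta>) \<partial>circle_measure)"
    if [measurable]: "h \<in> borel_measurable circle_measure" and h: "\<And>\<zeta>. 0 \<le> h \<zeta>" for h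
  proof -
    have "(\<integral>\<^sup>+\<zeta>. ennreal (k \<zeta> * h \<zeta>) \<partial>circle_measure) + (\<integral>\<^sup>+\<zeta>. ennreal ((K - k \<zeta>) * h \<zeta>) \<partial>circle_measure)
        = (\<integral>\<^sup>+\<zeta>. ennreal (k \<zeta> * h \<zeta>) + ennreal ((K - k \<zeta>) * h \<zeta>) \<partial>circle_measure)"
      by (rule nn_integral_add[symmetric]) auto
    also have "\<dots> = (\<integral>\<^sup>+\<zeta>. ennreal K * ennreal (h \<zeta>) \<partial>circle_measure)"
    proof (rule nn_integral_cong)
      fix \<zeta> assume "\<zeta> \<in> space circle_measure"
      then have "0 \<le> k \<zeta> * h \<zeta>" "0 \<le> (K - k \<zeta>) * h \<zeta>"
        using kK[of \<zeta>] h[of \<zeta>] by auto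
      then have "ennreal (k \<zeta> * h \<zeta>) + ennreal ((K - k \<zeta>) * h \<zeta>) = ennreal (K * h \<zeta>)"
        by (subst ennreal_plus[symmetric]) (auto simp: left_diff_distrib)
      then show "ennreal (k \<zeta> * h \<zeta>) + ennreal ((K - k \<zeta>) * h \<zeta>) = ennreal K * ennreal (h \<zeta>)"
        using h \<open>0 \<le> K\<close> by (simp add: ennreal_mult)
    qed
    finally show ?thesis by (simp add: nn_integral_cmult)
  qed
  have "ennreal C + (\<integral>\<^sup>+\<zeta>. ennreal ((K - k \<zeta>) * v \<zeta>) \<partial>circle_measure)
      = (\<integral>\<^sup>+\<zeta>. ennreal C + ennreal ((K - k \<zeta>) * v \<zeta>) \<partial>circle_measure)"
    by (subst nn_integral_add) auto
  also have "\<dots> \<le> (\<integral>\<^sup>+\<zeta>. liminf (\<lambda>n. ennreal (c n) + ennreal ((K - k \<zeta>) * u n \<zeta>)) \<partial>circle_measure)"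
  proof (rule nn_integral_mono)
    fix \<zeta> assume "\<zeta> \<in> space circle_measure"
    then have \<zeta>: "\<zeta> \<in> unit_circle" by simp
    show "ennreal C + ennreal ((K - k \<zeta>) * v \<zeta>)
        \<le> liminf (\<lambda>n. ennreal (c n) + ennreal ((K - k \<zeta>) * u n \<zeta>))"
    proof (cases "\<exists>L. has_nontangential_limit f \<zeta> L")
      case True
      then obtain L where "has_nontangential_limit f \<zeta> L" ..
      from tendsto_log_plus_norm[OF radius_seq_boundary_fun[OF this \<zeta>]]
      have "(\<lambda>n. u n \<zeta>) \<longlonglongrightarrow> v \<zeta>" unfolding u_def v_def .
      then have "(\<lambda>n. ennreal (c n) + ennreal ((K - k \<zeta>) * u n \<zeta>))
          \<longlonglongrightarrow> ennreal C + ennreal ((K - k \<zeta>) * v \<zeta>)"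
        by (intro tendsto_add tendsto_ennrealI tendsto_mult tendsto_const c)
      then show ?thesis
        by (simp add: lim_imp_Liminf)
    next
      case False
      then have "v \<zeta> = 0" by (simp add: v_def boundary_fun_def log_plus_def)
      then have "ennreal C + ennreal ((K - k \<zeta>) * v \<zeta>) = liminf (\<lambda>n. ennreal (c n))"
        using lim_imp_Liminf[OF _ tendsto_ennrealI[OF c(2)]] by simp
      also have "\<dots> \<le> liminf (\<lambda>n. ennreal (c n) + ennreal ((K - k \<zeta>) * u n \<zeta>))"
        by (intro Liminf_mono always_eventually) auto
      finally show ?thesis .
    qed
  qed
  also have "\<dots> \<le> liminf (\<lambda>n. \<integral>\<^sup>+\<zeta>. ennreal (c n) + ennreal ((K - k \<zeta>) * u n \<zeta>) \<partial>circle_measure)"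
    by (rule nn_integral_liminf) auto
  also have "\<dots> \<le> liminf (\<lambda>n. ennreal K * (\<integral>\<^sup>+\<zeta>. ennreal (u n \<zeta>) \<partial>circle_measure))"
  proof (intro Liminf_mono always_eventually allI)
    fix n
    have "(\<integral>\<^sup>+\<zeta>. ennreal (c n) + ennreal ((K - k \<zeta>) * u n \<zeta>) \<partial>circle_measure)
        = ennreal (c n) + (\<integral>\<^sup>+\<zeta>. ennreal ((K - k \<zeta>) * u n \<zeta>) \<partial>circle_measure)"
      by (subst nn_integral_add) auto
    also have "\<dots> \<le> (\<integral>\<^sup>+\<zeta>. ennreal (k \<zeta> * u n \<zeta>) \<partial>circle_measure)
        + (\<integral>\<^sup>+\<zeta>. ennreal ((K - k \<zeta>) * u n \<zeta>) \<partial>circle_measure)"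
      using le[of n] by (intro add_right_mono) (simp add: u_def)
    also have "\<dots> = ennreal K * (\<integral>\<^sup>+\<zeta>. ennreal (u n \<zeta>) \<partial>circle_measure)"
      by (rule split) (auto simp: nonneg)
    finally show "(\<integral>\<^sup>+\<zeta>. ennreal (c n) + ennreal ((K - k \<zeta>) * u n \<zeta>) \<partial>circle_measure)
        \<le> ennreal K * (\<integral>\<^sup>+\<zeta>. ennreal (u n \<zeta>) \<partial>circle_measure)" .
  qed
  also have "\<dots> = ennreal K * (\<integral>\<^sup>+\<zeta>. ennreal (v \<zeta>) \<partial>circle_measure)"
    by (rule lim_imp_Liminf) (auto intro!: ennreal_tendsto_cmult I)
  also have "\<dots> = (\<integral>\<^sup>+\<zeta>. ennreal (k \<zeta> * v \<zeta>) \<partial>circle_measure)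
      + (\<integral>\<^sup>+\<zeta>. ennreal ((K - k \<zeta>) * v \<zeta>) \<partial>circle_measure)"
    by (rule split[symmetric]) (auto simp: nonneg)
  finally have le': "ennreal C + (\<integral>\<^sup>+\<zeta>. ennreal ((K - k \<zeta>) * v \<zeta>) \<partial>circle_measure)
      \<le> (\<integral>\<^sup>+\<zeta>. ennreal (k \<zeta> * v \<zeta>) \<partial>circle_measure)
        + (\<integral>\<^sup>+\<zeta>. ennreal ((K - k \<zeta>) * v \<zeta>) \<partial>circle_measure)" .
  have "(\<integral>\<^sup>+\<zeta>. ennreal ((K - k \<zeta>) * v \<zeta>) \<partial>circle_measure)
      \<le> ennreal K * (\<integral>\<^sup>+\<zeta>. ennreal (v \<zeta>) \<partial>circle_measure)"
    using split[OF v] nonneg by (metis add.commute le_iff_add)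
  also have "\<dots> < \<infinity>" using fin by (simp add: ennreal_mult_less_top)
  finally show ?thesis
    using le' unfolding v_def[symmetric]
    by (auto simp: add.commute[of _ "\<integral>\<^sup>+\<zeta>. ennreal ((K - k \<zeta>) * v \<zeta>) \<partial>circle_measure"]
        ennreal_add_left_cancel_le)
qed


section \<open>Poisson majorization of the positive logarithm\<close>

text \<open>For \<open>\<zeta>\<close> on the circle \<open>|1 - cnj z \<zeta>| = |\<zeta> - z|\<close>, so this is the Poisson kernel; the present form is the one that
  expands in a geometric series.\<close>

definition poisson :: "complex \<Rightarrow> complex \<Rightarrow> real" where
  "poisson z \<zeta> = (1 - (norm z)\<^sup>2) / (norm (1 - cnj z * \<zeta>))\<^sup>2"

lemma poisson_nonneg: "z \<in> unit_disk \<Longrightarrow> 0 \<le> poisson z \<zeta>"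
  by (auto simp: poisson_def abs_square_le_1 intro!: divide_nonneg_nonneg)

lemma poisson_le:
  assumes "z \<in> unit_disk" "\<zeta> \<in> unit_circle"
  shows "poisson z \<zeta> \<le> 2 / (1 - norm z)"
proof -
  have z: "norm z < 1" using assms by simp
  have ge: "1 - norm z \<le> norm (1 - cnj z * \<zeta>)"
    using norm_one_minus_ge[OF assms(2), of "cnj z"] by simp
  have "poisson z \<zeta> \<le> (1 - (norm z)\<^sup>2) / (1 - norm z)\<^sup>2"
    unfolding poisson_def using z ge
    by (intro divide_left_mono power_mono mult_pos_pos zero_less_power) (auto simp: abs_square_le_1)
  also have "\<dots> = (1 + norm z) / (1 - norm z)"
    using z by (simp add: divide_simps) (simp add: power2_eq_square algebra_simps)
  also have "\<dots> \<le> 2 / (1 - norm z)"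
    using z by (intro divide_right_mono) auto
  finally show ?thesis .
qed

lemma continuous_on_poisson: "z \<in> unit_disk \<Longrightarrow> continuous_on unit_circle (poisson z)"
  unfolding poisson_def using norm_one_minus_ge[of _ "cnj z"]
  by (intro continuous_intros) force

lemma measurable_poisson: "z \<in> unit_disk \<Longrightarrow> poisson z \<in> borel_measurable circle_measure"
  by (intro measurable_circle_continuous continuous_on_poisson)

lemma poisson_dilate_commute:
  assumes "norm \<zeta> = 1" "norm \<xi> = 1"
  shows "poisson (of_real r * \<zeta>) \<xi> = poisson (of_real r * \<xi>) \<zeta>"
proof -
  have "norm (1 - of_real r * (cnj \<zeta> * \<xi>)) = norm (cnj (1 - of_real r * (cnj \<zeta> * \<xi>)))"
    by (rule complex_mod_cnj[symmetric])
  then have "norm (1 - cnj (of_real r * \<zeta>) * \<xi>) = norm (1 - cnj (of_real r * \<xi>) * \<zeta>)"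
    by (simp add: mult_ac)
  then show ?thesis
    using assms by (simp add: poisson_def norm_mult)
qed

text \<open>This splitting reduces the reproducing property of the Poisson kernel to orthogonality of the powers of \<open>\<zeta>\<close>:
  the first kernel picks the constant term of an analytic polynomial, the second its value at \<open>z\<close>, and the
  last summand removes the constant term again.\<close>

lemma poisson_eq_cauchy_kernels:
  assumes "z \<in> unit_disk" "\<zeta> \<in> unit_circle"
  shows "of_real (poisson z \<zeta>) = 1 / (1 - cnj z * \<zeta>) + cnj (1 / (1 - cnj z * \<zeta>)) - 1"
proof -
  define a where "a = cnj z * \<zeta>"
  have alg: "1 - a * c = (1 - c) + (1 - a) - (1 - a) * (1 - c)" for c
    by (simp add: algebra_simps)
  have na: "norm a = norm z" using assms by (simp add: a_def norm_mult)
  then have ne: "1 - a \<noteq> 0"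
    using assms by auto
  then have ne': "1 - cnj a \<noteq> 0"
    using complex_cnj_cancel_iff[of a 1] by simp
  have frac: "(v + u - u * v) / (u * v) = 1 / u + 1 / v - 1" if "u \<noteq> 0" "v \<noteq> 0" for u v :: complex
    using that by (simp add: add_divide_distrib diff_divide_distrib)
  have "of_real ((norm (1 - a))\<^sup>2) = (1 - a) * (1 - cnj a)"
    using complex_norm_square[of "1 - a"] by (simp del: of_real_power)
  moreover have "of_real (1 - (norm z)\<^sup>2) = 1 - a * cnj a"
    using complex_norm_square[of a] by (simp add: na del: of_real_power)
  ultimately have "of_real (poisson z \<zeta>) = (1 - a * cnj a) / ((1 - a) * (1 - cnj a))"
    by (simp only: poisson_def a_def of_real_divide)
  also have "1 - a * cnj a = (1 - cnj a) + (1 - a) - (1 - a) * (1 - cnj a)"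
    by (rule alg)
  also have "\<dots> / ((1 - a) * (1 - cnj a)) = 1 / (1 - a) + 1 / (1 - cnj a) - 1"
    by (rule frac[OF ne ne'])
  finally show ?thesis by (simp add: a_def)
qed

lemma integral_poisson_power:
  assumes z: "z \<in> unit_disk"
  shows "(\<integral>\<zeta>. of_real (poisson z \<zeta>) * \<zeta> ^ k \<partial>circle_measure) = z ^ k"
proof -
  note [measurable] = measurable_circle_ident
  define K where "K \<zeta> = 1 / (1 - cnj z * \<zeta>)" for \<zeta>
  have K: "K \<zeta> = (\<Sum>n. cnj z ^ n * \<zeta> ^ n)" if "\<zeta> \<in> unit_circle" for \<zeta>
  proof -
    have "norm (cnj z * \<zeta>) < 1" using that z by (simp add: norm_mult)
    from suminf_geometric[OF this] show ?thesis
      by (simp add: K_def power_mult_distrib)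
  qed
  have cont: "continuous_on unit_circle K"
    unfolding K_def using norm_one_minus_ge[of _ "cnj z"] z by (intro continuous_intros) force
  have summ: "summable (\<lambda>n. norm (cnj z ^ n))"
    using z by (auto simp: norm_power intro!: summable_geometric)
  \<comment> \<open>the analytic kernel sees only the constant term\<close>
  have K1: "(\<integral>\<zeta>. K \<zeta> * \<zeta> ^ k \<partial>circle_measure) = (if k = 0 then 1 else 0)"
  proof -
    have "(\<lambda>n. cnj z ^ n * (\<integral>\<zeta>. \<zeta> ^ n * \<zeta> ^ k \<partial>circle_measure)) sums
        (\<integral>\<zeta>. (\<Sum>n. cnj z ^ n * \<zeta> ^ n) * \<zeta> ^ k \<partial>circle_measure)"
      by (rule integral_circle_power_series[OF summ, where K = 1]) (auto simp: norm_power)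
    moreover have "(\<integral>\<zeta>. (\<Sum>n. cnj z ^ n * \<zeta> ^ n) * \<zeta> ^ k \<partial>circle_measure)
        = (\<integral>\<zeta>. K \<zeta> * \<zeta> ^ k \<partial>circle_measure)"
      by (rule Bochner_Integration.integral_cong) (auto simp: K)
    ultimately have s1: "(\<lambda>n. cnj z ^ n * (\<integral>\<zeta>. \<zeta> ^ n * \<zeta> ^ k \<partial>circle_measure)) sums
        (\<integral>\<zeta>. K \<zeta> * \<zeta> ^ k \<partial>circle_measure)"
      by (simp only:)
    have e1: "(\<lambda>n. cnj z ^ n * (\<integral>\<zeta>. \<zeta> ^ n * \<zeta> ^ k \<partial>circle_measure))
        = (\<lambda>n. if n = 0 then (if k = 0 then 1 else 0) else 0)"
    proof
      fix n
      have "(\<integral>\<zeta>. \<zeta> ^ n * \<zeta> ^ k \<partial>circle_measure) = (if n + k = 0 then 1 else 0)"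
        using integral_circle_power[of "n + k" 0] by (simp add: power_add)
      then show "cnj z ^ n * (\<integral>\<zeta>. \<zeta> ^ n * \<zeta> ^ k \<partial>circle_measure)
          = (if n = 0 then (if k = 0 then 1 else 0) else 0)"
        by simp
    qed
    have "(\<lambda>n. if n = 0 then (if k = 0 then 1 else 0) else 0) sums (if k = 0 then 1 else (0 :: complex))"
      by (rule sums_single)
    with s1 show ?thesis
      unfolding e1 by (rule sums_unique2)
  qed
  \<comment> \<open>computed through its conjugate, which is again a power series in \<open>\<zeta>\<close>\<close>
  have K2: "(\<integral>\<zeta>. cnj (K \<zeta>) * \<zeta> ^ k \<partial>circle_measure) = z ^ k"
  proof -
    have "(\<lambda>n. cnj z ^ n * (\<integral>\<zeta>. \<zeta> ^ n * cnj \<zeta> ^ k \<partial>circle_measure)) sums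
        (\<integral>\<zeta>. (\<Sum>n. cnj z ^ n * \<zeta> ^ n) * cnj \<zeta> ^ k \<partial>circle_measure)"
      by (rule integral_circle_power_series[OF summ, where K = 1])
         (auto intro!: measurable_circle_continuous continuous_intros simp: norm_power)
    moreover have "(\<integral>\<zeta>. (\<Sum>n. cnj z ^ n * \<zeta> ^ n) * cnj \<zeta> ^ k \<partial>circle_measure)
        = (\<integral>\<zeta>. cnj (cnj (K \<zeta>) * \<zeta> ^ k) \<partial>circle_measure)"
      by (rule Bochner_Integration.integral_cong) (auto simp: K)
    moreover have "\<dots> = cnj (\<integral>\<zeta>. cnj (K \<zeta>) * \<zeta> ^ k \<partial>circle_measure)"
      by (rule Bochner_Integration.integral_cnj)
    ultimately have s2: "(\<lambda>n. cnj z ^ n * (\<integral>\<zeta>. \<zeta> ^ n * cnj \<zeta> ^ k \<partial>circle_measure)) sums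
        cnj (\<integral>\<zeta>. cnj (K \<zeta>) * \<zeta> ^ k \<partial>circle_measure)"
      by (simp only:)
    have e2: "(\<lambda>n. cnj z ^ n * (\<integral>\<zeta>. \<zeta> ^ n * cnj \<zeta> ^ k \<partial>circle_measure))
        = (\<lambda>n. if n = k then cnj z ^ n else 0)"
      by (auto simp: integral_circle_power)
    have "(\<lambda>n. if n = k then cnj z ^ n else 0) sums (cnj z ^ k)"
      by (rule sums_single)
    with s2 have "cnj (\<integral>\<zeta>. cnj (K \<zeta>) * \<zeta> ^ k \<partial>circle_measure) = cnj z ^ k"
      unfolding e2 by (rule sums_unique2)
    then have "cnj (cnj (\<integral>\<zeta>. cnj (K \<zeta>) * \<zeta> ^ k \<partial>circle_measure)) = cnj (cnj z ^ k)"
      by simp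
    then show ?thesis by simp
  qed
  have K3: "(\<integral>\<zeta>. \<zeta> ^ k \<partial>circle_measure) = (if k = 0 then 1 else 0)"
    using integral_circle_power[of k 0] by simp
  have "(\<integral>\<zeta>. of_real (poisson z \<zeta>) * \<zeta> ^ k \<partial>circle_measure)
      = (\<integral>\<zeta>. (K \<zeta> * \<zeta> ^ k + cnj (K \<zeta>) * \<zeta> ^ k) - \<zeta> ^ k \<partial>circle_measure)"
    by (rule Bochner_Integration.integral_cong)
       (auto simp: poisson_eq_cauchy_kernels[OF z] K_def left_diff_distrib distrib_right)
  also have "\<dots> = (\<integral>\<zeta>. K \<zeta> * \<zeta> ^ k \<partial>circle_measure) + (\<integral>\<zeta>. cnj (K \<zeta>) * \<zeta> ^ k \<partial>circle_measure)
      - (\<integral>\<zeta>. \<zeta> ^ k \<partial>circle_measure)"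
  proof -
    have "integrable circle_measure (\<lambda>\<zeta>. K \<zeta> * \<zeta> ^ k)"
      "integrable circle_measure (\<lambda>\<zeta>. cnj (K \<zeta>) * \<zeta> ^ k)"
      "integrable circle_measure (\<lambda>\<zeta>. \<zeta> ^ k)"
      by (intro integrable_circle_continuous continuous_intros cont)+
    then show ?thesis by simp
  qed
  also have "\<dots> = z ^ k"
    by (simp add: K1 K2 K3)
  finally show ?thesis .
qed

lemma integral_poisson_poly:
  assumes z: "z \<in> unit_disk"
  shows "(\<integral>\<zeta>. of_real (poisson z \<zeta>) * poly q \<zeta> \<partial>circle_measure) = poly q z"
proof -
  have "(\<integral>\<zeta>. of_real (poisson z \<zeta>) * poly q \<zeta> \<partial>circle_measure)
      = (\<integral>\<zeta>. (\<Sum>i\<le>degree q. coeff q i * (of_real (poisson z \<zeta>) * \<zeta> ^ i)) \<partial>circle_measure)"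
    unfolding poly_altdef by (simp add: sum_distrib_left mult_ac)
  also have "\<dots> = (\<Sum>i\<le>degree q. coeff q i * (\<integral>\<zeta>. of_real (poisson z \<zeta>) * \<zeta> ^ i \<partial>circle_measure))"
  proof (subst Bochner_Integration.integral_sum)
    fix i
    show "integrable circle_measure (\<lambda>\<zeta>. coeff q i * (of_real (poisson z \<zeta>) * \<zeta> ^ i))"
      using continuous_on_poisson[OF z]
      by (intro integrable_circle_continuous continuous_intros)
  qed simp
  also have "\<dots> = poly q z"
    unfolding poly_altdef integral_poisson_power[OF z] ..
  finally show ?thesis .
qed

lemma integral_poisson_Re_poly:
  assumes z: "z \<in> unit_disk"
  shows "(\<integral>\<zeta>. poisson z \<zeta> * Re (poly q \<zeta>) \<partial>circle_measure) = Re (poly q z)"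
proof -
  have "integrable circle_measure (\<lambda>\<zeta>. complex_of_real (poisson z \<zeta>) * poly q \<zeta>)"
    using continuous_on_poisson[OF z] by (intro integrable_circle_continuous continuous_intros)
  from integral_Re[OF this] show ?thesis
    by (simp add: integral_poisson_poly[OF z])
qed

lemma integral_poisson:
  assumes z: "z \<in> unit_disk"
  shows "(\<integral>\<zeta>. poisson z \<zeta> \<partial>circle_measure) = 1"
  using integral_poisson_Re_poly[OF z, of 1] by simp

lemma nn_integral_poisson:
  assumes z: "z \<in> unit_disk"
  shows "(\<integral>\<^sup>+\<zeta>. ennreal (poisson z \<zeta>) \<partial>circle_measure) = 1"
  using nn_integral_eq_integral[OF integrable_circle_continuous[OF continuous_on_poisson[OF z]]]
    poisson_nonneg[OF z] by (simp add: integral_poisson[OF z])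

text \<open>Real trigonometric polynomials, described as functions that agree on the circle with the real part of an
  analytic polynomial: this is the form in which they extend harmonically to the disk.\<close>

definition trig_polys :: "(complex \<Rightarrow> real) set" where
  "trig_polys = {h. \<exists>q. \<forall>\<zeta>\<in>unit_circle. h \<zeta> = Re (poly q \<zeta>)}"

lemma trig_polys_add: "g \<in> trig_polys \<Longrightarrow> h \<in> trig_polys \<Longrightarrow> (\<lambda>\<zeta>. g \<zeta> + h \<zeta>) \<in> trig_polys"
proof -
  assume "g \<in> trig_polys" "h \<in> trig_polys"
  then obtain p q where "\<forall>\<zeta>\<in>unit_circle. g \<zeta> = Re (poly p \<zeta>)" "\<forall>\<zeta>\<in>unit_circle. h \<zeta> = Re (poly q \<zeta>)"
    unfolding trig_polys_def by blast
  then have "\<forall>\<zeta>\<in>unit_circle. g \<zeta> + h \<zeta> = Re (poly (p + q) \<zeta>)"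
    by simp
  then show ?thesis
    unfolding trig_polys_def by blast
qed

lemma trig_polys_sum:
  assumes "finite I" "\<And>i. i \<in> I \<Longrightarrow> h i \<in> trig_polys"
  shows "(\<lambda>\<zeta>. \<Sum>i\<in>I. h i \<zeta>) \<in> trig_polys"
  using assms
proof (induction I rule: finite_induct)
  case empty
  then show ?case by (auto simp: trig_polys_def intro!: exI[of _ 0])
next
  case (insert i I)
  then show ?case by (simp add: trig_polys_add)
qed

text \<open>On the circle \<open>cnj (\<zeta>\<^sup>k) = \<zeta>\<^sup>-\<^sup>k\<close>, so for \<open>k \<le> j\<close> the product of the two real parts is half the real part of
  \<open>a b \<zeta>\<^sup>j\<^sup>+\<^sup>k + cnj a b \<zeta>\<^sup>j\<^sup>-\<^sup>k\<close>.\<close>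

lemma trig_polys_mult_monomials:
  "(\<lambda>\<zeta>. Re (a * \<zeta> ^ j) * Re (b * \<zeta> ^ k)) \<in> trig_polys"
proof (induction j k arbitrary: a b rule: linorder_wlog)
  case (le k j)
  define q where "q = monom (b * a / 2) (j + k) + monom (b * cnj a / 2) (j - k)"
  have "Re (a * \<zeta> ^ k) * Re (b * \<zeta> ^ j) = Re (poly q \<zeta>)" if \<zeta>: "\<zeta> \<in> unit_circle" for \<zeta>
  proof -
    have "\<zeta> * cnj \<zeta> = 1"
      using \<zeta> by (simp add: complex_norm_square[symmetric])
    then have "\<zeta> ^ k * cnj \<zeta> ^ k = 1"
      by (simp flip: power_mult_distrib)
    then have "\<zeta> ^ j * cnj \<zeta> ^ k = \<zeta> ^ (j - k)"
      using le by (metis le_add_diff_inverse2 mult.assoc mult.right_neutral power_add)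
    then have "poly q \<zeta> = b * a / 2 * \<zeta> ^ (j + k) + b * cnj a / 2 * (\<zeta> ^ j * cnj \<zeta> ^ k)"
      by (simp add: q_def poly_monom)
    also have "\<dots> = (b * \<zeta> ^ j) * ((a * \<zeta> ^ k + cnj (a * \<zeta> ^ k)) / 2)"
      by (simp add: power_add distrib_left add_divide_distrib mult_ac)
    also have "\<dots> = (b * \<zeta> ^ j) * of_real (Re (a * \<zeta> ^ k))"
      by (simp only: complex_add_cnj) simp
    finally show ?thesis by simp
  qed
  then show ?case unfolding trig_polys_def by blast
next
  case (sym k j)
  from sym[of b a] show ?case by (simp add: mult.commute)
qed

lemma trig_polys_mult:
  assumes "g \<in> trig_polys" "h \<in> trig_polys"
  shows "(\<lambda>\<zeta>. g \<zeta> * h \<zeta>) \<in> trig_polys"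
proof -
  obtain p q where pq: "\<And>\<zeta>. \<zeta> \<in> unit_circle \<Longrightarrow> g \<zeta> = Re (poly p \<zeta>)"
      "\<And>\<zeta>. \<zeta> \<in> unit_circle \<Longrightarrow> h \<zeta> = Re (poly q \<zeta>)"
    using assms unfolding trig_polys_def by blast
  have "(\<lambda>\<zeta>. \<Sum>i\<le>degree p. \<Sum>j\<le>degree q. Re (coeff p i * \<zeta> ^ i) * Re (coeff q j * \<zeta> ^ j)) \<in> trig_polys"
    by (intro trig_polys_sum trig_polys_mult_monomials) auto
  moreover have "g \<zeta> * h \<zeta> = (\<Sum>i\<le>degree p. \<Sum>j\<le>degree q. Re (coeff p i * \<zeta> ^ i) * Re (coeff q j * \<zeta> ^ j))"
    if "\<zeta> \<in> unit_circle" for \<zeta>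
    by (simp only: pq[OF that] poly_altdef Re_sum sum_product)
  ultimately show ?thesis
    unfolding trig_polys_def by simp
qed

lemma trig_polys_dense:
  assumes "continuous_on unit_circle (U :: complex \<Rightarrow> real)" "0 < e"
  obtains q where "\<And>\<zeta>. \<zeta> \<in> unit_circle \<Longrightarrow> \<bar>U \<zeta> - Re (poly q \<zeta>)\<bar> < e"
proof -
  interpret function_ring_on trig_polys unit_circle
  proof
    fix f assume "f \<in> trig_polys"
    then obtain q where "\<And>\<zeta>. \<zeta> \<in> unit_circle \<Longrightarrow> f \<zeta> = Re (poly q \<zeta>)"
      unfolding trig_polys_def by blast
    then show "continuous_on unit_circle f"
      by (subst continuous_on_cong[OF refl]) (auto intro!: continuous_intros)
  next
    fix x y :: complex assume xy: "x \<noteq> y"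
    have mem: "(\<lambda>\<zeta>. Re (poly [:0, c:] \<zeta>)) \<in> trig_polys" for c
      unfolding trig_polys_def by blast
    have "Re x \<noteq> Re y \<or> Im x \<noteq> Im y"
      using xy by (simp add: complex_eq_iff)
    then show "\<exists>f\<in>trig_polys. f x \<noteq> f y"
      using mem[of 1] mem[of \<i>] 
    proof (elim disjE)
      assume "Im x \<noteq> Im y" then show ?thesis
        using mem[of \<i>] by (intro bexI[of _ "\<lambda>\<zeta>. - Im \<zeta>"]) simp_all
    qed (use mem[of 1] in \<open>auto intro!: bexI[of _ Re]\<close>)
  next
    fix c
    show "(\<lambda>_. c) \<in> trig_polys"
      unfolding trig_polys_def by (intro CollectI exI[of _ "[:of_real c:]"]) simp
  qed (auto intro: trig_polys_add trig_polys_mult)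
  from Stone_Weierstrass_basic[OF assms] obtain g
    where "g \<in> trig_polys" "\<forall>\<zeta>\<in>unit_circle. \<bar>U \<zeta> - g \<zeta>\<bar> < e" by blast
  moreover from this obtain q where "\<forall>\<zeta>\<in>unit_circle. g \<zeta> = Re (poly q \<zeta>)"
    unfolding trig_polys_def by blast
  ultimately show ?thesis
    by (intro that[of q]) simp
qed

text \<open>By Stone-Weierstrass there is a polynomial \<open>q\<close> whose real part is within \<open>e/2\<close> of \<open>log\<^sup>+ |g|\<close> on the circle. Then
  \<open>g exp(-q)\<close> has modulus at most \<open>exp(e/2)\<close> on the circle, hence in the disk, so \<open>log |g(z)| \<le> Re q(z) + e/2\<close>; and
  \<open>Re q(z)\<close> is the Poisson integral of its boundary values.\<close>

lemma log_plus_le_poisson_integral: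
  assumes g: "g holomorphic_on ball 0 R" "1 < R" and z: "z \<in> unit_disk"
  shows "log_plus (norm (g z)) \<le> (\<integral>\<zeta>. poisson z \<zeta> * log_plus (norm (g \<zeta>)) \<partial>circle_measure)"
proof (rule field_le_epsilon)
  fix e :: real assume e: "0 < e"
  define U where "U \<zeta> = log_plus (norm (g \<zeta>))" for \<zeta>
  have cball: "cball 0 1 \<subseteq> ball (0::complex) R" using g(2) by auto
  have contg: "continuous_on (cball 0 1) g"
    using holomorphic_on_subset[OF g(1) cball] by (rule holomorphic_on_imp_continuous_on)
  have U: "continuous_on unit_circle U"
    unfolding U_def
    by (intro continuous_on_compose2[OF continuous_log_plus] continuous_intros
        continuous_on_subset[OF contg]) auto
  obtain q where q: "\<And>\<zeta>. \<zeta> \<in> unit_circle \<Longrightarrow> \<bar>U \<zeta> - Re (poly q \<zeta>)\<bar> < e / 2"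
    using trig_polys_dense[OF U, of "e / 2"] e by auto
  have "norm (g z * exp (- poly q z)) \<le> exp (e / 2)"
  proof (rule maximum_modulus_frontier[of "\<lambda>z. g z * exp (- poly q z)" "cball 0 1"])
    show "(\<lambda>z. g z * exp (- poly q z)) holomorphic_on interior (cball 0 1)"
      using g(2) by (auto intro!: holomorphic_intros holomorphic_on_subset[OF g(1)])
    show "continuous_on (closure (cball 0 1)) (\<lambda>z. g z * exp (- poly q z))"
      using contg by (auto intro!: continuous_intros)
    fix \<zeta> assume "\<zeta> \<in> frontier (cball (0::complex) 1)"
    then have \<zeta>: "\<zeta> \<in> unit_circle" by simp
    have "norm (g \<zeta>) \<le> exp (U \<zeta>)"
      unfolding U_def by (rule norm_le_exp_log_plus)
    then have "norm (g \<zeta> * exp (- poly q \<zeta>)) \<le> exp (U \<zeta>) * exp (- Re (poly q \<zeta>))"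
      by (simp add: norm_mult)
    also have "\<dots> = exp (U \<zeta> - Re (poly q \<zeta>))"
      by (simp flip: exp_add)
    also have "\<dots> \<le> exp (e / 2)"
      using q[OF \<zeta>] by (subst exp_le_cancel_iff) linarith
    finally show "norm (g \<zeta> * exp (- poly q \<zeta>)) \<le> exp (e / 2)" .
  qed (use z in auto)
  then have *: "norm (g z) \<le> exp (e / 2 + Re (poly q z))"
    by (simp add: exp_minus exp_add divide_inverse[symmetric] norm_divide pos_divide_le_eq)
  have intU: "integrable circle_measure (\<lambda>\<zeta>. poisson z \<zeta> * U \<zeta>)"
    by (intro integrable_circle_continuous continuous_intros continuous_on_poisson U z)
  have "Re (poly q z) = (\<integral>\<zeta>. poisson z \<zeta> * Re (poly q \<zeta>) \<partial>circle_measure)"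
    by (rule integral_poisson_Re_poly[OF z, symmetric])
  also have "\<dots> \<le> (\<integral>\<zeta>. poisson z \<zeta> * U \<zeta> + e / 2 * poisson z \<zeta> \<partial>circle_measure)"
  proof (rule integral_mono)
    show "integrable circle_measure (\<lambda>\<zeta>. poisson z \<zeta> * Re (poly q \<zeta>))"
      by (intro integrable_circle_continuous continuous_intros continuous_on_poisson z)
    show "integrable circle_measure (\<lambda>\<zeta>. poisson z \<zeta> * U \<zeta> + e / 2 * poisson z \<zeta>)"
      by (intro integrable_circle_continuous continuous_intros continuous_on_poisson U z)
    fix \<zeta> assume "\<zeta> \<in> space circle_measure"
    then have "poisson z \<zeta> * Re (poly q \<zeta>) \<le> poisson z \<zeta> * (U \<zeta> + e / 2)"
      using q[of \<zeta>, unfolded abs_less_iff] by (intro mult_left_mono poisson_nonneg z) simp_all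
    then show "poisson z \<zeta> * Re (poly q \<zeta>) \<le> poisson z \<zeta> * U \<zeta> + e / 2 * poisson z \<zeta>"
      by (simp add: algebra_simps)
  qed
  also have "\<dots> = (\<integral>\<zeta>. poisson z \<zeta> * U \<zeta> \<partial>circle_measure) + e / 2"
    by (subst Bochner_Integration.integral_add)
       (auto intro!: intU integrable_circle_continuous continuous_intros continuous_on_poisson z
         simp: integral_poisson[OF z])
  finally have **: "Re (poly q z) \<le> (\<integral>\<zeta>. poisson z \<zeta> * U \<zeta> \<partial>circle_measure) + e / 2" .
  show "log_plus (norm (g z)) \<le> (\<integral>\<zeta>. poisson z \<zeta> * log_plus (norm (g \<zeta>)) \<partial>circle_measure) + e"
  proof (cases "norm (g z) \<le> 1")
    case True
    then have "log_plus (norm (g z)) = 0"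
      by (cases "g z = 0") (auto simp: log_plus_def max_def)
    moreover have "0 \<le> (\<integral>\<zeta>. poisson z \<zeta> * log_plus (norm (g \<zeta>)) \<partial>circle_measure)"
      by (intro Bochner_Integration.integral_nonneg mult_nonneg_nonneg poisson_nonneg z log_plus_nonneg)
    ultimately show ?thesis using e by simp
  next
    case False
    then have "ln (norm (g z)) \<le> ln (exp (e / 2 + Re (poly q z)))"
      using * by (intro ln_mono) auto
    then have "ln (norm (g z)) \<le> e / 2 + Re (poly q z)"
      by simp
    then show ?thesis
      using ** False by (simp add: log_plus_def U_def)
  qed
qed

lemma smirnov_log_plus_le:
  assumes f: "f \<in> smirnov_class" and z: "z \<in> unit_disk"
  shows "ennreal (log_plus (norm (f z)))
    \<le> (\<integral>\<^sup>+\<zeta>. ennreal (poisson z \<zeta> * log_plus (norm (boundary_fun f \<zeta>))) \<partial>circle_measure)"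
proof (rule smirnov_kernel_ge[OF f measurable_poisson[OF z] poisson_nonneg[OF z] poisson_le[OF z]])
  have hol: "f holomorphic_on unit_disk"
    using f by (simp add: smirnov_class_def nevanlinna_class_def)
  have "isCont f z"
    using holomorphic_on_imp_continuous_on[OF hol] z by (simp add: continuous_on_eq_continuous_at)
  moreover have "(\<lambda>n. of_real (radius_seq n) * z) \<longlonglongrightarrow> of_real 1 * z"
    by (intro tendsto_intros radius_seq_tendsto)
  ultimately show "(\<lambda>n. log_plus (norm (f (of_real (radius_seq n) * z)))) \<longlonglongrightarrow> log_plus (norm (f z))"
    by (intro tendsto_log_plus_norm isCont_tendsto_compose[of _ f]) auto
  fix n
  show "0 \<le> log_plus (norm (f (of_real (radius_seq n) * z)))"
    by (rule log_plus_nonneg)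
  let ?r = "radius_seq n"
  let ?g = "\<lambda>w. f (of_real ?r * w)"
  have r: "0 < ?r" "?r < 1" by (rule radius_seq)+
  have g: "?g holomorphic_on ball 0 (1 / ?r)"
  proof (rule holomorphic_on_compose_gen[OF _ hol, unfolded o_def])
    show "(\<lambda>w. of_real ?r * w) ` ball 0 (1 / ?r) \<subseteq> unit_disk"
      using r by (auto simp: norm_mult field_simps)
  qed (intro holomorphic_intros)
  have "continuous_on (cball 0 1) ?g"
  proof (intro holomorphic_on_imp_continuous_on holomorphic_on_subset[OF g] subsetI)
    fix w :: complex assume "w \<in> cball 0 1"
    moreover have "1 < 1 / ?r" using r by simp
    ultimately show "w \<in> ball 0 (1 / ?r)" by simp
  qed
  then have cont: "continuous_on unit_circle ?g"
    by (rule continuous_on_subset) auto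
  have "integrable circle_measure (\<lambda>\<zeta>. poisson z \<zeta> * log_plus (norm (?g \<zeta>)))"
    by (intro integrable_circle_continuous continuous_on_mult continuous_on_poisson z
        continuous_on_compose2[OF continuous_log_plus] continuous_on_norm cont) auto
  then have "(\<integral>\<^sup>+\<zeta>. ennreal (poisson z \<zeta> * log_plus (norm (?g \<zeta>))) \<partial>circle_measure)
      = ennreal (\<integral>\<zeta>. poisson z \<zeta> * log_plus (norm (?g \<zeta>)) \<partial>circle_measure)"
    by (rule nn_integral_eq_integral) (auto intro!: mult_nonneg_nonneg poisson_nonneg z log_plus_nonneg)
  then show "ennreal (log_plus (norm (?g z)))
      \<le> (\<integral>\<^sup>+\<zeta>. ennreal (poisson z \<zeta> * log_plus (norm (?g \<zeta>))) \<partial>circle_measure)"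
    using log_plus_le_poisson_integral[OF g _ z] r by (simp add: ennreal_leI)
qed


section \<open>Integral means of weak Hardy functions\<close>

text \<open>A bound on \<open>f\<^sup>* s powr (1/p)\<close> is a bound on the tails of the boundary function: if the tail at \<open>x\<close> exceeded
  \<open>s = (c/x) powr p\<close>, then the rearrangement at \<open>s\<close> would be at least \<open>x\<close>, and \<open>x s powr (1/p) = c\<close> would exceed the
  supremum. At levels \<open>x < 1\<close> the maximum with 1 has full measure, and there \<open>x powr (-p) \<ge> 1\<close>.\<close>

lemma weak_hardy_tail:
  assumes f: "f \<in> weak_hardy p" and p: "0 < p"
  obtains A where "1 \<le> A" "\<And>x. 0 < x \<Longrightarrow>
    emeasure circle_measure {\<zeta>\<in>space circle_measure. x < max 1 (norm (boundary_fun f \<zeta>))}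
      \<le> ennreal (A * x powr (- p))"
proof -
  define C where
    "C = (SUP s\<in>{0<..}. decreasing_rearrangement (boundary_fun f) s * ennreal (s powr (1 / p)))"
  have C: "C < \<infinity>" and hol: "f holomorphic_on unit_disk"
    using f by (auto simp: weak_hardy_def smirnov_class_def nevanlinna_class_def C_def)
  define c where "c = enn2real C + 1"
  have c: "0 < c" "C < ennreal c"
  proof -
    show "0 < c" using enn2real_nonneg[of C] unfolding c_def by linarith
    have "C = ennreal (enn2real C)" using C by simp
    also have "\<dots> < ennreal c" by (simp add: c_def ennreal_less_iff)
    finally show "C < ennreal c" .
  qed
  have meas: "boundary_fun f \<in> borel_measurable circle_measure"
    by (intro measurable_boundary_fun holomorphic_on_imp_continuous_on hol)
  have sets: "{\<zeta>\<in>unit_circle. t < norm (boundary_fun f \<zeta>)} \<in> sets circle_measure" for t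
  proof -
    have "{\<zeta>\<in>space circle_measure. t < norm (boundary_fun f \<zeta>)} \<in> sets circle_measure"
      using meas by measurable
    then show ?thesis by simp
  qed
  have dist: "distribution_fun (boundary_fun f) x \<le> c powr p * x powr (- p)" if x: "0 < x" for x
  proof (rule ccontr)
    assume "\<not> ?thesis"
    then have gt: "c powr p * x powr (- p) < distribution_fun (boundary_fun f) x" by simp
    define s where "s = c powr p * x powr (- p)"
    have s: "0 < s" using c x by (simp add: s_def)
    have root: "s powr (1 / p) = c / x"
    proof -
      have "s = (c / x) powr p"
        using c x by (simp add: s_def powr_divide powr_minus_divide)
      then show ?thesis using c x p by (simp add: powr_powr)
    qed
    have "ennreal x \<le> decreasing_rearrangement (boundary_fun f) s"
      unfolding decreasing_rearrangement_def
    proof (rule INF_greatest)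
      fix t assume t: "t \<in> {t. 0 \<le> t \<and> distribution_fun (boundary_fun f) t \<le> s}"
      have "x \<le> t"
      proof (rule ccontr)
        assume "\<not> x \<le> t"
        then have "distribution_fun (boundary_fun f) x \<le> distribution_fun (boundary_fun f) t"
          unfolding distribution_fun_def by (intro circle.finite_measure_mono sets) auto
        with t gt show False by (simp add: s_def)
      qed
      then show "ennreal x \<le> ennreal t" by (rule ennreal_leI)
    qed
    then have "ennreal x * ennreal (c / x)
        \<le> decreasing_rearrangement (boundary_fun f) s * ennreal (s powr (1 / p))"
      unfolding root by (intro mult_right_mono) auto
    also have "\<dots> \<le> C"
      unfolding C_def using s by (intro SUP_upper) auto
    finally have "ennreal c \<le> C"
      using x c by (simp flip: ennreal_mult)
    with c show False by simp
  qed
  show ?thesis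
  proof (rule that[of "max 1 (c powr p)"])
    fix x :: real assume x: "0 < x"
    show "emeasure circle_measure {\<zeta>\<in>space circle_measure. x < max 1 (norm (boundary_fun f \<zeta>))}
      \<le> ennreal (max 1 (c powr p) * x powr (- p))"
    proof (cases "x < 1")
      case True
      have "1 powr p * x powr (- p) \<le> max 1 (c powr p) * x powr (- p)"
        by (intro mult_right_mono) auto
      moreover have "1 \<le> x powr (- p)"
        using powr_mono2'[of "- p" x 1] x p True by simp
      ultimately have "1 \<le> max 1 (c powr p) * x powr (- p)" by simp
      then show ?thesis
        unfolding emeasure_circle_eq_measure
        by (intro ennreal_leI) (meson circle.prob_le_1 order_trans)
    next
      case False
      then have "{\<zeta>\<in>space circle_measure. x < max 1 (norm (boundary_fun f \<zeta>))}
          = {\<zeta>\<in>unit_circle. x < norm (boundary_fun f \<zeta>)}"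
        by auto
      moreover have "c powr p * x powr (- p) \<le> max 1 (c powr p) * x powr (- p)"
        by (intro mult_right_mono) auto
      ultimately show ?thesis
        using dist[OF x] unfolding emeasure_circle_eq_measure distribution_fun_def
        by (intro ennreal_leI) simp
    qed
  qed simp
qed

text \<open>Jensen's inequality for the probability density \<open>k\<close>, from the tangent line of \<open>exp\<close> at \<open>t\<close>. The term with a
  negative sign is moved to the other side, so that all integrals are of nonnegative functions and may be
  infinite.\<close>

lemma exp_le_nn_integral_exp:
  fixes k X :: "'a \<Rightarrow> real"
  assumes [measurable]: "k \<in> borel_measurable M" "X \<in> borel_measurable M"
    and k: "\<And>x. x \<in> space M \<Longrightarrow> 0 \<le> k x" "(\<integral>\<^sup>+x. ennreal (k x) \<partial>M) = 1"
    and X: "\<And>x. x \<in> space M \<Longrightarrow> 0 \<le> X x"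
    and t: "0 \<le> t" "ennreal t \<le> (\<integral>\<^sup>+x. ennreal (k x * X x) \<partial>M)"
  shows "ennreal (exp t) \<le> (\<integral>\<^sup>+x. ennreal (k x * exp (X x)) \<partial>M)"
proof -
  have "ennreal (exp t) + ennreal (exp t) * ennreal t
      \<le> ennreal (exp t) * (\<integral>\<^sup>+x. ennreal (k x) \<partial>M) + ennreal (exp t) * (\<integral>\<^sup>+x. ennreal (k x * X x) \<partial>M)"
    using t k by (intro add_mono mult_left_mono) auto
  also have "\<dots> = (\<integral>\<^sup>+x. ennreal (exp t) * ennreal (k x) + ennreal (exp t) * ennreal (k x * X x) \<partial>M)"
    by (subst nn_integral_add) (auto simp: nn_integral_cmult)
  also have "\<dots> \<le> (\<integral>\<^sup>+x. ennreal (k x * exp (X x)) + ennreal (exp t * t) * ennreal (k x) \<partial>M)"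
  proof (rule nn_integral_mono)
    fix x assume x: "x \<in> space M"
    have "exp t * (1 + (X x - t)) \<le> exp t * exp (X x - t)"
      by (intro mult_left_mono exp_ge_add_one_self) auto
    also have "\<dots> = exp (X x)" by (simp flip: exp_add)
    finally have "k x * (exp t * (1 + (X x - t))) \<le> k x * exp (X x)"
      by (intro mult_left_mono k x)
    then have "exp t * k x + exp t * (k x * X x) \<le> k x * exp (X x) + exp t * t * k x"
      by (simp add: algebra_simps)
    then have "ennreal (exp t * k x + exp t * (k x * X x)) \<le> ennreal (k x * exp (X x) + exp t * t * k x)"
      by (rule ennreal_leI)
    then show "ennreal (exp t) * ennreal (k x) + ennreal (exp t) * ennreal (k x * X x)
        \<le> ennreal (k x * exp (X x)) + ennreal (exp t * t) * ennreal (k x)"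
      using k(1)[OF x] X[OF x] t by (simp add: ennreal_plus ennreal_mult)
  qed
  also have "\<dots> = (\<integral>\<^sup>+x. ennreal (k x * exp (X x)) \<partial>M) + ennreal (exp t * t)"
    using k by (subst nn_integral_add) (auto simp: nn_integral_cmult)
  finally have "ennreal (exp t * t) + ennreal (exp t)
      \<le> ennreal (exp t * t) + (\<integral>\<^sup>+x. ennreal (k x * exp (X x)) \<partial>M)"
    using t by (simp add: ennreal_mult add.commute)
  then show ?thesis
    by (simp add: ennreal_add_left_cancel_le)
qed

text \<open>With \<open>w = max(1,|g|)\<close> for the boundary function \<open>g\<close>, write \<open>log w = X\<^sub>1 + X\<^sub>2\<close> with \<open>X\<^sub>1 = log\<^sup>+ (w/H)\<close> and
  \<open>X\<^sub>2 = log min(w,H)\<close>. Since \<open>X\<^sub>1 \<le> (2/p) (w/H) powr (p/2)\<close> where \<open>w > H\<close> and the Poisson kernel is at most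
  \<open>2/(1-r)\<close>, the Poisson integral of \<open>X\<^sub>1\<close> is at most a constant multiple of \<open>H powr (-p)/(1-r)\<close>; the height \<open>H\<close> is
  chosen to make this quotient 1. Jensen's inequality takes care of \<open>X\<^sub>2\<close>.\<close>

lemma smirnov_norm_le_truncated:
  fixes p r A :: real
  assumes f: "f \<in> smirnov_class" and p: "0 < p" and r: "0 < r" "r < 1"
    and A: "0 \<le> A" "\<And>x. 0 < x \<Longrightarrow>
      emeasure circle_measure {\<zeta>\<in>space circle_measure. x < max 1 (norm (boundary_fun f \<zeta>))}
        \<le> ennreal (A * x powr (- p))"
    and z: "norm z = r"
  shows "ennreal (norm (f z)) \<le> ennreal (exp (4 * A * weak_const (p / 2) p / p)) *
    (\<integral>\<^sup>+\<zeta>. ennreal (poisson z \<zeta> * min (max 1 (norm (boundary_fun f \<zeta>))) ((1 - r) powr (- (1 / p)))) \<partial>circle_measure)"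
proof -
  define H where "H = (1 - r) powr (- (1 / p))"
  define w where "w \<zeta> = max 1 (norm (boundary_fun f \<zeta>))" for \<zeta>
  define B where "B = 4 * A * weak_const (p / 2) p / p"
  have hol: "f holomorphic_on unit_disk"
    using f by (simp add: smirnov_class_def nevanlinna_class_def)
  have bf [measurable]: "boundary_fun f \<in> borel_measurable circle_measure"
    by (intro measurable_boundary_fun holomorphic_on_imp_continuous_on hol)
  have w [measurable]: "w \<in> borel_measurable circle_measure"
    unfolding w_def by measurable
  have zd: "z \<in> unit_disk" using z r by simp
  note [measurable] = measurable_poisson[OF zd]
  have H1: "1 \<le> H"
    using powr_mono2'[of "- (1 / p)" "1 - r" 1] r p by (simp add: H_def)
  \<comment> \<open>this identity is the reason for the choice of \<open>H\<close>\<close>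
  have Hp: "H powr (- p) = 1 - r"
    using r p by (simp add: H_def powr_powr)
  have w1: "1 \<le> w \<zeta>" for \<zeta> by (simp add: w_def)
  have B0: "0 \<le> B"
    unfolding B_def using p A weak_const_nonneg[of "p / 2" p] by (intro divide_nonneg_pos) auto
  define X2 where "X2 \<zeta> = ln (min (w \<zeta>) H)" for \<zeta>
  define X1 where "X1 \<zeta> = ln (max 1 (w \<zeta> / H))" for \<zeta>
  have [measurable]: "X1 \<in> borel_measurable circle_measure" "X2 \<in> borel_measurable circle_measure"
    unfolding X1_def X2_def by measurable
  have X0: "0 \<le> X1 \<zeta>" "0 \<le> X2 \<zeta>" for \<zeta>
    using w1[of \<zeta>] H1 by (auto simp: X1_def X2_def)
  have split: "log_plus (norm (boundary_fun f \<zeta>)) = X1 \<zeta> + X2 \<zeta>" for \<zeta>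
  proof -
    have "log_plus (norm (boundary_fun f \<zeta>)) = ln (w \<zeta>)"
      by (simp add: log_plus_eq w_def)
    also have "w \<zeta> = max 1 (w \<zeta> / H) * min (w \<zeta>) H"
      using H1 w1[of \<zeta>] by (auto simp: max_def min_def field_simps)
    also have "ln \<dots> = X1 \<zeta> + X2 \<zeta>"
      unfolding X1_def X2_def using H1 w1[of \<zeta>] by (intro ln_mult_pos) auto
    finally show ?thesis .
  qed
  have X1: "(\<integral>\<^sup>+\<zeta>. ennreal (poisson z \<zeta> * X1 \<zeta>) \<partial>circle_measure) \<le> ennreal B"
  proof -
    have "(\<integral>\<^sup>+\<zeta>. ennreal (poisson z \<zeta> * X1 \<zeta>) \<partial>circle_measure)
        \<le> (\<integral>\<^sup>+\<zeta>. ennreal (4 / ((1 - r) * p) * H powr (- (p / 2)))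
              * (ennreal (w \<zeta> powr (p / 2)) * indicator {\<zeta>. H < w \<zeta>} \<zeta>) \<partial>circle_measure)"
    proof (rule nn_integral_mono)
      fix \<zeta> assume "\<zeta> \<in> space circle_measure"
      then have \<zeta>: "\<zeta> \<in> unit_circle" by simp
      show "ennreal (poisson z \<zeta> * X1 \<zeta>) \<le> ennreal (4 / ((1 - r) * p) * H powr (- (p / 2)))
              * (ennreal (w \<zeta> powr (p / 2)) * indicator {\<zeta>. H < w \<zeta>} \<zeta>)"
      proof (cases "H < w \<zeta>")
        case False
        then have "X1 \<zeta> = 0" using H1 by (simp add: X1_def max_def field_simps)
        then show ?thesis by simp
      next
        case True
        have "X1 \<zeta> = ln (w \<zeta> / H)" using True H1 by (simp add: X1_def max_def field_simps)
        also have "\<dots> \<le> (w \<zeta> / H) powr (p / 2) / (p / 2)"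
          using True H1 p by (intro ln_powr_bound) auto
        also have "(w \<zeta> / H) powr (p / 2) = w \<zeta> powr (p / 2) * H powr (- (p / 2))"
          using w1[of \<zeta>] H1 by (simp add: powr_divide powr_minus_divide)
        finally have "poisson z \<zeta> * X1 \<zeta>
            \<le> 2 / (1 - r) * (w \<zeta> powr (p / 2) * H powr (- (p / 2)) / (p / 2))"
          using poisson_le[OF zd \<zeta>] poisson_nonneg[OF zd] X0 z r by (intro mult_mono) auto
        also have "\<dots> = 4 / ((1 - r) * p) * H powr (- (p / 2)) * w \<zeta> powr (p / 2)"
          by simp
        finally have "ennreal (poisson z \<zeta> * X1 \<zeta>)
            \<le> ennreal (4 / ((1 - r) * p) * H powr (- (p / 2)) * w \<zeta> powr (p / 2))"
          by (rule ennreal_leI)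
        also have "\<dots> = ennreal (4 / ((1 - r) * p) * H powr (- (p / 2))) * ennreal (w \<zeta> powr (p / 2))"
          using r p by (intro ennreal_mult) auto
        finally show ?thesis using True by simp
      qed
    qed
    also have "\<dots> = ennreal (4 / ((1 - r) * p) * H powr (- (p / 2)))
        * (\<integral>\<^sup>+\<zeta>. ennreal (w \<zeta> powr (p / 2)) * indicator {\<zeta>. H < w \<zeta>} \<zeta> \<partial>circle_measure)"
      by (rule nn_integral_cmult) (auto intro!: borel_measurable_times_ennreal borel_measurable_indicator')
    also have "\<dots> \<le> ennreal (4 / ((1 - r) * p) * H powr (- (p / 2)))
        * ennreal (A * weak_const (p / 2) p * H powr (p / 2 - p))"
      by (intro mult_left_mono weak_type_above w) (use A H1 p in \<open>auto simp: w_def\<close>)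
    also have "\<dots> = ennreal (4 / ((1 - r) * p) * H powr (- (p / 2)) * (A * weak_const (p / 2) p * H powr (p / 2 - p)))"
      using r p A weak_const_nonneg[of "p / 2" p] by (intro ennreal_mult[symmetric]) auto
    also have "4 / ((1 - r) * p) * H powr (- (p / 2)) * (A * weak_const (p / 2) p * H powr (p / 2 - p))
        = 4 / ((1 - r) * p) * (A * weak_const (p / 2) p) * (H powr (- (p / 2)) * H powr (p / 2 - p))"
      by simp
    also have "H powr (- (p / 2)) * H powr (p / 2 - p) = 1 - r"
      by (simp add: Hp flip: powr_add)
    also have "4 / ((1 - r) * p) * (A * weak_const (p / 2) p) * (1 - r) = B"
      using r by (simp add: B_def)
    finally show ?thesis .
  qed
  \<comment> \<open>the part of \<open>log\<^sup>+ |f(z)|\<close> that \<open>X2\<close> has to account for\<close>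
  define t where "t = max 0 (log_plus (norm (f z)) - B)"
  have "ennreal (log_plus (norm (f z)))
      \<le> (\<integral>\<^sup>+\<zeta>. ennreal (poisson z \<zeta> * log_plus (norm (boundary_fun f \<zeta>))) \<partial>circle_measure)"
    by (rule smirnov_log_plus_le[OF f zd])
  also have "\<dots> = (\<integral>\<^sup>+\<zeta>. ennreal (poisson z \<zeta> * X1 \<zeta>) + ennreal (poisson z \<zeta> * X2 \<zeta>) \<partial>circle_measure)"
    unfolding split using X0 poisson_nonneg[OF zd]
    by (intro nn_integral_cong) (simp add: distrib_left)
  also have "\<dots> = (\<integral>\<^sup>+\<zeta>. ennreal (poisson z \<zeta> * X1 \<zeta>) \<partial>circle_measure)
      + (\<integral>\<^sup>+\<zeta>. ennreal (poisson z \<zeta> * X2 \<zeta>) \<partial>circle_measure)"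
    by (rule nn_integral_add) auto
  also have "\<dots> \<le> ennreal B + (\<integral>\<^sup>+\<zeta>. ennreal (poisson z \<zeta> * X2 \<zeta>) \<partial>circle_measure)"
    by (intro add_right_mono X1)
  finally have "ennreal (log_plus (norm (f z))) - ennreal B
      \<le> (\<integral>\<^sup>+\<zeta>. ennreal (poisson z \<zeta> * X2 \<zeta>) \<partial>circle_measure)"
    by (subst ennreal_minus_le_iff) auto
  then have "ennreal t \<le> (\<integral>\<^sup>+\<zeta>. ennreal (poisson z \<zeta> * X2 \<zeta>) \<partial>circle_measure)"
    using B0 by (simp add: t_def ennreal_minus max_def ennreal_neg split: if_splits)
  then have exp_t: "ennreal (exp t) \<le> (\<integral>\<^sup>+\<zeta>. ennreal (poisson z \<zeta> * exp (X2 \<zeta>)) \<partial>circle_measure)"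
    using X0 poisson_nonneg[OF zd] nn_integral_poisson[OF zd]
    by (intro exp_le_nn_integral_exp) (auto simp: t_def)
  have "norm (f z) \<le> exp (log_plus (norm (f z)))"
    by (rule norm_le_exp_log_plus)
  also have "\<dots> \<le> exp (B + t)" by (simp add: t_def)
  finally have "norm (f z) \<le> exp B * exp t" by (simp add: exp_add)
  then have "ennreal (norm (f z)) \<le> ennreal (exp B) * ennreal (exp t)"
    by (simp add: ennreal_leI flip: ennreal_mult)
  also have "\<dots> \<le> ennreal (exp B) * (\<integral>\<^sup>+\<zeta>. ennreal (poisson z \<zeta> * exp (X2 \<zeta>)) \<partial>circle_measure)"
    by (intro mult_left_mono exp_t) auto
  also have "(\<integral>\<^sup>+\<zeta>. ennreal (poisson z \<zeta> * exp (X2 \<zeta>)) \<partial>circle_measure)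
      = (\<integral>\<^sup>+\<zeta>. ennreal (poisson z \<zeta> * min (w \<zeta>) H) \<partial>circle_measure)"
  proof (rule nn_integral_cong)
    fix \<zeta>
    have "0 < min (w \<zeta>) H" using w1[of \<zeta>] H1 by simp
    then show "ennreal (poisson z \<zeta> * exp (X2 \<zeta>)) = ennreal (poisson z \<zeta> * min (w \<zeta>) H)"
      by (simp add: X2_def)
  qed
  finally show ?thesis
    by (simp add: B_def w_def H_def)
qed

lemma nn_integral_min_le:
  fixes w :: "'a \<Rightarrow> real"
  assumes w [measurable]: "w \<in> borel_measurable M" and w0: "\<And>x. 0 \<le> w x"
    and weak: "\<And>x. 0 < x \<Longrightarrow> emeasure M {\<zeta>\<in>space M. x < w \<zeta>} \<le> ennreal (A * x powr (- p))"
    and A: "0 \<le> A" and H: "0 < H" and p: "0 < p" "p < 1"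
  shows "(\<integral>\<^sup>+\<zeta>. ennreal (min (w \<zeta>) H) \<partial>M) \<le> ennreal (A * (weak_const 1 p + 1) * H powr (1 - p))"
proof -
  have "(\<integral>\<^sup>+\<zeta>. ennreal (min (w \<zeta>) H) \<partial>M)
      \<le> (\<integral>\<^sup>+\<zeta>. ennreal (w \<zeta> powr 1) * indicator {\<zeta>. 0 \<le> w \<zeta> \<and> w \<zeta> \<le> H} \<zeta>
          + ennreal H * indicator {\<zeta>\<in>space M. H < w \<zeta>} \<zeta> \<partial>M)"
    by (intro nn_integral_mono) (auto simp: indicator_def min_def w0)
  also have "\<dots> = (\<integral>\<^sup>+\<zeta>. ennreal (w \<zeta> powr 1) * indicator {\<zeta>. 0 \<le> w \<zeta> \<and> w \<zeta> \<le> H} \<zeta> \<partial>M)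
      + ennreal H * emeasure M {\<zeta>\<in>space M. H < w \<zeta>}"
    by (subst nn_integral_add) (auto simp: nn_integral_cmult_indicator)
  also have "\<dots> \<le> ennreal (A * weak_const 1 p * H powr (1 - p)) + ennreal H * ennreal (A * H powr (- p))"
    using assms by (intro add_mono mult_left_mono weak_type_below weak) auto
  also have "\<dots> = ennreal (A * weak_const 1 p * H powr (1 - p) + H * (A * H powr (- p)))"
    using A H p weak_const_nonneg[of 1 p] by (subst ennreal_plus) (auto simp: ennreal_mult)
  also have "H * (A * H powr (- p)) = A * H powr (1 - p)"
    using H by (simp add: powr_diff powr_minus_divide)
  finally show ?thesis by (simp add: algebra_simps)
qed

lemma integral_mean_1: "integral_mean 1 r f = (\<integral>\<zeta>. norm (f (of_real r * \<zeta>)) \<partial>circle_measure)"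
  by (simp add: integral_mean_def)

text \<open>Tonelli and the symmetry of the kernel \<open>P(r\<zeta>, \<xi>)\<close> in \<open>\<zeta>\<close> and \<open>\<xi>\<close>.\<close>

lemma nn_integral_poisson_dilation:
  assumes r: "0 \<le> r" "r < 1" and m [measurable]: "m \<in> borel_measurable circle_measure"
  shows "(\<integral>\<^sup>+\<zeta>. (\<integral>\<^sup>+\<xi>. ennreal (poisson (of_real r * \<zeta>) \<xi>) * m \<xi> \<partial>circle_measure) \<partial>circle_measure)
    = (\<integral>\<^sup>+\<xi>. m \<xi> \<partial>circle_measure)"
proof -
  interpret pair_sigma_finite circle_measure circle_measure
    by unfold_locales
  note [measurable] = measurable_circle_ident
  have "(\<lambda>(\<zeta>, \<xi>). ennreal (poisson (of_real r * \<zeta>) \<xi>) * m \<xi>)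
      \<in> borel_measurable (circle_measure \<Otimes>\<^sub>M circle_measure)"
    unfolding poisson_def by measurable
  then have "(\<integral>\<^sup>+\<zeta>. (\<integral>\<^sup>+\<xi>. ennreal (poisson (of_real r * \<zeta>) \<xi>) * m \<xi> \<partial>circle_measure) \<partial>circle_measure)
      = (\<integral>\<^sup>+\<xi>. (\<integral>\<^sup>+\<zeta>. ennreal (poisson (of_real r * \<zeta>) \<xi>) * m \<xi> \<partial>circle_measure) \<partial>circle_measure)"
    by (rule Fubini'[symmetric])
  also have "\<dots> = (\<integral>\<^sup>+\<xi>. m \<xi> \<partial>circle_measure)"
  proof (rule nn_integral_cong)
    fix \<xi> assume "\<xi> \<in> space circle_measure"
    then have \<xi>: "norm \<xi> = 1" by simp
    have zd: "of_real r * \<xi> \<in> unit_disk" using r \<xi> by (simp add: norm_mult)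
    have "(\<integral>\<^sup>+\<zeta>. ennreal (poisson (of_real r * \<zeta>) \<xi>) * m \<xi> \<partial>circle_measure)
        = (\<integral>\<^sup>+\<zeta>. ennreal (poisson (of_real r * \<xi>) \<zeta>) * m \<xi> \<partial>circle_measure)"
      using poisson_dilate_commute[of \<xi> _ r] \<xi> by (intro nn_integral_cong) simp
    also have "\<dots> = m \<xi>"
      using nn_integral_poisson[OF zd] measurable_poisson[OF zd]
      by (subst nn_integral_multc) auto
    finally show "(\<integral>\<^sup>+\<zeta>. ennreal (poisson (of_real r * \<zeta>) \<xi>) * m \<xi> \<partial>circle_measure) = m \<xi>" .
  qed
  finally show ?thesis .
qed

text \<open>Averaging the pointwise bound over the circle of radius \<open>r\<close> removes the Poisson kernel; the weak type bound leaves
  \<open>O(H powr (1-p))\<close> for the mean of the truncated function.\<close>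

lemma weak_hardy_subset_mixed_norm:
  assumes p: "0 < p" "p < 1" and f: "f \<in> weak_hardy p"
  shows "f \<in> mixed_norm_space 1 \<infinity> (1 / p - 1)"
proof -
  from weak_hardy_tail[OF f p(1)] obtain A where A: "1 \<le> A" "\<And>x. 0 < x \<Longrightarrow>
    emeasure circle_measure {\<zeta>\<in>space circle_measure. x < max 1 (norm (boundary_fun f \<zeta>))}
      \<le> ennreal (A * x powr (- p))" by blast
  have sm: "f \<in> smirnov_class" using f by (simp add: weak_hardy_def)
  then have hol: "f holomorphic_on unit_disk"
    by (simp add: smirnov_class_def nevanlinna_class_def)
  have bf [measurable]: "boundary_fun f \<in> borel_measurable circle_measure"
    by (intro measurable_boundary_fun holomorphic_on_imp_continuous_on hol)
  define E where "E = exp (4 * A * weak_const (p / 2) p / p)"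
  define C where "C = E * (A * (weak_const 1 p + 1))"
  have C0: "0 \<le> C"
    using A weak_const_nonneg[of 1 p] p by (simp add: C_def E_def)
  have bound: "integral_mean 1 r f * (1 - r) powr (1 / p - 1) \<le> C" if r: "r \<in> {0<..<1}" for r
  proof -
    define H where "H = (1 - r) powr (- (1 / p))"
    define m where "m \<zeta> = min (max 1 (norm (boundary_fun f \<zeta>))) H" for \<zeta>
    have [measurable]: "m \<in> borel_measurable circle_measure" unfolding m_def by measurable
    have H0: "0 < H" using r by (simp add: H_def)
    have "(\<integral>\<^sup>+\<zeta>. ennreal (norm (f (of_real r * \<zeta>))) \<partial>circle_measure)
       \<le> (\<integral>\<^sup>+\<zeta>. ennreal E * (\<integral>\<^sup>+\<xi>. ennreal (poisson (of_real r * \<zeta>) \<xi>) * ennreal (m \<xi>) \<partial>circle_measure) \<partial>circle_measure)"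
    proof (rule nn_integral_mono)
      fix \<zeta> assume "\<zeta> \<in> space circle_measure"
      then have n: "norm (of_real r * \<zeta>) = r" using r by (simp add: norm_mult)
      have "ennreal (norm (f (of_real r * \<zeta>)))
          \<le> ennreal E * (\<integral>\<^sup>+\<xi>. ennreal (poisson (of_real r * \<zeta>) \<xi> * m \<xi>) \<partial>circle_measure)"
        unfolding E_def m_def H_def
        by (rule smirnov_norm_le_truncated[OF sm p(1) _ _ _ A(2) n]) (use r A in auto)
      also have "(\<integral>\<^sup>+\<xi>. ennreal (poisson (of_real r * \<zeta>) \<xi> * m \<xi>) \<partial>circle_measure)
          = (\<integral>\<^sup>+\<xi>. ennreal (poisson (of_real r * \<zeta>) \<xi>) * ennreal (m \<xi>) \<partial>circle_measure)"
        using n r H0 by (intro nn_integral_cong ennreal_mult poisson_nonneg) (auto simp: m_def)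
      finally show "ennreal (norm (f (of_real r * \<zeta>))) \<le> ennreal E
          * (\<integral>\<^sup>+\<xi>. ennreal (poisson (of_real r * \<zeta>) \<xi>) * ennreal (m \<xi>) \<partial>circle_measure)" .
    qed
    also have "\<dots> \<le> ennreal E * (\<integral>\<^sup>+\<zeta>. (\<integral>\<^sup>+\<xi>. ennreal (poisson (of_real r * \<zeta>) \<xi>) * ennreal (m \<xi>) \<partial>circle_measure) \<partial>circle_measure)"
    proof (subst nn_integral_cmult)
      note [measurable] = measurable_circle_ident
      show "(\<lambda>\<zeta>. \<integral>\<^sup>+\<xi>. ennreal (poisson (of_real r * \<zeta>) \<xi>) * ennreal (m \<xi>) \<partial>circle_measure)
          \<in> borel_measurable circle_measure"
        unfolding poisson_def by measurable
    qed simp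
    also have "\<dots> = ennreal E * (\<integral>\<^sup>+\<xi>. ennreal (m \<xi>) \<partial>circle_measure)"
      using r by (subst nn_integral_poisson_dilation) auto
    also have "\<dots> \<le> ennreal E * ennreal (A * (weak_const 1 p + 1) * H powr (1 - p))"
      unfolding m_def by (intro mult_left_mono nn_integral_min_le A p H0) (use A in auto)
    also have "\<dots> = ennreal (C * H powr (1 - p))"
      using A weak_const_nonneg[of 1 p] p
      by (subst ennreal_mult[symmetric]) (auto simp: C_def E_def mult.assoc)
    finally have "integral_mean 1 r f \<le> C * H powr (1 - p)"
      unfolding integral_mean_1 using C0 by (intro integral_real_bounded) auto
    then have "integral_mean 1 r f * (1 - r) powr (1 / p - 1)
        \<le> C * H powr (1 - p) * (1 - r) powr (1 / p - 1)"
      by (intro mult_right_mono) auto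
    also have "\<dots> = C * ((1 - r) powr (- (1 / p) * (1 - p)) * (1 - r) powr (1 / p - 1))"
      by (simp add: H_def powr_powr)
    also have "(1 - r) powr (- (1 / p) * (1 - p)) * (1 - r) powr (1 / p - 1) = 1"
      using p r by (simp add: field_simps flip: powr_add)
    finally show ?thesis by simp
  qed
  have "(SUP r\<in>{0<..<1}. ennreal (integral_mean 1 r f * (1 - r) powr (1 / p - 1))) \<le> ennreal C"
    by (intro SUP_least ennreal_leI bound)
  also have "\<dots> < \<infinity>" by simp
  finally show ?thesis
    using hol by (simp add: mixed_norm_space_def)
qed


section \<open>Power series on the disk and the fractional derivative\<close>

definition powser :: "(nat \<Rightarrow> complex) \<Rightarrow> complex \<Rightarrow> complex" where
  "powser a z = (\<Sum>n. a n * z ^ n)"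

text \<open>The coefficient sequences of functions analytic in the disk.\<close>

definition disk_seqs :: "(nat \<Rightarrow> complex) set" where
  "disk_seqs = {a. \<forall>r. 0 < r \<and> r < 1 \<longrightarrow> summable (\<lambda>n. norm (a n) * r ^ n)}"

lemma disk_seqsD:
  assumes "a \<in> disk_seqs" "norm z < 1"
  shows "summable (\<lambda>n. norm (a n * z ^ n))"
proof -
  define r where "r = (1 + norm z) / 2"
  have r: "0 < r" "r < 1" "norm z \<le> r"
    using assms(2) norm_ge_zero[of z] by (auto simp: r_def simp del: norm_ge_zero)
  have "summable (\<lambda>n. norm (a n) * r ^ n)"
    using assms(1) r by (simp add: disk_seqs_def)
  then show ?thesis
    by (rule summable_comparison_test')
       (use r in \<open>auto simp: norm_mult norm_power intro!: mult_left_mono power_mono\<close>)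
qed

lemma disk_seqsD_real:
  assumes "a \<in> disk_seqs" "0 \<le> r" "r < 1"
  shows "summable (\<lambda>n. norm (a n) * r ^ n)"
  using disk_seqsD[OF assms(1), of "of_real r"] assms by (simp add: norm_mult norm_power)

lemma disk_seqsI:
  assumes "\<And>r. 0 < r \<Longrightarrow> r < 1 \<Longrightarrow> summable (\<lambda>n. a n * of_real r ^ n)"
  shows "a \<in> disk_seqs"
  unfolding disk_seqs_def
proof safe
  fix r :: real assume r: "0 < r" "r < 1"
  have "summable (\<lambda>n. norm (a n * of_real r ^ n))"
  proof (rule powser_insidea)
    show "summable (\<lambda>n. a n * of_real ((1 + r) / 2) ^ n)"
      using r by (intro assms) auto
    show "norm (of_real r :: complex) < norm (of_real ((1 + r) / 2) :: complex)"
      unfolding norm_of_real using r by simp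
  qed
  then show "summable (\<lambda>n. norm (a n) * r ^ n)"
    using r by (simp add: norm_mult norm_power)
qed

lemma powser_sums:
  assumes "a \<in> disk_seqs" "norm z < 1"
  shows "(\<lambda>n. a n * z ^ n) sums powser a z"
  unfolding powser_def by (rule summable_sums[OF summable_norm_cancel[OF disk_seqsD[OF assms]]])

lemma powser_holomorphic:
  assumes "a \<in> disk_seqs"
  shows "powser a holomorphic_on unit_disk"
  by (rule power_series_holomorphic[where a = a]) (use powser_sums[OF assms] in simp)

lemma isCont_powser:
  assumes "a \<in> disk_seqs" "norm z < 1"
  shows "isCont (powser a) z"
  using holomorphic_on_imp_continuous_on[OF powser_holomorphic[OF assms(1)]] assms(2)
  by (simp add: continuous_on_eq_continuous_at)

lemma taylor_coeff_powser:
  assumes "a \<in> disk_seqs"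
  shows "taylor_coeff (powser a) = a"
proof
  fix n
  have "conv_radius a \<ge> 1"
    by (rule conv_radius_geI_ex') (use powser_sums[OF assms] in \<open>auto simp: sums_iff\<close>)
  then have "0 < fps_conv_radius (Abs_fps a)"
    by (simp add: fps_conv_radius_def Abs_fps_inverse less_le_trans[of 0 1])
  then have "powser a has_fps_expansion Abs_fps a"
    by (simp add: has_fps_expansion_def eval_fps_def powser_def)
  then have "a n = (deriv ^^ n) (powser a) 0 / fact n"
    using fps_nth_fps_expansion[of "powser a" "Abs_fps a" n] by simp
  then show "taylor_coeff (powser a) n = a n"
    by (simp add: taylor_coeff_def)
qed

lemma taylor_coeff_sums:
  assumes "f holomorphic_on unit_disk" "norm z < 1"
  shows "(\<lambda>n. taylor_coeff f n * z ^ n) sums f z"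
  using holomorphic_power_series[OF assms(1), of z] assms(2) by (simp add: taylor_coeff_def)

lemma taylor_coeff_disk_seqs:
  assumes "f holomorphic_on unit_disk"
  shows "taylor_coeff f \<in> disk_seqs"
  by (rule disk_seqsI) (use taylor_coeff_sums[OF assms] in \<open>auto simp: sums_iff\<close>)

lemma powser_taylor_coeff:
  assumes "f holomorphic_on unit_disk" "norm z < 1"
  shows "powser (taylor_coeff f) z = f z"
  unfolding powser_def using taylor_coeff_sums[OF assms] by (simp add: sums_iff)

text \<open>The Hadamard product: split \<open>r\<^sup>n\<close> evenly between the two factors.\<close>

lemma disk_seqs_mult:
  assumes "a \<in> disk_seqs" "b \<in> disk_seqs"
  shows "(\<lambda>n. a n * b n) \<in> disk_seqs"
  unfolding disk_seqs_def
proof safe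
  fix r :: real assume r: "0 < r" "r < 1"
  have s: "0 \<le> sqrt r" "sqrt r < 1" using r by auto
  have "(\<lambda>n. norm (b n) * sqrt r ^ n) \<longlonglongrightarrow> 0"
    by (rule summable_LIMSEQ_zero[OF disk_seqsD_real[OF assms(2) s]])
  then have "Bseq (\<lambda>n. norm (b n) * sqrt r ^ n)"
    by (intro convergent_imp_Bseq convergentI)
  then obtain K where K: "\<And>n. norm (norm (b n) * sqrt r ^ n) \<le> K"
    by (auto simp: Bseq_def)
  show "summable (\<lambda>n. norm (a n * b n) * r ^ n)"
  proof (rule summable_comparison_test')
    show "summable (\<lambda>n. norm (a n) * sqrt r ^ n * K)"
      by (intro summable_mult2 disk_seqsD_real assms s)
    show "norm (norm (a n * b n) * r ^ n) \<le> norm (a n) * sqrt r ^ n * K" for n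
    proof -
      have "r ^ n = sqrt r ^ n * sqrt r ^ n"
        using r by (simp flip: power_mult_distrib)
      then have "norm (norm (a n * b n) * r ^ n) = (norm (a n) * sqrt r ^ n) * (norm (b n) * sqrt r ^ n)"
        using r by (simp add: norm_mult abs_mult)
      also have "\<dots> \<le> (norm (a n) * sqrt r ^ n) * K"
        using K[of n] s r by (intro mult_left_mono) (auto simp: abs_mult)
      finally show ?thesis by simp
    qed
  qed
qed

definition deriv_weight :: "real \<Rightarrow> nat \<Rightarrow> real" where
  "deriv_weight b n = Gamma (real n + b + 1) / fact n"

lemma Gamma_plus1_pos: "0 < b \<Longrightarrow> 0 < Gamma (b + 1 :: real)"
  by (intro Gamma_real_pos) simp

lemma Gamma_plus1_neq_0: "0 < b \<Longrightarrow> Gamma (b + 1 :: real) \<noteq> 0"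
  using Gamma_plus1_pos by (metis less_irrefl)

lemma deriv_weight_pos: "0 < b \<Longrightarrow> 0 < deriv_weight b n"
  unfolding deriv_weight_def by (intro divide_pos_pos Gamma_real_pos) auto

lemma frac_deriv_eq_powser:
  "frac_deriv b f = powser (\<lambda>n. of_real (deriv_weight b n) * taylor_coeff f n)"
  by (rule ext) (simp add: frac_deriv_def powser_def deriv_weight_def)

text \<open>The binomial series, since \<open>B\<^sub>n/\<Gamma>(b+1)\<close> is the Pochhammer symbol of \<open>b+1\<close> divided by \<open>n!\<close>.\<close>

lemma cauchy_power_sums:
  fixes z :: complex
  assumes b: "0 < b" and z: "norm z < 1"
  shows "(\<lambda>n. of_real (deriv_weight b n) * z ^ n) sums
      (of_real (Gamma (b + 1)) * (1 - z) powr (- of_real (b + 1)))"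
proof -
  define c where "c = complex_of_real (b + 1)"
  have ni: "c \<notin> \<int>\<^sub>\<le>\<^sub>0"
    unfolding c_def using b by (subst of_real_in_nonpos_Ints_iff) (auto elim!: nonpos_Ints_cases)
  have G: "Gamma (b + 1) \<noteq> 0"
    using b by (intro Gamma_plus1_neq_0) simp
  have coeff: "(- c gchoose n) * (- z) ^ n = of_real (deriv_weight b n / Gamma (b + 1)) * z ^ n" for n
  proof -
    have "(- c gchoose n) * (- z) ^ n = ((-1) ^ n * (-1) ^ n) * pochhammer c n / fact n * z ^ n"
      using gbinomial_pochhammer[of "- c" n] power_minus[of z n] by simp
    also have "((-1) ^ n * (-1) ^ n) = (1 :: complex)"
      by (simp flip: power_mult_distrib)
    also have "pochhammer c n = Gamma (c + of_nat n) / Gamma c"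
      by (rule pochhammer_Gamma[OF ni])
    also have "c + of_nat n = of_real (real n + b + 1)"
      by (simp add: c_def)
    also have "Gamma (complex_of_real (real n + b + 1)) / Gamma c = of_real (Gamma (real n + b + 1) / Gamma (b + 1))"
      unfolding c_def by (simp only: Gamma_complex_of_real of_real_divide)
    finally show ?thesis
      by (simp add: deriv_weight_def)
  qed
  have "(\<lambda>n. (- c gchoose n) * (- z) ^ n) sums (1 + - z) powr (- c)"
    using z by (intro gen_binomial_complex) simp
  from sums_mult[OF this, of "of_real (Gamma (b + 1))"] show ?thesis
    unfolding coeff using G by (simp add: c_def)
qed

lemma deriv_weight_disk_seqs: "0 < b \<Longrightarrow> (\<lambda>n. of_real (deriv_weight b n)) \<in> disk_seqs"
  by (rule disk_seqsI) (use cauchy_power_sums in \<open>auto simp: sums_iff\<close>)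

text \<open>Parseval's identity for the two dilated functions.\<close>

lemma integral_circle_pairing:
  assumes a: "a \<in> disk_seqs" and b: "b \<in> disk_seqs" and s: "0 \<le> s" "s < 1" and t: "0 \<le> t" "t < 1"
  shows "(\<integral>\<zeta>. powser a (of_real s * \<zeta>) * powser b (of_real t * cnj \<zeta>) \<partial>circle_measure)
    = powser (\<lambda>n. a n * b n) (of_real (s * t))"
proof -
  let ?g = "\<lambda>\<zeta>. powser b (of_real t * cnj \<zeta>)"
  have cont: "continuous_on unit_disk (powser b)"
    by (intro holomorphic_on_imp_continuous_on powser_holomorphic b)
  have "continuous_on unit_circle ?g"
    using t by (intro continuous_on_compose2[OF cont] continuous_intros) (auto simp: norm_mult)
  then have meas: "?g \<in> borel_measurable circle_measure"
    by (rule measurable_circle_continuous)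
  have bound: "norm (?g \<zeta>) \<le> (\<Sum>n. norm (b n) * t ^ n)" if "\<zeta> \<in> unit_circle" for \<zeta>
  proof -
    have n: "norm (of_real t * cnj \<zeta>) < 1" using t that by (simp add: norm_mult)
    have "norm (?g \<zeta>) \<le> (\<Sum>n. norm (b n * (of_real t * cnj \<zeta>) ^ n))"
      unfolding powser_def by (rule summable_norm[OF disk_seqsD[OF b n]])
    also have "\<dots> = (\<Sum>n. norm (b n) * t ^ n)"
      using t that by (simp add: norm_mult norm_power)
    finally show ?thesis .
  qed
  have coeff: "(\<integral>\<zeta>. \<zeta> ^ n * ?g \<zeta> \<partial>circle_measure) = b n * of_real t ^ n" for n
  proof -
    have summ: "summable (\<lambda>m. norm (cnj (b m) * of_real t ^ m))"
      using disk_seqsD_real[OF b t] t by (simp add: norm_mult norm_power)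
    have "(\<lambda>m. (cnj (b m) * of_real t ^ m) * (\<integral>\<zeta>. \<zeta> ^ m * cnj \<zeta> ^ n \<partial>circle_measure)) sums
        (\<integral>\<zeta>. (\<Sum>m. (cnj (b m) * of_real t ^ m) * \<zeta> ^ m) * cnj \<zeta> ^ n \<partial>circle_measure)"
      by (rule integral_circle_power_series[OF summ, where K = 1])
         (auto intro!: measurable_circle_continuous continuous_intros simp: norm_power)
    moreover have "(\<lambda>m. (cnj (b m) * of_real t ^ m) * (\<integral>\<zeta>. \<zeta> ^ m * cnj \<zeta> ^ n \<partial>circle_measure))
        = (\<lambda>m. if m = n then cnj (b m) * of_real t ^ m else 0)"
      by (auto simp: integral_circle_power)
    ultimately have "(\<integral>\<zeta>. (\<Sum>m. (cnj (b m) * of_real t ^ m) * \<zeta> ^ m) * cnj \<zeta> ^ n \<partial>circle_measure)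
        = cnj (b n) * of_real t ^ n"
      using sums_unique2[OF _ sums_single[of n "\<lambda>m. cnj (b m) * of_real t ^ m"]] by simp
    moreover have "(\<integral>\<zeta>. (\<Sum>m. (cnj (b m) * of_real t ^ m) * \<zeta> ^ m) * cnj \<zeta> ^ n \<partial>circle_measure)
        = (\<integral>\<zeta>. cnj (\<zeta> ^ n * ?g \<zeta>) \<partial>circle_measure)"
    proof (rule Bochner_Integration.integral_cong)
      fix \<zeta> assume "\<zeta> \<in> space circle_measure"
      then have "norm (of_real t * cnj \<zeta>) < 1" using t by (simp add: norm_mult)
      from sums_cnj[THEN iffD2, OF powser_sums[OF b this]]
      have "(\<Sum>m. (cnj (b m) * of_real t ^ m) * \<zeta> ^ m) = cnj (?g \<zeta>)"
        by (simp add: sums_iff power_mult_distrib mult.assoc)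
      then show "(\<Sum>m. (cnj (b m) * of_real t ^ m) * \<zeta> ^ m) * cnj \<zeta> ^ n = cnj (\<zeta> ^ n * ?g \<zeta>)"
        by simp
    qed simp
    ultimately have "cnj (\<integral>\<zeta>. \<zeta> ^ n * ?g \<zeta> \<partial>circle_measure) = cnj (b n * of_real t ^ n)"
      by (simp only: Bochner_Integration.integral_cnj) simp
    then show ?thesis by (simp only: complex_cnj_cancel_iff)
  qed
  have "summable (\<lambda>n. norm (a n * of_real s ^ n))"
    using disk_seqsD_real[OF a s] s by (simp add: norm_mult norm_power)
  from integral_circle_power_series[OF this meas bound]
  have "(\<lambda>n. a n * of_real s ^ n * (b n * of_real t ^ n)) sums
      (\<integral>\<zeta>. (\<Sum>n. a n * of_real s ^ n * \<zeta> ^ n) * ?g \<zeta> \<partial>circle_measure)"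
    unfolding coeff .
  then have "(\<integral>\<zeta>. (\<Sum>n. a n * of_real s ^ n * \<zeta> ^ n) * ?g \<zeta> \<partial>circle_measure)
      = (\<Sum>n. a n * of_real s ^ n * (b n * of_real t ^ n))"
    by (simp add: sums_iff)
  then show ?thesis
    by (simp add: powser_def power_mult_distrib mult_ac)
qed


section \<open>Integral means in the mixed norm conditions\<close>

lemma mixed_norm_1_infD:
  assumes "f \<in> mixed_norm_space 1 \<infinity> \<alpha>"
  obtains C where "0 \<le> C" "\<And>r. 0 < r \<Longrightarrow> r < 1 \<Longrightarrow>
    (\<integral>\<zeta>. norm (f (of_real r * \<zeta>)) \<partial>circle_measure) * (1 - r) powr \<alpha> \<le> C"
proof -
  define S where "S = (SUP r\<in>{0<..<1}. ennreal (integral_mean 1 r f * (1 - r) powr \<alpha>))"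
  have S: "S < \<infinity>" using assms by (simp add: mixed_norm_space_def S_def)
  show ?thesis
  proof (rule that[of "enn2real S"])
    fix r :: real assume r: "0 < r" "r < 1"
    have "ennreal (integral_mean 1 r f * (1 - r) powr \<alpha>) \<le> S"
      unfolding S_def using r by (intro SUP_upper) auto
    also have "S = ennreal (enn2real S)" using S by simp
    finally show "(\<integral>\<zeta>. norm (f (of_real r * \<zeta>)) \<partial>circle_measure) * (1 - r) powr \<alpha> \<le> enn2real S"
      by (simp add: integral_mean_1)
  qed simp
qed

lemma norm_le_integral_mean_inf:
  assumes F: "F holomorphic_on unit_disk" and z: "norm z \<le> t" and t: "0 < t" "t < 1"
  shows "norm (F z) \<le> integral_mean \<infinity> t F"
proof (rule maximum_modulus_frontier[of F "cball 0 t"])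
  have sub: "cball 0 t \<subseteq> unit_disk" using t by auto
  show "F holomorphic_on interior (cball 0 t)"
    using t by (intro holomorphic_on_subset[OF F]) auto
  have cont: "continuous_on (cball 0 t) F"
    by (intro holomorphic_on_imp_continuous_on holomorphic_on_subset[OF F] sub)
  then show "continuous_on (closure (cball 0 t)) F" by simp
  show "z \<in> cball 0 t" using z by simp
  fix w assume "w \<in> frontier (cball (0::complex) t)"
  then have w: "norm w = t" using t by simp
  have bdd: "bdd_above ((\<lambda>\<zeta>. norm (F (of_real t * \<zeta>))) ` unit_circle)"
  proof -
    have "bounded (F ` cball 0 t)"
      by (intro compact_imp_bounded compact_continuous_image cont) auto
    then obtain B where "\<forall>x\<in>cball 0 t. norm (F x) \<le> B"
      unfolding bounded_iff by blast
    then show ?thesis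
      using t by (intro bdd_aboveI2[of _ _ B]) (auto simp: norm_mult)
  qed
  have "norm (F (of_real t * (w / of_real t))) \<le> (SUP \<zeta>\<in>unit_circle. norm (F (of_real t * \<zeta>)))"
    by (rule cSUP_upper[OF _ bdd]) (use w t in \<open>simp add: norm_divide\<close>)
  then show "norm (F w) \<le> integral_mean \<infinity> t F"
    using t by (simp add: integral_mean_def)
qed simp

lemma integral_mean_inf_nonneg:
  assumes "F holomorphic_on unit_disk" "0 < t" "t < 1"
  shows "0 \<le> integral_mean \<infinity> t F"
  using norm_le_integral_mean_inf[of F 0 t] assms norm_ge_zero[of "F 0"] by (simp del: norm_ge_zero)

lemma integral_mean_inf_mono:
  assumes F: "F holomorphic_on unit_disk"
  shows "mono_on {0<..<1} (\<lambda>t. integral_mean \<infinity> t F)"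
proof (rule mono_onI)
  fix s t :: real assume st: "s \<in> {0<..<1}" "t \<in> {0<..<1}" "s \<le> t"
  have "(SUP \<zeta>\<in>unit_circle. norm (F (of_real s * \<zeta>))) \<le> integral_mean \<infinity> t F"
    using st by (intro cSUP_least norm_le_integral_mean_inf F) (auto simp: norm_mult intro: exI[of _ 1])
  then show "integral_mean \<infinity> s F \<le> integral_mean \<infinity> t F"
    by (simp add: integral_mean_def)
qed

lemma mixed_norm_inf_1_iff:
  assumes F: "F holomorphic_on unit_disk"
  shows "F \<in> mixed_norm_space \<infinity> 1 1 \<longleftrightarrow>
    (\<integral>\<^sup>+r\<in>{0<..<1}. ennreal (integral_mean \<infinity> r F) \<partial>lborel) < \<infinity>"
proof -
  have "(\<integral>\<^sup>+r\<in>{0<..<1}. ennreal (integral_mean \<infinity> r F powr 1 * (1 - r) powr (1 * 1 - 1)) \<partial>lborel)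
      = (\<integral>\<^sup>+r\<in>{0<..<1}. ennreal (integral_mean \<infinity> r F) \<partial>lborel)"
    using integral_mean_inf_nonneg[OF F]
    by (intro nn_integral_cong) (auto simp: indicator_def)
  then show ?thesis
    using F by (simp add: mixed_norm_space_def)
qed

text \<open>The Beta integral turns the weight \<open>B\<^sub>n\<close> of the fractional derivative into an average over radii.\<close>

lemma integral_beta_power:
  assumes b: "0 < b"
  shows "integrable (restrict_space lborel {0<..<1}) (\<lambda>u. (1 - u) powr (b - 1) * u ^ n)"
    and "(\<integral>u. (1 - u) powr (b - 1) * u ^ n \<partial>restrict_space lborel {0<..<1}) = Gamma b / deriv_weight b n"
proof -
  let ?h = "\<lambda>u::real. u powr (real (Suc n) - 1) * (1 - u) powr (b - 1)"
  have eq: "?h u = (1 - u) powr (b - 1) * u ^ n" if "u \<in> {0<..<1}" for u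
    using that by (simp add: powr_realpow)
  have hi: "(?h has_integral Beta (real (Suc n)) b) {0<..<1}"
    using has_integral_Beta_real[of "real (Suc n)" b] b by (simp add: has_integral_Icc_iff_Ioo)
  have "set_integrable lborel {0..1} ?h"
    by (rule integrable_Beta) (use b in auto)
  then have int: "set_integrable lborel {0<..<1} ?h"
    by (rule set_integrable_subset) auto
  then have int': "set_integrable lborel {0<..<1} (\<lambda>u. (1 - u) powr (b - 1) * u ^ n)"
    by (subst set_integrable_cong[OF refl refl eq[symmetric]]) auto
  then show "integrable (restrict_space lborel {0<..<1}) (\<lambda>u. (1 - u) powr (b - 1) * u ^ n)"
    by (simp add: integrable_restrict_space set_integrable_def)
  have "(\<integral>u. (1 - u) powr (b - 1) * u ^ n \<partial>restrict_space lborel {0<..<1})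
      = (LINT u:{0<..<1}|lborel. (1 - u) powr (b - 1) * u ^ n)"
    by (simp add: integral_restrict_space set_lebesgue_integral_def)
  also have "\<dots> = (LINT u:{0<..<1}|lborel. ?h u)"
    by (rule set_lebesgue_integral_cong) (use eq in auto)
  also have "\<dots> = integral {0<..<1} ?h"
    by (rule set_borel_integral_eq_integral(2)[OF int])
  also have "\<dots> = Beta (real (Suc n)) b"
    using hi by (rule integral_unique)
  also have "\<dots> = Gamma b / deriv_weight b n"
  proof -
    have "Gamma (real (Suc n)) = fact n"
      using Gamma_fact[of n, where 'a = real] by (simp add: add.commute)
    moreover have "real (Suc n) + b = real n + b + 1" by simp
    ultimately show ?thesis
      by (simp only: Beta_def deriv_weight_def) (simp add: mult.commute)
  qed
  finally show "(\<integral>u. (1 - u) powr (b - 1) * u ^ n \<partial>restrict_space lborel {0<..<1})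
      = Gamma b / deriv_weight b n" .
qed

text \<open>This is used with an increasing mean \<open>G\<close> at the radius \<open>\<surd>u \<le> (1+u)/2\<close>: the affine substitution replaces the
  quadratic one.\<close>

lemma nn_integral_midpoint_le:
  fixes G :: "real \<Rightarrow> real"
  assumes mono: "mono_on {0<..<1} G"
  shows "(\<integral>\<^sup>+u\<in>{0<..<1}. ennreal (G ((1 + u) / 2)) \<partial>lborel) \<le> 2 * (\<integral>\<^sup>+u\<in>{0<..<1}. ennreal (G u) \<partial>lborel)"
proof -
  define h where "h u = ennreal (G u) * indicator {0<..<1} u" for u
  have h: "h \<in> borel_measurable borel"
  proof -
    have "(\<lambda>u. ennreal (G u)) \<in> borel_measurable (restrict_space borel {0<..<1})"
      using borel_measurable_mono_on_fnc[OF mono] by measurable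
    then show ?thesis
      unfolding h_def by (subst (asm) borel_measurable_restrict_space_iff_ennreal) auto
  qed
  have "(\<integral>\<^sup>+u\<in>{0<..<1}. ennreal (G ((1 + u) / 2)) \<partial>lborel) \<le> (\<integral>\<^sup>+u. h (1 / 2 + 1 / 2 * u) \<partial>lborel)"
    by (intro nn_integral_mono) (auto simp: h_def indicator_def add_divide_distrib)
  also have "\<dots> = 2 * (\<bar>1 / 2 :: real\<bar> * (\<integral>\<^sup>+u. h (1 / 2 + 1 / 2 * u) \<partial>lborel))"
  proof -
    have "ennreal 2 * ennreal \<bar>1 / 2\<bar> = ennreal (2 * \<bar>1 / 2\<bar>)"
      by (rule ennreal_mult[symmetric]) auto
    then have "(2 :: ennreal) * ennreal \<bar>1 / 2\<bar> = 1"
      by (simp only: ennreal_numeral) simp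
    then show ?thesis by (simp only: mult.assoc[symmetric] mult_1_left)
  qed
  also have "\<bar>1 / 2 :: real\<bar> * (\<integral>\<^sup>+u. h (1 / 2 + 1 / 2 * u) \<partial>lborel) = (\<integral>\<^sup>+u. h u \<partial>lborel)"
    by (rule nn_integral_real_affine[symmetric, OF h]) simp
  finally show ?thesis by (simp add: h_def)
qed


section \<open>Uniform boundedness\<close>

text \<open>The Banach-Steinhaus theorem: by Baire's theorem one of the closed sets on which all \<open>T i\<close> are bounded by \<open>n\<close>
  contains a ball, and differences of its points cover a neighbourhood of 0.\<close>

theorem uniform_boundedness:
  fixes T :: "'i \<Rightarrow> 'b::{real_normed_vector,complete_space} \<Rightarrow> 'c::real_normed_vector"
  assumes lin: "\<And>i. bounded_linear (T i)" and pw: "\<And>x. \<exists>K. \<forall>i. norm (T i x) \<le> K"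
  obtains K where "\<And>i x. norm (T i x) \<le> K * norm x"
proof -
  define S where "S n = {x. \<forall>i. norm (T i x) \<le> real n}" for n
  have closed: "closed (S n)" for n
    unfolding S_def
    by (intro closed_Collect_all closed_Collect_le continuous_intros
        linear_continuous_on bounded_linear.continuous_on[OF lin])
  have cover: "(\<Union>n. S n) = UNIV"
  proof -
    have "\<exists>n. x \<in> S n" for x
    proof -
      obtain K where "\<forall>i. norm (T i x) \<le> K" using pw by blast
      moreover obtain n :: nat where "K \<le> real n" using real_arch_simple by blast
      ultimately show ?thesis unfolding S_def using order_trans by blast
    qed
    then show ?thesis by auto
  qed
  have "\<exists>n. interior (S n) \<noteq> {}"
  proof (rule ccontr)
    assume "\<not> ?thesis"
    then have empty: "interior (S n) = {}" for n by blast
    have "Met_TC.mtopology interior_of (\<Union>(range S)) = {}"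
      using closed empty by (intro Met_TC.metric_Baire_category_alt) (auto simp: complete_UNIV)
    then show False
      using cover by simp
  qed
  then obtain n x0 e where e: "0 < e" "cball x0 e \<subseteq> S n"
    by (metis ex_in_conv mem_interior_cball)
  have "norm (T i x) \<le> 2 * real n / e * norm x" for i x
  proof (cases "x = 0")
    case True
    then show ?thesis using linear_0[OF bounded_linear.linear[OF lin]] by simp
  next
    case False
    interpret bounded_linear "T i" by (rule lin)
    define y where "y = (e / norm x) *\<^sub>R x"
    have "norm y = e" using False e by (simp add: y_def)
    then have "x0 + y \<in> S n" "x0 \<in> S n"
      using e by (auto simp: dist_norm intro!: subsetD[OF e(2)])
    then have "norm (T i (x0 + y)) + norm (T i x0) \<le> 2 * real n"
      unfolding S_def by (smt (verit) mem_Collect_eq)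
    moreover have "norm (T i y) \<le> norm (T i (x0 + y)) + norm (T i x0)"
      using norm_triangle_ineq4[of "T i (x0 + y)" "T i x0"] by (simp add: add)
    moreover have "norm (T i y) = e / norm x * norm (T i x)"
      using e by (simp add: y_def scaleR)
    ultimately have "e / norm x * norm (T i x) \<le> 2 * real n" by linarith
    then show ?thesis
      using e False by (simp add: field_simps)
  qed
  then show ?thesis by (rule that)
qed

text \<open>The previous theorem for the functionals \<open>c \<mapsto> \<Sum> a\<^sub>i\<^sub>k c\<^sub>k\<close> on the space of bounded sequences, whose norms are the
  \<open>\<ell>\<^sup>1\<close> norms of the rows. Bounded sequences are realized as bounded continuous functions on a discrete metric
  space.\<close>

lemma uniform_boundedness_rows:
  fixes a :: "'i \<Rightarrow> nat \<Rightarrow> complex"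
  assumes summ: "\<And>i. summable (\<lambda>k. norm (a i k))"
    and bdd: "\<And>c. (\<And>k. norm (c k) \<le> 1) \<Longrightarrow> \<exists>K. \<forall>i. norm (\<Sum>k. a i k * c k) \<le> K"
  obtains K where "\<And>i. (\<Sum>k. norm (a i k)) \<le> K"
proof -
  define T where "T i x = (\<Sum>k. a i k * apply_bcontfun x (discrete k))" for i and x :: "nat discrete \<Rightarrow>\<^sub>C complex"
  have le: "norm (a i k * apply_bcontfun x (discrete k)) \<le> norm (a i k) * norm x" for i k and x :: "nat discrete \<Rightarrow>\<^sub>C complex"
    unfolding norm_mult by (intro mult_left_mono norm_bounded) auto
  have s': "summable (\<lambda>k. norm (a i k * apply_bcontfun x (discrete k)))" for i and x :: "nat discrete \<Rightarrow>\<^sub>C complex"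
    by (rule summable_comparison_test'[OF summable_mult2[OF summ]]) (use le in auto)
  note s = summable_norm_cancel[OF s']
  have lin: "bounded_linear (T i)" for i
  proof (rule bounded_linear_intro[where K = "\<Sum>k. norm (a i k)"])
    fix x y :: "nat discrete \<Rightarrow>\<^sub>C complex" and r :: real
    show "T i (x + y) = T i x + T i y"
      unfolding T_def by (simp add: suminf_add[OF s s] distrib_left)
    show "T i (r *\<^sub>R x) = r *\<^sub>R T i x"
      unfolding T_def by (simp add: suminf_scaleR_right[OF s])
    have "norm (T i x) \<le> (\<Sum>k. norm (a i k * apply_bcontfun x (discrete k)))"
      unfolding T_def by (rule summable_norm[OF s'])
    also have "\<dots> \<le> (\<Sum>k. norm (a i k) * norm x)"
      by (intro suminf_le le s' summable_mult2 summ)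
    also have "\<dots> = (\<Sum>k. norm (a i k)) * norm x"
      by (rule suminf_mult2[symmetric, OF summ])
    finally show "norm (T i x) \<le> norm x * (\<Sum>k. norm (a i k))"
      by (simp add: mult.commute)
  qed
  have "\<exists>K. \<forall>i. norm (T i x) \<le> K" for x
  proof -
    \<comment> \<open>rescaling puts an arbitrary bounded sequence into the unit ball; the summand 1 avoids division by 0\<close>
    define N where "N = norm x + 1"
    have N: "0 < N" unfolding N_def by (simp add: add_nonneg_pos)
    have "norm (apply_bcontfun x (discrete k) / of_real N) \<le> 1" for k
      using norm_bounded[of x "discrete k"] N by (simp add: norm_divide N_def)
    then obtain K where K: "\<And>i. norm (\<Sum>k. a i k * (apply_bcontfun x (discrete k) / of_real N)) \<le> K"
      using bdd[of "\<lambda>k. apply_bcontfun x (discrete k) / of_real N"] by blast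
    have "norm (T i x) \<le> N * K" for i
    proof -
      have "(\<Sum>k. a i k * (apply_bcontfun x (discrete k) / of_real N)) = T i x / of_real N"
        unfolding T_def using suminf_divide[OF s[of i x], of "of_real N"] by simp
      with K[of i] have "norm (T i x / of_real N) \<le> K" by (simp only:)
      then show ?thesis using N by (simp add: norm_divide divide_le_eq mult.commute)
    qed
    then show ?thesis by blast
  qed
  from uniform_boundedness[of T, OF lin this] obtain K where K: "\<And>i x. norm (T i x) \<le> K * norm x"
    by blast
  have "(\<Sum>k. norm (a i k)) \<le> \<bar>K\<bar>" for i
  proof -
    define c where "c k = cnj (sgn (a i k))" for k
    have c: "norm (c k) \<le> 1" for k by (simp add: c_def norm_sgn)
    have "continuous_on UNIV (c \<circ> of_discrete)"
      unfolding continuous_on_open_vimage[OF open_UNIV] by (simp add: open_discrete)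
    then have "c \<circ> of_discrete \<in> bcontfun"
      using c by (auto simp: bcontfun_def bounded_iff)
    then have app: "apply_bcontfun (Bcontfun (c \<circ> of_discrete)) = c \<circ> of_discrete"
      by (rule Bcontfun_inverse)
    have "a i k * c k = of_real (norm (a i k))" for k
    proof -
      have "a i k * cnj (a i k) = of_real (norm (a i k)) * of_real (norm (a i k))"
        using complex_norm_square[of "a i k"] by (simp add: power2_eq_square)
      then show ?thesis
        by (cases "a i k = 0") (simp_all add: c_def sgn_eq)
    qed
    then have "T i (Bcontfun (c \<circ> of_discrete)) = of_real (\<Sum>k. norm (a i k))"
      unfolding T_def app by (simp add: discrete_inverse suminf_of_real[OF summ])
    then have "(\<Sum>k. norm (a i k)) \<le> norm (T i (Bcontfun (c \<circ> of_discrete)))"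
      by simp
    also have "\<dots> \<le> \<bar>K\<bar> * norm (Bcontfun (c \<circ> of_discrete))"
      by (rule order_trans[OF K]) (auto intro: mult_right_mono)
    also have "\<dots> \<le> \<bar>K\<bar> * 1"
      by (intro mult_left_mono norm_bound) (auto simp: app c)
    finally show ?thesis by simp
  qed
  then show ?thesis by (rule that)
qed


section \<open>Abel summability from the two growth conditions\<close>

lemma borel_measurable_restrict_lborel:
  "borel_measurable (restrict_space lborel A) = borel_measurable (restrict_space borel A)"
  by (intro measurable_cong_sets sets_restrict_space_cong) simp_all

text \<open>The Abel sums are integrals over \<open>0 < u < 1\<close> with integrand \<open>(1-u) powr (b-1) h(\<rho>u)\<close>, where \<open>h\<close> has the coefficients
  \<open>B\<^sub>n \<lambda>\<^sub>n a\<^sub>n\<close> (\<open>repr\<close>). Parseval's identity at the radii \<open>\<surd>u\<close> for \<open>f\<close> and \<open>\<rho> \<surd>u\<close> for \<open>F\<close> bounds \<open>h(\<rho>u)\<close> by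
  \<open>C (1 - \<surd>u) powr (1-b) M\<^sub>\<infinity>((1+u)/2, F)\<close>; as \<open>1 - u \<le> 2 (1 - \<surd>u)\<close>, the powers cancel and an integrable majorant that
  is independent of \<open>\<rho>\<close> remains (\<open>bound\<close>, \<open>dom\<close>).\<close>

lemma abel_summable_pairing:
  fixes b :: real
  assumes b: "1 < b" and f: "f \<in> mixed_norm_space 1 \<infinity> (b - 1)"
    and g: "g \<in> mixed_norm_deriv_space \<infinity> 1 1 b"
  shows "abel_summable (\<lambda>n. taylor_coeff g n * taylor_coeff f n)"
proof -
  define a where "a = taylor_coeff f"
  define l where "l = taylor_coeff g"
  define d where "d n = of_real (deriv_weight b n) * l n" for n
  define c where "c n = a n * d n" for n
  define M where "M = restrict_space lborel {0<..<1::real}"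
  have b0: "0 < b" using b by simp
  have fh: "f holomorphic_on unit_disk" and gh: "g holomorphic_on unit_disk"
    using f g by (simp_all add: mixed_norm_space_def mixed_norm_deriv_space_def)
  have a: "a \<in> disk_seqs" and l: "l \<in> disk_seqs"
    unfolding a_def l_def using fh gh by (auto intro: taylor_coeff_disk_seqs)
  have d: "d \<in> disk_seqs"
    unfolding d_def by (intro disk_seqs_mult deriv_weight_disk_seqs b0 l)
  have c: "c \<in> disk_seqs"
    unfolding c_def by (intro disk_seqs_mult a d)
  have la: "(\<lambda>n. l n * a n) \<in> disk_seqs"
    by (intro disk_seqs_mult l a)
  have F: "powser d \<in> mixed_norm_space \<infinity> 1 1"
    using g by (simp add: mixed_norm_deriv_space_def frac_deriv_eq_powser d_def[abs_def] l_def)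
  have Fh: "powser d holomorphic_on unit_disk" by (rule powser_holomorphic[OF d])
  define Mx where "Mx t = integral_mean \<infinity> t (powser d)" for t
  have mono: "mono_on {0<..<1} Mx"
    unfolding Mx_def by (rule integral_mean_inf_mono[OF Fh])
  have finite: "(\<integral>\<^sup>+u\<in>{0<..<1}. ennreal (Mx u) \<partial>lborel) < \<infinity>"
    using F unfolding mixed_norm_inf_1_iff[OF Fh] Mx_def .
  obtain C where C: "0 \<le> C" "\<And>r. 0 < r \<Longrightarrow> r < 1 \<Longrightarrow>
      (\<integral>\<zeta>. norm (f (of_real r * \<zeta>)) \<partial>circle_measure) * (1 - r) powr (b - 1) \<le> C"
    using mixed_norm_1_infD[OF f] by blast
  have spM: "space M = {0<..<1}" by (simp add: M_def space_restrict_space)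
  have Mx0: "0 \<le> Mx t" if "0 < t" "t < 1" for t
    unfolding Mx_def using that by (intro integral_mean_inf_nonneg Fh)
  have bound: "norm ((1 - u) powr (b - 1) *\<^sub>R powser c (of_real (\<rho> * u)))
      \<le> 2 powr (b - 1) * C * Mx ((1 + u) / 2)"
    if u: "0 < u" "u < 1" and \<rho>: "0 < \<rho>" "\<rho> < 1" for u \<rho>
  proof -
    have su: "0 < sqrt u" "sqrt u < 1" using u by auto
    have "sqrt u \<le> (1 + u) / 2"
      using arith_geo_mean_sqrt[of 1 u] u by simp
    have \<rho>s: "0 < \<rho> * sqrt u" "\<rho> * sqrt u \<le> sqrt u" "\<rho> * sqrt u < 1"
    proof -
      show "0 < \<rho> * sqrt u" "\<rho> * sqrt u \<le> sqrt u"
        using su \<rho> mult_right_mono[of \<rho> 1 "sqrt u"] by auto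
      with su show "\<rho> * sqrt u < 1" by linarith
    qed
    have "powser c (of_real (\<rho> * u)) = powser c (of_real (sqrt u * (\<rho> * sqrt u)))"
      using u by (simp add: mult.left_commute)
    also have "\<dots> = (\<integral>\<zeta>. powser a (of_real (sqrt u) * \<zeta>) * powser d (of_real (\<rho> * sqrt u) * cnj \<zeta>) \<partial>circle_measure)"
      unfolding c_def by (rule integral_circle_pairing[symmetric]) (use a d su \<rho>s in auto)
    also have "norm \<dots> \<le> (\<integral>\<zeta>. norm (f (of_real (sqrt u) * \<zeta>)) * Mx ((1 + u) / 2) \<partial>circle_measure)"
    proof (rule Bochner_Integration.integral_norm_bound_integral)
      have cd: "continuous_on unit_disk (powser x)" if "x \<in> disk_seqs" for x
        by (intro holomorphic_on_imp_continuous_on powser_holomorphic that)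
      have cf: "continuous_on unit_disk f" by (intro holomorphic_on_imp_continuous_on fh)
      have in_disk: "\<And>\<zeta>. norm \<zeta> = 1 \<Longrightarrow> of_real (sqrt u) * \<zeta> \<in> unit_disk"
          "\<And>\<zeta>. norm \<zeta> = 1 \<Longrightarrow> of_real (\<rho> * sqrt u) * cnj \<zeta> \<in> unit_disk"
        using su \<rho>s \<rho> by (auto simp: norm_mult)
      show "integrable circle_measure (\<lambda>\<zeta>. powser a (of_real (sqrt u) * \<zeta>) * powser d (of_real (\<rho> * sqrt u) * cnj \<zeta>))"
        using in_disk
        by (intro integrable_circle_continuous continuous_on_mult continuous_on_compose2[OF cd[OF a]]
            continuous_on_compose2[OF cd[OF d]] continuous_intros) auto
      show "integrable circle_measure (\<lambda>\<zeta>. norm (f (of_real (sqrt u) * \<zeta>)) * Mx ((1 + u) / 2))"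
        using in_disk
        by (intro integrable_circle_continuous continuous_on_mult continuous_on_norm
            continuous_on_compose2[OF cf] continuous_intros) auto
      fix \<zeta> assume "\<zeta> \<in> space circle_measure"
      then have \<zeta>: "norm \<zeta> = 1" by simp
      have "powser a (of_real (sqrt u) * \<zeta>) = f (of_real (sqrt u) * \<zeta>)"
        unfolding a_def using in_disk(1)[OF \<zeta>] by (intro powser_taylor_coeff fh) simp
      moreover have "norm (powser d (of_real (\<rho> * sqrt u) * cnj \<zeta>)) \<le> Mx ((1 + u) / 2)"
        unfolding Mx_def
      proof (rule norm_le_integral_mean_inf[OF Fh])
        have "norm (complex_of_real (\<rho> * sqrt u) * cnj \<zeta>) = \<rho> * sqrt u"
          using \<zeta> abs_of_pos[OF \<rho>s(1)] by (simp only: norm_mult norm_of_real complex_mod_cnj mult_1_right)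
        also have "\<dots> \<le> (1 + u) / 2" using \<rho>s(2) \<open>sqrt u \<le> (1 + u) / 2\<close> by linarith
        finally show "norm (complex_of_real (\<rho> * sqrt u) * cnj \<zeta>) \<le> (1 + u) / 2" .
      qed (use u in auto)
      ultimately show "norm (powser a (of_real (sqrt u) * \<zeta>) * powser d (of_real (\<rho> * sqrt u) * cnj \<zeta>))
          \<le> norm (f (of_real (sqrt u) * \<zeta>)) * Mx ((1 + u) / 2)"
        by (simp only: norm_mult) (intro mult_left_mono, auto)
    qed
    also have "\<dots> = (\<integral>\<zeta>. norm (f (of_real (sqrt u) * \<zeta>)) \<partial>circle_measure) * Mx ((1 + u) / 2)"
      by simp
    finally have n: "norm (powser c (of_real (\<rho> * u)))
        \<le> (\<integral>\<zeta>. norm (f (of_real (sqrt u) * \<zeta>)) \<partial>circle_measure) * Mx ((1 + u) / 2)" .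
    have "1 - u = (1 + sqrt u) * (1 - sqrt u)"
      using u by (simp add: algebra_simps)
    then have "(1 - u) powr (b - 1) = (1 + sqrt u) powr (b - 1) * (1 - sqrt u) powr (b - 1)"
      using su by (simp add: powr_mult)
    also have "\<dots> \<le> 2 powr (b - 1) * (1 - sqrt u) powr (b - 1)"
      using su b by (intro mult_right_mono powr_mono2) auto
    finally have w: "(1 - u) powr (b - 1) \<le> 2 powr (b - 1) * (1 - sqrt u) powr (b - 1)" .
    have "norm ((1 - u) powr (b - 1) *\<^sub>R powser c (of_real (\<rho> * u)))
        \<le> (2 powr (b - 1) * (1 - sqrt u) powr (b - 1))
          * ((\<integral>\<zeta>. norm (f (of_real (sqrt u) * \<zeta>)) \<partial>circle_measure) * Mx ((1 + u) / 2))"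
      unfolding norm_scaleR using n w by (intro mult_mono) auto
    also have "\<dots> = 2 powr (b - 1) * ((\<integral>\<zeta>. norm (f (of_real (sqrt u) * \<zeta>)) \<partial>circle_measure)
        * (1 - sqrt u) powr (b - 1)) * Mx ((1 + u) / 2)"
      by (simp add: mult_ac)
    also have "\<dots> \<le> 2 powr (b - 1) * C * Mx ((1 + u) / 2)"
      using C(2)[OF su] u by (intro mult_right_mono mult_left_mono Mx0) auto
    finally show ?thesis .
  qed
  have repr: "(\<Sum>n. l n * a n * of_real \<rho> ^ n)
      = (\<integral>u. (1 - u) powr (b - 1) *\<^sub>R powser c (of_real (\<rho> * u)) \<partial>M) / of_real (Gamma b)"
    if \<rho>: "0 < \<rho>" "\<rho> < 1" for \<rho>
  proof -
    define h where "h n u = ((1 - u) powr (b - 1) * u ^ n) *\<^sub>R (c n * of_real \<rho> ^ n)" for n u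
    have int: "integrable M (h n)" for n
      unfolding h_def M_def by (intro integrable_scaleR_left integral_beta_power b0)
    have hn: "norm (h n u) = (1 - u) powr (b - 1) * u ^ n * norm (c n * of_real \<rho> ^ n)"
      if "u \<in> {0<..<1}" for n u
      using that by (simp add: h_def)
    have Gb: "0 < Gamma b" using b0 by (rule Gamma_real_pos)
    have cw: "c n = of_real (deriv_weight b n) * (l n * a n)" for n
      by (simp add: c_def d_def)
    have "(\<lambda>n. \<integral>u. h n u \<partial>M) sums (\<integral>u. (\<Sum>n. h n u) \<partial>M)"
    proof (rule sums_integral[OF int])
      show "AE u in M. summable (\<lambda>n. norm (h n u))"
      proof (rule AE_I2)
        fix u assume "u \<in> space M"
        then have u: "u \<in> {0<..<1}" by (simp add: spM)
        have "\<rho> * u < 1" using u \<rho> mult_strict_mono[of \<rho> 1 u 1] by simp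
        then have "summable (\<lambda>n. norm (c n) * (\<rho> * u) ^ n)"
          using u \<rho> by (intro disk_seqsD_real c) auto
        then have "summable (\<lambda>n. (1 - u) powr (b - 1) * (norm (c n) * (\<rho> * u) ^ n))"
          by (rule summable_mult)
        then show "summable (\<lambda>n. norm (h n u))"
          using u \<rho> by (simp add: hn norm_mult norm_power power_mult_distrib mult_ac)
      qed
      have "(\<integral>u. norm (h n u) \<partial>M) = Gamma b * (norm (l n * a n) * \<rho> ^ n)" for n
      proof -
        have "(\<integral>u. norm (h n u) \<partial>M) = (\<integral>u. (1 - u) powr (b - 1) * u ^ n * norm (c n * of_real \<rho> ^ n) \<partial>M)"
          by (rule Bochner_Integration.integral_cong) (auto simp: spM hn)
        also have "\<dots> = Gamma b / deriv_weight b n * norm (c n * of_real \<rho> ^ n)"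
          unfolding M_def by (simp add: integral_beta_power[OF b0])
        also have "\<dots> = Gamma b * (norm (l n * a n) * \<rho> ^ n)"
          using deriv_weight_pos[OF b0, of n] \<rho> by (simp add: cw norm_mult norm_power)
        finally show ?thesis .
      qed
      then show "summable (\<lambda>n. \<integral>u. norm (h n u) \<partial>M)"
        using disk_seqsD_real[OF la, of \<rho>] \<rho> by (auto intro: summable_mult)
    qed
    moreover have "(\<integral>u. h n u \<partial>M) = of_real (Gamma b) * (l n * a n * of_real \<rho> ^ n)" for n
    proof -
      have "(\<integral>u. h n u \<partial>M) = (Gamma b / deriv_weight b n) *\<^sub>R (c n * of_real \<rho> ^ n)"
        unfolding h_def M_def using integral_beta_power[OF b0, of n]
        by (subst integral_scaleR_left) auto
      also have "\<dots> = of_real (Gamma b) * (l n * a n * of_real \<rho> ^ n)"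
        using deriv_weight_pos[OF b0, of n] by (simp add: cw scaleR_conv_of_real)
      finally show ?thesis .
    qed
    moreover have "(\<integral>u. (\<Sum>n. h n u) \<partial>M) = (\<integral>u. (1 - u) powr (b - 1) *\<^sub>R powser c (of_real (\<rho> * u)) \<partial>M)"
    proof (rule Bochner_Integration.integral_cong)
      fix u assume "u \<in> space M"
      then have u: "u \<in> {0<..<1}" by (simp add: spM)
      have "norm (complex_of_real (\<rho> * u)) < 1"
        using u \<rho> mult_strict_mono[of \<rho> 1 u 1] by (simp add: norm_mult)
      from sums_scaleR_right[OF powser_sums[OF c this], of "(1 - u) powr (b - 1)"]
      show "(\<Sum>n. h n u) = (1 - u) powr (b - 1) *\<^sub>R powser c (of_real (\<rho> * u))"
        by (simp add: sums_iff h_def power_mult_distrib scaleR_conv_of_real mult_ac)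
    qed simp
    ultimately have "(\<lambda>n. of_real (Gamma b) * (l n * a n * of_real \<rho> ^ n)) sums
        (\<integral>u. (1 - u) powr (b - 1) *\<^sub>R powser c (of_real (\<rho> * u)) \<partial>M)"
      by simp
    from sums_divide[OF this, of "of_real (Gamma b)"] show ?thesis
      using Gb by (simp add: sums_iff)
  qed
  define L where "L = (\<integral>u. (1 - u) powr (b - 1) *\<^sub>R powser c (of_real u) \<partial>M) / of_real (Gamma b)"
  have cc: "continuous_on unit_disk (powser c)"
    by (intro holomorphic_on_imp_continuous_on powser_holomorphic c)
  have meas: "(\<lambda>u. (1 - u) powr (b - 1) *\<^sub>R powser c (of_real (\<rho> * u))) \<in> borel_measurable M"
    if "0 < \<rho>" "\<rho> \<le> 1" for \<rho>
    unfolding M_def borel_measurable_restrict_lborel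
  proof (rule borel_measurable_continuous_on_restrict)
    have "norm (complex_of_real (\<rho> * u)) < 1" if u: "u \<in> {0<..<1}" for u
    proof -
      have "0 < \<rho> * u" "\<rho> * u \<le> 1 * u"
        using u \<open>0 < \<rho>\<close> \<open>\<rho> \<le> 1\<close> by (auto intro!: mult_right_mono)
      then show ?thesis using u by (simp only: norm_of_real abs_of_pos) auto
    qed
    then show "continuous_on {0<..<1} (\<lambda>u. (1 - u) powr (b - 1) *\<^sub>R powser c (of_real (\<rho> * u)))"
      by (intro continuous_on_scaleR continuous_on_compose2[OF cc] continuous_on_powr'
          continuous_intros) auto
  qed
  have dom: "integrable M (\<lambda>u. 2 powr (b - 1) * C * Mx ((1 + u) / 2))"
  proof (intro integrable_mult_right integrableI_nonneg)
    have "mono_on {0<..<1} (\<lambda>u. Mx ((1 + u) / 2))"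
      by (rule mono_onI) (auto intro!: mono_onD[OF mono])
    then show "(\<lambda>u. Mx ((1 + u) / 2)) \<in> borel_measurable M"
      unfolding M_def borel_measurable_restrict_lborel by (rule borel_measurable_mono_on_fnc)
    show "AE u in M. 0 \<le> Mx ((1 + u) / 2)"
      by (rule AE_I2) (auto simp: spM intro!: Mx0)
    have "(\<integral>\<^sup>+u. ennreal (Mx ((1 + u) / 2)) \<partial>M) = (\<integral>\<^sup>+u\<in>{0<..<1}. ennreal (Mx ((1 + u) / 2)) \<partial>lborel)"
      unfolding M_def by (simp add: nn_integral_restrict_space)
    also have "\<dots> \<le> 2 * (\<integral>\<^sup>+u\<in>{0<..<1}. ennreal (Mx u) \<partial>lborel)"
      by (rule nn_integral_midpoint_le[OF mono])
    also have "\<dots> < \<infinity>" using finite by (simp add: ennreal_mult_less_top)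
    finally show "(\<integral>\<^sup>+u. ennreal (Mx ((1 + u) / 2)) \<partial>M) < \<infinity>" .
  qed
  have "((\<lambda>r::real. \<Sum>n. l n * a n * of_real r ^ n) \<longlongrightarrow> L) (at_left 1)"
  proof (rule tendsto_at_left_sequentially[of 0])
    fix S :: "nat \<Rightarrow> real"
    assume S: "\<And>n. S n < 1" "\<And>n. 0 < S n" "S \<longlonglongrightarrow> 1"
    have "(\<lambda>n. \<integral>u. (1 - u) powr (b - 1) *\<^sub>R powser c (of_real (S n * u)) \<partial>M)
        \<longlonglongrightarrow> (\<integral>u. (1 - u) powr (b - 1) *\<^sub>R powser c (of_real u) \<partial>M)"
    proof (rule integral_dominated_convergence[OF _ _ dom])
      show "(\<lambda>u. (1 - u) powr (b - 1) *\<^sub>R powser c (of_real u)) \<in> borel_measurable M"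
        using meas[of 1] by simp
      show "(\<lambda>u. (1 - u) powr (b - 1) *\<^sub>R powser c (of_real (S n * u))) \<in> borel_measurable M" for n
        using S less_imp_le by (intro meas) blast+
      show "AE u in M. norm ((1 - u) powr (b - 1) *\<^sub>R powser c (of_real (S n * u)))
          \<le> 2 powr (b - 1) * C * Mx ((1 + u) / 2)" for n
        by (intro AE_I2 bound S) (auto simp: spM)
      show "AE u in M. (\<lambda>n. (1 - u) powr (b - 1) *\<^sub>R powser c (of_real (S n * u)))
          \<longlonglongrightarrow> (1 - u) powr (b - 1) *\<^sub>R powser c (of_real u)"
      proof (rule AE_I2)
        fix u assume "u \<in> space M"
        then have u: "complex_of_real u \<in> unit_disk" by (simp add: spM)
        have "isCont (powser c) (of_real u)"
          using u by (intro isCont_powser[OF c]) simp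
        moreover have "(\<lambda>n. of_real (S n * u)) \<longlonglongrightarrow> complex_of_real (1 * u)"
          by (intro tendsto_intros S)
        ultimately have "(\<lambda>n. powser c (of_real (S n * u))) \<longlonglongrightarrow> powser c (of_real u)"
          by (intro isCont_tendsto_compose[of _ "powser c"]) auto
        then show "(\<lambda>n. (1 - u) powr (b - 1) *\<^sub>R powser c (of_real (S n * u)))
          \<longlonglongrightarrow> (1 - u) powr (b - 1) *\<^sub>R powser c (of_real u)"
          by (intro tendsto_intros)
      qed
    qed
    then have "(\<lambda>n. (\<integral>u. (1 - u) powr (b - 1) *\<^sub>R powser c (of_real (S n * u)) \<partial>M) / of_real (Gamma b))
        \<longlonglongrightarrow> L"
      unfolding L_def using Gamma_real_pos[OF b0] by (intro tendsto_divide tendsto_const) auto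
    then show "(\<lambda>m. \<Sum>n. l n * a n * of_real (S m) ^ n) \<longlonglongrightarrow> L"
      using repr[OF S(2) S(1)] by simp
  qed simp
  moreover have "summable (\<lambda>n. l n * a n * of_real r ^ n)" if "0 < r" "r < 1" for r :: real
    using powser_sums[OF la, of "of_real r"] that by (auto simp: sums_iff)
  ultimately show ?thesis
    unfolding abel_summable_def a_def l_def by blast
qed


section \<open>Mixtures of power series\<close>

lemma tendsto_suminf_dominated:
  fixes a :: "nat \<Rightarrow> 'b \<Rightarrow> complex"
  assumes "\<And>k. ((\<lambda>x. a k x) \<longlongrightarrow> l k) F" "eventually (\<lambda>x. \<forall>k. norm (a k x) \<le> M k) F"
    and "summable M" "F \<noteq> bot"
  shows "((\<lambda>x. \<Sum>k. a k x) \<longlongrightarrow> (\<Sum>k. l k)) F"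
proof -
  have "eventually (\<lambda>(k, x). norm (a k x) \<le> M k) (at_top \<times>\<^sub>F F)"
    unfolding eventually_prod_filter using assms(2)
    by (intro exI[of _ "\<lambda>_. True"] exI[of _ "\<lambda>x. \<forall>k. norm (a k x) \<le> M k"]) auto
  from tannerys_theorem[OF assms(1) this assms(3,4)] show ?thesis by blast
qed

lemma bounded_disk_seqs:
  assumes "\<And>n. norm (a n) \<le> K"
  shows "a \<in> disk_seqs"
  unfolding disk_seqs_def
proof safe
  fix r :: real assume r: "0 < r" "r < 1"
  show "summable (\<lambda>n. norm (a n) * r ^ n)"
  proof (rule summable_comparison_test')
    show "summable (\<lambda>n. K * r ^ n)" using r by (intro summable_mult summable_geometric) auto
    show "norm (norm (a n) * r ^ n) \<le> K * r ^ n" for n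
      using r mult_right_mono[OF assms[of n], of "r ^ n"] by (simp add: abs_mult)
  qed
qed

lemma mixture_term_le:
  fixes \<gamma> v :: complex
  assumes "norm v \<le> 1"
  shows "norm (\<gamma> * v) \<le> norm \<gamma>"
  using mult_left_mono[OF assms, of "norm \<gamma>"] by (simp add: norm_mult)

lemma summable_mixture:
  fixes \<gamma> v :: "nat \<Rightarrow> complex"
  assumes "summable (\<lambda>k. norm (\<gamma> k))" "\<And>k. norm (v k) \<le> 1"
  shows "summable (\<lambda>k. norm (\<gamma> k * v k))"
  by (rule summable_comparison_test'[OF assms(1)]) (use mixture_term_le[OF assms(2)] in simp)

lemma norm_mixture_le:
  fixes \<gamma> v :: "nat \<Rightarrow> complex"
  assumes \<gamma>: "summable (\<lambda>k. norm (\<gamma> k))" and v: "\<And>k. norm (v k) \<le> 1"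
  shows "norm (\<Sum>k<K. \<gamma> k * v k) \<le> (\<Sum>k. norm (\<gamma> k))" "norm (\<Sum>k. \<gamma> k * v k) \<le> (\<Sum>k. norm (\<gamma> k))"
proof -
  have "norm (\<Sum>k<K. \<gamma> k * v k) \<le> (\<Sum>k<K. norm (\<gamma> k))"
    by (intro sum_norm_le mixture_term_le v)
  also have "\<dots> \<le> (\<Sum>k. norm (\<gamma> k))"
    by (intro sum_le_suminf \<gamma>) auto
  finally show "norm (\<Sum>k<K. \<gamma> k * v k) \<le> (\<Sum>k. norm (\<gamma> k))" .
  have "norm (\<Sum>k. \<gamma> k * v k) \<le> (\<Sum>k. norm (\<gamma> k * v k))"
    by (rule summable_norm[OF summable_mixture[OF assms]])
  also have "\<dots> \<le> (\<Sum>k. norm (\<gamma> k))"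
    by (intro suminf_le mixture_term_le v \<gamma> summable_mixture)
  finally show "norm (\<Sum>k. \<gamma> k * v k) \<le> (\<Sum>k. norm (\<gamma> k))" .
qed

text \<open>Mixing the coefficients \<open>d\<^sub>n v\<^sub>k\<^sub>n\<close> with absolutely summable weights \<open>\<gamma>\<^sub>k\<close> mixes the functions in the same way.
  It is applied both to test functions and to their pairings.\<close>

lemma powser_mixture_sums:
  fixes \<gamma> :: "nat \<Rightarrow> complex" and v :: "nat \<Rightarrow> nat \<Rightarrow> complex"
  assumes d: "d \<in> disk_seqs" and z: "norm z < 1"
    and \<gamma>: "summable (\<lambda>k. norm (\<gamma> k))" and v: "\<And>k n. norm (v k n) \<le> 1"
  shows "(\<lambda>k. \<gamma> k * powser (\<lambda>n. d n * v k n) z) sums powser (\<lambda>n. d n * (\<Sum>k. \<gamma> k * v k n)) z"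
proof -
  have dv: "(\<lambda>n. d n * v k n) \<in> disk_seqs" for k
    by (intro disk_seqs_mult d bounded_disk_seqs[where K = 1] v)
  have lim: "(\<lambda>K. \<Sum>k<K. \<gamma> k * v k n) \<longlonglongrightarrow> (\<Sum>k. \<gamma> k * v k n)" for n
    by (intro summable_LIMSEQ summable_norm_cancel[OF summable_mixture[OF \<gamma>]] v)
  have "(\<lambda>K. \<Sum>n. d n * z ^ n * (\<Sum>k<K. \<gamma> k * v k n)) \<longlonglongrightarrow> (\<Sum>n. d n * z ^ n * (\<Sum>k. \<gamma> k * v k n))"
  proof (rule tendsto_suminf_dominated)
    show "(\<lambda>K. d n * z ^ n * (\<Sum>k<K. \<gamma> k * v k n)) \<longlonglongrightarrow> d n * z ^ n * (\<Sum>k. \<gamma> k * v k n)" for n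
      by (intro tendsto_intros lim)
    show "eventually (\<lambda>K. \<forall>n. norm (d n * z ^ n * (\<Sum>k<K. \<gamma> k * v k n))
        \<le> norm (d n * z ^ n) * (\<Sum>k. norm (\<gamma> k))) sequentially"
      unfolding norm_mult[of "d _ * z ^ _"]
      by (intro always_eventually allI mult_left_mono norm_mixture_le \<gamma> v norm_ge_zero)
  qed (auto intro!: summable_mult2 disk_seqsD[OF d z])
  moreover have "(\<Sum>n. d n * z ^ n * (\<Sum>k<K. \<gamma> k * v k n)) = (\<Sum>k<K. \<gamma> k * powser (\<lambda>n. d n * v k n) z)" for K
  proof -
    have "(\<lambda>n. \<Sum>k<K. \<gamma> k * (d n * v k n * z ^ n)) sums (\<Sum>k<K. \<gamma> k * powser (\<lambda>n. d n * v k n) z)"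
      by (intro sums_sum sums_mult powser_sums dv z)
    moreover have "(\<Sum>k<K. \<gamma> k * (d n * v k n * z ^ n)) = d n * z ^ n * (\<Sum>k<K. \<gamma> k * v k n)" for n
      by (simp add: sum_distrib_left mult_ac)
    ultimately show ?thesis by (simp add: sums_iff)
  qed
  moreover have "(\<Sum>n. d n * z ^ n * (\<Sum>k. \<gamma> k * v k n)) = powser (\<lambda>n. d n * (\<Sum>k. \<gamma> k * v k n)) z"
    by (simp add: powser_def mult_ac)
  ultimately show ?thesis
    unfolding sums_def by simp
qed


section \<open>Sums of Cauchy kernels at dyadic scales\<close>

definition dyadic :: "nat \<Rightarrow> real" where "dyadic k = (1 / 2) ^ Suc k"

lemma dyadic_pos: "0 < dyadic k"
  by (simp add: dyadic_def)

lemma dyadic_less_1: "dyadic k < 1"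
  by (simp add: dyadic_def power_Suc_less_one del: power_Suc)

lemma dyadic_sums: "dyadic sums 1"
  unfolding dyadic_def by (rule power_half_series)

lemma summable_dyadic: "summable dyadic"
  using dyadic_sums by (rule sums_summable)

text \<open>The points \<open>w\<^sub>k\<close> approach the circle at dyadic rate, one at each scale; their arguments and the bounded
  coefficients \<open>c\<^sub>k\<close> are arbitrary.\<close>

locale dyadic_atoms =
  fixes b :: real and w c :: "nat \<Rightarrow> complex"
  assumes b: "1 < b" and norm_w: "\<And>k. norm (w k) = 1 - dyadic k" and norm_c: "\<And>k. norm (c k) \<le> 1"
begin

definition coef :: "nat \<Rightarrow> complex" where "coef k = c k * of_real (dyadic k)"

definition moment :: "nat \<Rightarrow> complex" where "moment n = (\<Sum>k. coef k * w k ^ n)"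

definition atom_sum :: "complex \<Rightarrow> complex" where
  "atom_sum = powser (\<lambda>n. of_real (deriv_weight b n / Gamma (b + 1)) * moment n)"

lemma norm_coef: "norm (coef k) \<le> dyadic k"
  using mult_right_mono[OF norm_c, of "dyadic k" k] dyadic_pos[of k] by (simp add: coef_def norm_mult)

lemma norm_w_less: "norm (w k) < 1"
  by (simp add: norm_w dyadic_pos)

lemma summable_coef: "summable (\<lambda>k. norm (coef k))"
  by (rule summable_comparison_test'[OF summable_dyadic]) (simp add: norm_coef)

lemma norm_w_power: "norm (w k ^ n) \<le> 1"
  unfolding norm_power using norm_w_less[of k] by (intro power_le_one) auto

lemma moment_disk_seqs: "moment \<in> disk_seqs"
  by (rule bounded_disk_seqs) (use norm_mixture_le(2)[OF summable_coef norm_w_power] in \<open>simp add: moment_def\<close>)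

lemma powser_moment_sums:
  assumes d: "d \<in> disk_seqs" and z: "norm z < 1"
  shows "(\<lambda>k. coef k * powser d (w k * z)) sums powser (\<lambda>n. d n * moment n) z"
proof -
  have "powser (\<lambda>n. d n * w k ^ n) z = powser d (w k * z)" for k
    by (simp add: powser_def power_mult_distrib mult.assoc)
  with powser_mixture_sums[where v = "\<lambda>k n. w k ^ n", OF d z summable_coef norm_w_power] show ?thesis
    by (simp only: moment_def)
qed

lemma weight_disk_seqs: "(\<lambda>n. of_real (deriv_weight b n / Gamma (b + 1))) \<in> disk_seqs"
proof -
  have "(\<lambda>n. of_real (1 / Gamma (b + 1)) :: complex) \<in> disk_seqs"
    unfolding disk_seqs_def by (auto intro!: summable_mult summable_geometric)
  from disk_seqs_mult[OF this deriv_weight_disk_seqs[of b]] show ?thesis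
    using b by simp
qed

lemma atom_coeffs_disk_seqs:
  "(\<lambda>n. of_real (deriv_weight b n / Gamma (b + 1)) * moment n) \<in> disk_seqs"
  by (rule disk_seqs_mult[OF weight_disk_seqs moment_disk_seqs])

lemma atom_sum_holomorphic: "atom_sum holomorphic_on unit_disk"
  unfolding atom_sum_def by (rule powser_holomorphic[OF atom_coeffs_disk_seqs])

lemma taylor_coeff_atom_sum:
  "taylor_coeff atom_sum n = of_real (deriv_weight b n / Gamma (b + 1)) * moment n"
  unfolding atom_sum_def taylor_coeff_powser[OF atom_coeffs_disk_seqs] ..

definition atom :: "nat \<Rightarrow> complex \<Rightarrow> complex" where
  "atom k z = coef k * (1 - w k * z) powr (- of_real (b + 1))"

lemma atom_sums:
  assumes z: "norm z < 1"
  shows "(\<lambda>k. atom k z) sums atom_sum z"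
proof -
  have "powser (\<lambda>n. of_real (deriv_weight b n / Gamma (b + 1))) (w k * z)
      = (1 - w k * z) powr (- of_real (b + 1))" for k
  proof -
    have wz: "norm (w k * z) < 1"
      using norm_w_less[of k] z mult_strict_mono'[of "norm (w k)" 1 "norm z" 1]
      by (simp add: norm_mult)
    have G: "Gamma (b + 1) \<noteq> 0"
      using b by (intro Gamma_plus1_neq_0) simp
    have "0 < b" using b by simp
    from sums_divide[OF cauchy_power_sums[OF this wz], of "of_real (Gamma (b + 1))"] show ?thesis
      using G by (simp add: powser_def sums_iff)
  qed
  with powser_moment_sums[OF weight_disk_seqs z] show ?thesis
    unfolding atom_sum_def atom_def by (simp only:)
qed

definition majorant :: "nat \<Rightarrow> complex \<Rightarrow> real" where
  "majorant k \<zeta> = dyadic k * norm (1 - w k * \<zeta>) powr (- (b + 1))"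

lemma majorant_nonneg: "0 \<le> majorant k \<zeta>"
  using dyadic_pos[of k] by (simp add: majorant_def)

lemma norm_atom_le_majorant: "norm (atom k z) \<le> majorant k z"
  unfolding atom_def majorant_def norm_mult
  by (intro mult_mono norm_coef) (use dyadic_pos[of k] in \<open>auto simp: norm_powr_real_powr' less_imp_le\<close>)

lemma norm_kernel_ge: "\<zeta> \<in> unit_circle \<Longrightarrow> dyadic k \<le> norm (1 - w k * \<zeta>)"
  using norm_one_minus_ge[of \<zeta> "w k"] by (simp add: norm_w)

text \<open>Moving from a boundary point into its Stolz region changes \<open>1 - w\<^sub>k \<zeta>\<close> by at most \<open>a (1 - |z|)\<close>, and
  \<open>1 - |z| \<le> |1 - w\<^sub>k z|\<close>. So the values on the circle control each summand both along the radius and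
  nontangentially.\<close>

lemma majorant_near_boundary:
  assumes \<zeta>: "\<zeta> \<in> unit_circle" and z: "norm z < 1" "dist z \<zeta> \<le> a * (1 - norm z)" and a: "0 < a"
  shows "majorant k z \<le> (1 + a) powr (b + 1) * majorant k \<zeta>"
proof -
  have pos: "0 < norm (1 - w k * \<zeta>)" using norm_kernel_ge[OF \<zeta>, of k] dyadic_pos[of k] by linarith
  have "norm (w k * z) \<le> 1 * norm z"
    unfolding norm_mult using norm_w_less[of k] by (intro mult_right_mono) auto
  then have "1 - norm z \<le> norm (1 - w k * z)"
    using norm_triangle_ineq2[of 1 "w k * z"] by simp
  then have d: "dist z \<zeta> \<le> a * norm (1 - w k * z)"
    using z(2) a mult_left_mono[of "1 - norm z" "norm (1 - w k * z)" a] by linarith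
  have "norm (1 - w k * \<zeta>) = norm ((1 - w k * z) + w k * (z - \<zeta>))"
    by (simp add: algebra_simps)
  also have "\<dots> \<le> norm (1 - w k * z) + norm (w k * (z - \<zeta>))"
    by (rule norm_triangle_ineq)
  also have "norm (w k * (z - \<zeta>)) \<le> 1 * dist z \<zeta>"
    unfolding norm_mult dist_norm using norm_w_less[of k] by (intro mult_right_mono) auto
  finally have le: "norm (1 - w k * \<zeta>) / (1 + a) \<le> norm (1 - w k * z)"
    using d a by (simp add: divide_le_eq algebra_simps)
  have "norm (1 - w k * z) powr (- (b + 1)) \<le> (norm (1 - w k * \<zeta>) / (1 + a)) powr (- (b + 1))"
    using le pos a b by (intro powr_mono2') auto
  also have "\<dots> = (1 + a) powr (b + 1) * norm (1 - w k * \<zeta>) powr (- (b + 1))"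
  proof -
    have "(1 + a) powr (- (b + 1)) = 1 / (1 + a) powr (b + 1)"
      by (rule powr_minus_divide)
    then show ?thesis
      by (simp only: powr_divide) simp
  qed
  finally have "dyadic k * norm (1 - w k * z) powr (- (b + 1))
      \<le> dyadic k * ((1 + a) powr (b + 1) * norm (1 - w k * \<zeta>) powr (- (b + 1)))"
    using dyadic_pos[of k] by (intro mult_left_mono) auto
  then show ?thesis
    by (simp add: majorant_def mult_ac)
qed

text \<open>The arcs removed around the peaks shrink by this factor from one scale to the next. Any factor less than 1 keeps
  their total length finite; this one is so close to 1 that the weighted kernels still decay
  like \<open>2 powr (-j/2)\<close> off the arcs, because \<open>\<theta> powr (-(b+1)) = \<surd>2\<close>.\<close>

definition \<theta> :: real where "\<theta> = 2 powr (- (1 / (2 * (b + 1))))"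

text \<open>A set of measure \<open>O(2\<^sup>-\<^sup>N)\<close> off which the sum of the kernels is \<open>O(2\<^sup>b\<^sup>N)\<close>: for \<open>k < N\<close> the kernels are small
  everywhere, and for \<open>k = N + j\<close> an arc of length comparable to \<open>2\<^sup>-\<^sup>N \<theta>\<^sup>j\<close> around the peak is removed.\<close>

definition exceptional :: "nat \<Rightarrow> complex set" where
  "exceptional N = (\<Union>j. {\<zeta>\<in>unit_circle. norm (1 - w (N + j) * \<zeta>) < (1 / 2) ^ N * \<theta> ^ j})"

lemma theta: "0 < \<theta>" "\<theta> < 1" "\<theta> powr (- (b + 1)) = sqrt 2"
proof -
  show "0 < \<theta>" by (simp add: \<theta>_def)
  show "\<theta> < 1" using b powr_less_mono[of "- (1 / (2 * (b + 1)))" 0 2] by (simp add: \<theta>_def)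
  show "\<theta> powr (- (b + 1)) = sqrt 2"
  proof -
    have "1 / (2 * s) * s = 1 / 2" if "s \<noteq> 0" for s :: real
      using that by simp
    from this[of "b + 1"] have "1 / (2 * (b + 1)) * (b + 1) = 1 / 2"
      using b by linarith
    then have "- (1 / (2 * (b + 1))) * (- (b + 1)) = 1 / 2"
      by (simp only: minus_mult_minus)
    then show ?thesis by (simp only: \<theta>_def powr_powr) (simp add: powr_half_sqrt)
  qed
qed

lemma sets_exceptional: "exceptional N \<in> sets circle_measure"
  unfolding exceptional_def
  by (intro sets.countable_UN image_subsetI measure_cauchy_kernel_level norm_w_less)
     (use theta in auto)

lemma measure_exceptional: "measure circle_measure (exceptional N) \<le> 4 / (1 - \<theta>) * (1 / 2) ^ N"
proof -
  let ?A = "\<lambda>j. {\<zeta>\<in>unit_circle. norm (1 - w (N + j) * \<zeta>) < (1 / 2) ^ N * \<theta> ^ j}"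
  have d: "0 < (1 / 2) ^ N * \<theta> ^ j" for j using theta by simp
  have "emeasure circle_measure (exceptional N) \<le> (\<Sum>j. emeasure circle_measure (?A j))"
    unfolding exceptional_def
    by (intro emeasure_subadditive_countably image_subsetI measure_cauchy_kernel_level norm_w_less d)
  also have "\<dots> \<le> (\<Sum>j. ennreal (4 * (1 / 2) ^ N * \<theta> ^ j))"
    unfolding emeasure_circle_eq_measure
    using measure_cauchy_kernel_level(1)[OF norm_w_less d]
    by (intro suminf_le ennreal_leI) (auto simp: mult.assoc)
  also have "\<dots> = ennreal (\<Sum>j. 4 * (1 / 2) ^ N * \<theta> ^ j)"
    using theta by (intro suminf_ennreal2) (auto intro!: summable_mult summable_geometric)
  also have "(\<Sum>j. 4 * (1 / 2) ^ N * \<theta> ^ j) = 4 / (1 - \<theta>) * (1 / 2) ^ N"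
    using theta by (subst suminf_mult) (auto simp: suminf_geometric intro!: summable_geometric)
  finally show ?thesis
    using theta unfolding emeasure_circle_eq_measure by (subst (asm) ennreal_le_iff) auto
qed

definition major_const :: real where
  "major_const = 2 powr b / (2 powr b - 1) + 1 / 2 / (1 - sqrt 2 / 2)"

lemma major_const_pos: "0 < major_const"
proof -
  have "1 < 2 powr b" using b powr_less_mono[of 0 b 2] by simp
  moreover have "sqrt 2 / 2 < 1" using sqrt2_less_2 by simp
  ultimately show ?thesis
    unfolding major_const_def by (intro add_pos_pos divide_pos_pos) auto
qed

text \<open>For \<open>k < N\<close> each term is at most \<open>2 powr (b(k+1))\<close>, a geometric series dominated by its end; for \<open>k = N + j\<close> the
  distance from the peak gives \<open>2 powr (bN)\<close> times \<open>(\<surd>2/2)\<^sup>j\<close>.\<close>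

lemma majorant_off_exceptional:
  assumes \<zeta>: "\<zeta> \<in> unit_circle" "\<zeta> \<notin> exceptional N"
  shows "summable (\<lambda>k. majorant k \<zeta>)"
    and "(\<Sum>k. majorant k \<zeta>) \<le> major_const * (2 powr b) ^ N"
proof -
  define B where "B = 2 powr b"
  have B: "1 < B" using b powr_less_mono[of 0 b 2] by (simp add: B_def)
  have s2: "0 \<le> sqrt 2 / 2" "sqrt 2 / 2 < 1" using sqrt2_less_2 by auto
  have head: "majorant k \<zeta> \<le> B * B ^ k" for k
  proof -
    have "norm (1 - w k * \<zeta>) powr (- (b + 1)) \<le> dyadic k powr (- (b + 1))"
      using norm_kernel_ge[OF \<zeta>(1)] dyadic_pos b by (intro powr_mono2') auto
    then have "majorant k \<zeta> \<le> dyadic k * dyadic k powr (- (b + 1))"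
      unfolding majorant_def using dyadic_pos[of k] by (intro mult_left_mono) auto
    also have "\<dots> = dyadic k powr (- b)"
      using dyadic_pos[of k] powr_add[of "dyadic k" 1 "- (b + 1)"] by simp
    also have "dyadic k = 2 powr (- real (Suc k))"
      by (simp only: dyadic_def powr_minus powr_realpow zero_less_numeral power_one_over inverse_eq_divide)
    also have "(2 powr (- real (Suc k))) powr (- b) = B powr (real (Suc k))"
      by (simp only: B_def powr_powr minus_mult_minus mult.commute)
    also have "\<dots> = B ^ Suc k"
      using B by (intro powr_realpow) auto
    finally show ?thesis by simp
  qed
  have tail: "majorant (j + N) \<zeta> \<le> 1 / 2 * B ^ N * (sqrt 2 / 2) ^ j" for j
  proof -
    have d0: "0 < (1 / 2) ^ N * \<theta> ^ j" using theta by simp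
    have "(1 / 2) ^ N * \<theta> ^ j \<le> norm (1 - w (j + N) * \<zeta>)"
      using \<zeta> by (auto simp: exceptional_def add.commute not_less)
    then have "norm (1 - w (j + N) * \<zeta>) powr (- (b + 1)) \<le> ((1 / 2) ^ N * \<theta> ^ j) powr (- (b + 1))"
      using d0 b by (intro powr_mono2') auto
    also have "\<dots> = ((1 / 2) ^ N) powr (- (b + 1)) * (\<theta> ^ j) powr (- (b + 1))"
      by (rule powr_mult)
    also have "(\<theta> ^ j) powr (- (b + 1)) = sqrt 2 ^ j"
    proof -
      have "(\<theta> ^ j) powr (- (b + 1)) = (\<theta> powr real j) powr (- (b + 1))"
        using theta by (simp add: powr_realpow)
      also have "\<dots> = (\<theta> powr (- (b + 1))) powr real j"
        unfolding powr_powr by (simp only: mult.commute)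
      finally show ?thesis unfolding theta(3) by (simp add: powr_realpow)
    qed
    also have "((1 / 2) ^ N) powr (- (b + 1)) = (2 ^ N) * B ^ N"
    proof -
      have "((1 / 2) ^ N) = 2 powr (- real N)"
        by (simp only: powr_minus powr_realpow zero_less_numeral power_one_over inverse_eq_divide)
      then have "((1 / 2) ^ N) powr (- (b + 1)) = 2 powr (real N + real N * b)"
        by (simp only: powr_powr) (simp add: algebra_simps)
      also have "\<dots> = 2 powr real N * (2 powr b) powr real N"
        by (simp add: powr_add powr_powr mult.commute)
      finally show ?thesis using B by (simp add: powr_realpow B_def)
    qed
    finally have "majorant (j + N) \<zeta> \<le> dyadic (j + N) * (2 ^ N * B ^ N * sqrt 2 ^ j)"
      unfolding majorant_def using dyadic_pos[of "j + N"] by (intro mult_left_mono) auto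
    also have "\<dots> = 1 / 2 * B ^ N * (sqrt 2 / 2) ^ j"
      by (simp add: dyadic_def power_add power_divide)
    finally show ?thesis .
  qed
  have stail: "summable (\<lambda>j. 1 / 2 * B ^ N * (sqrt 2 / 2) ^ j)"
    using s2 by (intro summable_mult summable_geometric) auto
  have "summable (\<lambda>j. majorant (j + N) \<zeta>)"
    by (rule summable_comparison_test'[OF stail]) (use tail majorant_nonneg in auto)
  then show summ: "summable (\<lambda>k. majorant k \<zeta>)"
    by (subst (asm) summable_iff_shift)
  have "(\<Sum>k. majorant k \<zeta>) = (\<Sum>j. majorant (j + N) \<zeta>) + (\<Sum>k<N. majorant k \<zeta>)"
    by (rule suminf_split_initial_segment[OF summ])
  also have "\<dots> \<le> (\<Sum>j. 1 / 2 * B ^ N * (sqrt 2 / 2) ^ j) + (\<Sum>k<N. B * B ^ k)"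
    using summ by (intro add_mono suminf_le sum_mono tail head stail summable_ignore_initial_segment)
  also have "(\<Sum>j. 1 / 2 * B ^ N * (sqrt 2 / 2) ^ j) = 1 / 2 / (1 - sqrt 2 / 2) * B ^ N"
    using s2 by (subst suminf_mult) (auto simp: suminf_geometric intro!: summable_geometric)
  also have "(\<Sum>k<N. B * B ^ k) = B * ((B ^ N - 1) / (B - 1))"
    using B by (simp add: sum_distrib_left[symmetric] geometric_sum)
  also have "\<dots> \<le> B / (B - 1) * B ^ N"
    using B by (simp add: divide_right_mono)
  finally show "(\<Sum>k. majorant k \<zeta>) \<le> major_const * (2 powr b) ^ N"
    by (simp add: major_const_def B_def algebra_simps)
qed

definition total_majorant :: "complex \<Rightarrow> real" where
  "total_majorant \<zeta> = (\<Sum>k. majorant k \<zeta>)"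

lemma measurable_total_majorant: "total_majorant \<in> borel_measurable circle_measure"
proof -
  note [measurable] = measurable_circle_ident
  show ?thesis
    unfolding total_majorant_def majorant_def by measurable
qed

lemma AE_majorant_summable: "AE \<zeta> in circle_measure. summable (\<lambda>k. majorant k \<zeta>)"
proof (rule AE_I)
  let ?Z = "\<Inter>N. exceptional N"
  show sets: "?Z \<in> sets circle_measure"
    by (intro sets.countable_INT image_subsetI sets_exceptional) auto
  show "{\<zeta>\<in>space circle_measure. \<not> summable (\<lambda>k. majorant k \<zeta>)} \<subseteq> ?Z"
    using majorant_off_exceptional(1) by auto
  have "(\<lambda>N. 4 / (1 - \<theta>) * (1 / 2) ^ N) \<longlonglongrightarrow> 4 / (1 - \<theta>) * 0"
    by (intro tendsto_intros LIMSEQ_power_zero) simp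
  moreover have "measure circle_measure ?Z \<le> 4 / (1 - \<theta>) * (1 / 2) ^ N" for N
    by (rule order_trans[OF circle.finite_measure_mono[OF _ sets_exceptional] measure_exceptional]) blast
  ultimately have "measure circle_measure ?Z \<le> 4 / (1 - \<theta>) * 0"
    by (intro LIMSEQ_le_const) auto
  then have "measure circle_measure ?Z \<le> 0" by simp
  then show "emeasure circle_measure ?Z = 0"
    unfolding emeasure_circle_eq_measure by (simp add: measure_le_0_iff)
qed

text \<open>At height \<open>x\<close> choose \<open>N\<close> with \<open>2\<^sup>b\<^sup>N\<close> comparable to \<open>x\<close>; then the set where the sum exceeds \<open>x\<close> lies in the
  exceptional set, of measure comparable to \<open>2\<^sup>-\<^sup>N\<close>, that is to \<open>x powr (-1/b)\<close>.\<close>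

lemma total_majorant_weak_type:
  obtains A where "0 < A" "\<And>x. 0 < x \<Longrightarrow>
    emeasure circle_measure {\<zeta>\<in>space circle_measure. x < total_majorant \<zeta>} \<le> ennreal (A * x powr (- (1 / b)))"
proof -
  define C where "C = major_const"
  define D where "D = 4 / (1 - \<theta>)"
  have C: "0 < C" unfolding C_def by (rule major_const_pos)
  have D: "0 < D" unfolding D_def using theta by simp
  define A where "A = max 1 (2 * D) * C powr (1 / b)"
  have A: "0 < A" using C by (simp add: A_def)
  have "measure circle_measure {\<zeta>\<in>space circle_measure. x < total_majorant \<zeta>} \<le> A * x powr (- (1 / b))"
    if x: "0 < x" for x
  proof -
    have Ax: "A * x powr (- (1 / b)) = max 1 (2 * D) / (x / C) powr (1 / b)"
    proof -
      have "x powr (- (1 / b)) = 1 / x powr (1 / b)" by (rule powr_minus_divide)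
      moreover have "(x / C) powr (1 / b) = x powr (1 / b) / C powr (1 / b)" by (rule powr_divide)
      ultimately show ?thesis by (simp add: A_def)
    qed
    show ?thesis
    proof (cases "x \<le> C")
      case True
      have "(x / C) powr (1 / b) \<le> 1"
        using True x C b by (intro powr_le1) auto
      then have "1 \<le> A * x powr (- (1 / b))"
        unfolding Ax using x C by (simp add: le_divide_eq)
      then show ?thesis
        by (rule order_trans[OF circle.prob_le_1])
    next
      case False
      have "1 \<le> (x / C) powr (1 / b)"
        using False C b by (intro ge_one_powr_ge_zero) auto
      then obtain N where N: "2 ^ N \<le> (x / C) powr (1 / b)" "(x / C) powr (1 / b) < 2 * 2 ^ N"
        by (rule dyadic_floor)
      have "(2 ^ N) powr b \<le> ((x / C) powr (1 / b)) powr b"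
        using N(1) b by (intro powr_mono2) auto
      also have "\<dots> = x / C"
        using x C b by (simp add: powr_powr)
      finally have "(2 ^ N) powr b \<le> x / C" .
      then have "(2 powr b) ^ N \<le> x / C"
      proof -
        have "(2 powr b) ^ N = (2 powr b) powr real N"
          by (simp add: powr_realpow)
        also have "\<dots> = (2 powr real N) powr b"
          unfolding powr_powr by (simp only: mult.commute)
        also have "2 powr real N = (2 :: real) ^ N"
          by (simp add: powr_realpow)
        finally show ?thesis
          using \<open>(2 ^ N) powr b \<le> x / C\<close> by (simp only:)
      qed
      then have "C * (2 powr b) ^ N \<le> x"
        using C by (simp add: le_divide_eq mult.commute)
      then have le: "total_majorant \<zeta> \<le> x" if "\<zeta> \<in> unit_circle" "\<zeta> \<notin> exceptional N" for \<zeta>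
        unfolding total_majorant_def using majorant_off_exceptional(2)[OF that] unfolding C_def by linarith
      have "{\<zeta>\<in>space circle_measure. x < total_majorant \<zeta>} \<subseteq> exceptional N"
        unfolding space_circle_measure using le not_less by blast
      then have "measure circle_measure {\<zeta>\<in>space circle_measure. x < total_majorant \<zeta>}
          \<le> measure circle_measure (exceptional N)"
        by (intro circle.finite_measure_mono sets_exceptional)
      also have "\<dots> \<le> D / 2 ^ N"
        using measure_exceptional[of N] by (simp add: D_def power_divide)
      also have "\<dots> \<le> 2 * D / (x / C) powr (1 / b)"
      proof -
        have "D / 2 ^ N = 2 * D / (2 * 2 ^ N)" by simp
        also have "\<dots> \<le> 2 * D / (x / C) powr (1 / b)"
          using N(2) D x C by (intro divide_left_mono mult_pos_pos) auto
        finally show ?thesis .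
      qed
      also have "\<dots> \<le> A * x powr (- (1 / b))"
        unfolding Ax using x C by (intro divide_right_mono) auto
      finally show ?thesis .
    qed
  qed
  then show ?thesis
    by (intro that[OF A]) (simp only: emeasure_circle_eq_measure ennreal_leI)
qed

end


section \<open>Sums of Cauchy kernels are weak Hardy functions\<close>

lemma nn_integral_log_plus_weak_type:
  fixes U :: "'a \<Rightarrow> real"
  assumes U [measurable]: "U \<in> borel_measurable M" and A: "0 \<le> A" and p: "0 < p"
    and U0: "AE \<zeta> in M. 0 \<le> U \<zeta>"
    and weak: "\<And>x. 0 < x \<Longrightarrow> emeasure M {\<zeta>\<in>space M. x < U \<zeta>} \<le> ennreal (A * x powr (- p))"
  shows "(\<integral>\<^sup>+\<zeta>. ennreal (log_plus (U \<zeta>)) \<partial>M) < \<infinity>"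
proof -
  have "(\<integral>\<^sup>+\<zeta>. ennreal (log_plus (U \<zeta>)) \<partial>M)
      \<le> (\<integral>\<^sup>+\<zeta>. ennreal (2 / p) * (ennreal (U \<zeta> powr (p / 2)) * indicator {\<zeta>. 1 < U \<zeta>} \<zeta>) \<partial>M)"
  proof (rule nn_integral_mono_AE)
    show "AE \<zeta> in M. ennreal (log_plus (U \<zeta>))
        \<le> ennreal (2 / p) * (ennreal (U \<zeta> powr (p / 2)) * indicator {\<zeta>. 1 < U \<zeta>} \<zeta>)"
      using U0
    proof eventually_elim
      case (elim \<zeta>)
      show ?case
      proof (cases "1 < U \<zeta>")
        case True
        then have "ln (U \<zeta>) \<le> U \<zeta> powr (p / 2) / (p / 2)"
          using p by (intro ln_powr_bound) auto
        then have "ennreal (log_plus (U \<zeta>)) \<le> ennreal (2 / p * U \<zeta> powr (p / 2))"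
          using True by (intro ennreal_leI) (simp add: log_plus_def mult.commute)
        also have "\<dots> = ennreal (2 / p) * ennreal (U \<zeta> powr (p / 2))"
          using p by (intro ennreal_mult) auto
        finally show ?thesis
          using True by simp
      next
        case False
        then have "log_plus (U \<zeta>) = 0"
          using elim by (simp add: log_plus_eq)
        then show ?thesis by simp
      qed
    qed
  qed
  also have "\<dots> = ennreal (2 / p) * (\<integral>\<^sup>+\<zeta>. ennreal (U \<zeta> powr (p / 2)) * indicator {\<zeta>. 1 < U \<zeta>} \<zeta> \<partial>M)"
    by (rule nn_integral_cmult) (auto intro!: borel_measurable_times_ennreal borel_measurable_indicator')
  also have "\<dots> \<le> ennreal (2 / p) * ennreal (A * weak_const (p / 2) p * 1 powr (p / 2 - p))"
    by (intro mult_left_mono weak_type_above U weak) (use A p in auto)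
  also have "\<dots> < \<infinity>" by (simp add: ennreal_mult_less_top)
  finally show ?thesis .
qed

context dyadic_atoms
begin

text \<open>Termwise limits, justified by dominated convergence of series in each Stolz region.\<close>

lemma atom_sum_nontangential:
  assumes \<zeta>: "\<zeta> \<in> unit_circle" and summ: "summable (\<lambda>k. majorant k \<zeta>)"
  shows "has_nontangential_limit atom_sum \<zeta> (\<Sum>k. atom k \<zeta>)"
  unfolding has_nontangential_limit_def
proof (intro allI impI)
  fix a :: real assume a: "1 < a"
  let ?F = "at \<zeta> within stolz_region a \<zeta>"
  have in_stolz: "eventually (\<lambda>z. z \<in> stolz_region a \<zeta>) ?F"
    by (simp add: eventually_at_filter)
  show "(atom_sum \<longlongrightarrow> (\<Sum>k. atom k \<zeta>)) ?F"
  proof (cases "?F = bot")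
    case False
    have "((\<lambda>z. \<Sum>k. atom k z) \<longlongrightarrow> (\<Sum>k. atom k \<zeta>)) ?F"
    proof (rule tendsto_suminf_dominated)
      fix k
      have "Re (w k * \<zeta>) \<le> norm (w k * \<zeta>)" by (rule complex_Re_le_cmod)
      then have "0 < Re (1 - w k * \<zeta>)"
        using norm_w_less[of k] \<zeta> by (simp add: norm_mult)
      then have "1 - w k * \<zeta> \<notin> \<real>\<^sub>\<le>\<^sub>0"
        by (auto elim!: nonpos_Reals_cases simp: complex_eq_iff)
      then show "(atom k \<longlongrightarrow> atom k \<zeta>) ?F"
        unfolding atom_def by (intro tendsto_mult tendsto_const tendsto_powr_complex tendsto_intros) auto
    next
      show "eventually (\<lambda>z. \<forall>k. norm (atom k z) \<le> (1 + a) powr (b + 1) * majorant k \<zeta>) ?F"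
        using in_stolz
      proof eventually_elim
        case (elim z)
        show ?case
          by (intro allI order_trans[OF norm_atom_le_majorant] majorant_near_boundary \<zeta>)
             (use elim a in \<open>auto simp: stolz_region_def\<close>)
      qed
      show "summable (\<lambda>k. (1 + a) powr (b + 1) * majorant k \<zeta>)"
        by (intro summable_mult summ)
    qed fact
    moreover have "eventually (\<lambda>z. (\<Sum>k. atom k z) = atom_sum z) ?F"
      using in_stolz
    proof eventually_elim
      case (elim z)
      then have "norm z < 1" by (simp add: stolz_region_def)
      from atom_sums[OF this] show ?case by (simp add: sums_iff)
    qed
    ultimately show ?thesis by (rule Lim_transform_eventually)
  qed simp
qed

lemma norm_atom_sum_le:
  assumes \<zeta>: "\<zeta> \<in> unit_circle" and summ: "summable (\<lambda>k. majorant k \<zeta>)" and r: "0 < r" "r < 1"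
  shows "norm (atom_sum (of_real r * \<zeta>)) \<le> 2 powr (b + 1) * total_majorant \<zeta>"
proof -
  let ?z = "of_real r * \<zeta>"
  have z: "norm ?z < 1" using \<zeta> r by (simp add: norm_mult)
  have "?z - \<zeta> = of_real (r - 1) * \<zeta>" by (simp add: algebra_simps)
  then have "dist ?z \<zeta> = 1 - r"
    using \<zeta> r by (simp add: dist_norm norm_mult del: of_real_diff)
  then have le: "norm (atom k ?z) \<le> 2 powr (b + 1) * majorant k \<zeta>" for k
    using majorant_near_boundary[OF \<zeta> z, of 1 k] \<zeta> r order_trans[OF norm_atom_le_majorant[of k ?z]]
    by (simp add: norm_mult)
  have s: "summable (\<lambda>k. norm (atom k ?z))"
    by (rule summable_comparison_test'[OF summable_mult[OF summ]]) (use le in simp)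
  have "norm (atom_sum ?z) = norm (\<Sum>k. atom k ?z)"
    using atom_sums[OF z] by (simp add: sums_iff)
  also have "\<dots> \<le> (\<Sum>k. norm (atom k ?z))" by (rule summable_norm[OF s])
  also have "\<dots> \<le> (\<Sum>k. 2 powr (b + 1) * majorant k \<zeta>)"
    by (intro suminf_le le s summable_mult summ)
  also have "\<dots> = 2 powr (b + 1) * total_majorant \<zeta>"
    unfolding total_majorant_def by (rule suminf_mult[OF summ])
  finally show ?thesis .
qed

text \<open>The sum of the kernel moduli dominates \<open>f\<close> along almost every radius up to a constant. It has weak type \<open>p = 1/b\<close>, so
  its positive logarithm is integrable; dominated convergence then gives the Smirnov condition, and the
  boundary function inherits the weak type bound.\<close>

theorem atom_sum_weak_hardy: "atom_sum \<in> weak_hardy (1 / b)"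
proof -
  define p where "p = 1 / b"
  have p: "0 < p" using b by (simp add: p_def)
  define U where "U \<zeta> = 2 powr (b + 1) * total_majorant \<zeta>" for \<zeta>
  have U [measurable]: "U \<in> borel_measurable circle_measure"
    unfolding U_def using measurable_total_majorant by measurable
  obtain A0 where A0: "0 < A0" "\<And>x. 0 < x \<Longrightarrow>
    emeasure circle_measure {\<zeta>\<in>space circle_measure. x < total_majorant \<zeta>} \<le> ennreal (A0 * x powr (- p))"
    using total_majorant_weak_type unfolding p_def by blast
  define A where "A = A0 * (2 powr (b + 1)) powr p"
  have A: "0 < A" using A0 by (simp add: A_def)
  have weak: "emeasure circle_measure {\<zeta>\<in>space circle_measure. x < U \<zeta>} \<le> ennreal (A * x powr (- p))"
    if x: "0 < x" for x
  proof -
    have "(x < U \<zeta>) = (x / 2 powr (b + 1) < total_majorant \<zeta>)" for \<zeta>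
      by (simp add: U_def divide_less_eq mult.commute)
    moreover have "A0 * (x / 2 powr (b + 1)) powr (- p) = A * x powr (- p)"
    proof -
      have "(2 powr (b + 1)) powr (- p) = 1 / (2 powr (b + 1)) powr p" by (rule powr_minus_divide)
      then show ?thesis by (simp only: powr_divide A_def) simp
    qed
    ultimately show ?thesis
      using A0(2)[of "x / 2 powr (b + 1)"] x by simp
  qed
  have hol: "atom_sum holomorphic_on unit_disk" by (rule atom_sum_holomorphic)
  have cont: "continuous_on unit_disk atom_sum" by (rule holomorphic_on_imp_continuous_on[OF hol])
  have bf: "boundary_fun atom_sum \<in> borel_measurable circle_measure"
    by (rule measurable_boundary_fun[OF cont])
  define LI where "LI = (\<integral>\<^sup>+\<zeta>. ennreal (log_plus (U \<zeta>)) \<partial>circle_measure)"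
  have LI: "LI < \<infinity>"
  proof -
    have "AE \<zeta> in circle_measure. 0 \<le> U \<zeta>"
      using AE_majorant_summable
      by eventually_elim (auto simp: U_def total_majorant_def intro!: mult_nonneg_nonneg suminf_nonneg majorant_nonneg)
    then show ?thesis
      unfolding LI_def using A by (intro nn_integral_log_plus_weak_type[OF U _ p _ weak]) auto
  qed
  have dominated: "AE \<zeta> in circle_measure. ennreal (log_plus (norm (atom_sum (of_real r * \<zeta>)))) \<le> ennreal (log_plus (U \<zeta>))"
    if r: "0 < r" "r < 1" for r
    using AE_majorant_summable AE_space
  proof eventually_elim
    case (elim \<zeta>)
    then show ?case
      unfolding U_def using r by (intro ennreal_leI log_plus_mono norm_atom_sum_le) auto
  qed
  have nev: "atom_sum \<in> nevanlinna_class"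
  proof -
    have "(SUP r\<in>{0<..<1::real}. log_mean (\<lambda>\<zeta>. atom_sum (of_real r * \<zeta>))) \<le> LI"
      unfolding log_mean_def LI_def by (intro SUP_least nn_integral_mono_AE dominated) auto
    also note LI
    finally show ?thesis using hol by (simp add: nevanlinna_class_def)
  qed
  have conv: "((\<lambda>r::real. log_mean (\<lambda>\<zeta>. atom_sum (of_real r * \<zeta>))) \<longlongrightarrow> log_mean (boundary_fun atom_sum)) (at_left 1)"
  proof (rule tendsto_at_left_sequentially[of 0])
    fix S :: "nat \<Rightarrow> real" assume S: "\<And>n. S n < 1" "\<And>n. 0 < S n" "S \<longlonglongrightarrow> 1"
    show "(\<lambda>n. log_mean (\<lambda>\<zeta>. atom_sum (of_real (S n) * \<zeta>))) \<longlonglongrightarrow> log_mean (boundary_fun atom_sum)"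
      unfolding log_mean_def
    proof (rule nn_integral_dominated_convergence)
      show "(\<lambda>\<zeta>. ennreal (log_plus (norm (atom_sum (of_real (S n) * \<zeta>))))) \<in> borel_measurable circle_measure" for n
        using S less_imp_le
        by (intro measurable_compose[OF _ measurable_ennreal] measurable_log_plus_norm measurable_dilation cont) blast+
      show "(\<lambda>\<zeta>. ennreal (log_plus (norm (boundary_fun atom_sum \<zeta>)))) \<in> borel_measurable circle_measure"
        by (intro measurable_compose[OF _ measurable_ennreal] measurable_log_plus_norm bf)
      show "(\<lambda>\<zeta>. ennreal (log_plus (U \<zeta>))) \<in> borel_measurable circle_measure"
        unfolding log_plus_def by measurable
      show "(\<integral>\<^sup>+\<zeta>. ennreal (log_plus (U \<zeta>)) \<partial>circle_measure) < \<infinity>"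
        using LI by (simp add: LI_def)
      show "AE \<zeta> in circle_measure. ennreal (log_plus (norm (atom_sum (of_real (S n) * \<zeta>)))) \<le> ennreal (log_plus (U \<zeta>))" for n
        by (rule dominated[OF S(2,1)])
      have lim: "filterlim S (at_left 1) sequentially"
        unfolding filterlim_at
      proof
        show "eventually (\<lambda>n. S n \<in> {..<1} \<and> S n \<noteq> 1) sequentially"
          using S(1) by (intro always_eventually allI) (auto simp: less_le)
      qed (rule S(3))
      show "AE \<zeta> in circle_measure. (\<lambda>n. ennreal (log_plus (norm (atom_sum (of_real (S n) * \<zeta>)))))
          \<longlonglongrightarrow> ennreal (log_plus (norm (boundary_fun atom_sum \<zeta>)))"
        using AE_majorant_summable AE_space
      proof eventually_elim
        case (elim \<zeta>)
        then have \<zeta>: "\<zeta> \<in> unit_circle" by simp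
        note nt = atom_sum_nontangential[OF \<zeta> elim(1)]
        have "((\<lambda>r. atom_sum (of_real r * \<zeta>)) \<longlongrightarrow> boundary_fun atom_sum \<zeta>) (at_left 1)"
          using has_nontangential_limit_radial[OF nt \<zeta>] boundary_fun_eqI[OF nt \<zeta>] by simp
        from filterlim_compose[OF this lim] show ?case
          by (intro tendsto_ennrealI tendsto_log_plus_norm)
      qed
    qed
  qed simp
  have bfU: "AE \<zeta> in circle_measure. norm (boundary_fun atom_sum \<zeta>) \<le> U \<zeta>"
    using AE_majorant_summable AE_space
  proof eventually_elim
    case (elim \<zeta>)
    then have \<zeta>: "\<zeta> \<in> unit_circle" by simp
    have "(\<lambda>n. norm (atom_sum (of_real (radius_seq n) * \<zeta>))) \<longlonglongrightarrow> norm (boundary_fun atom_sum \<zeta>)"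
      by (intro tendsto_norm radius_seq_boundary_fun[OF atom_sum_nontangential[OF \<zeta> elim(1)] \<zeta>])
    then show ?case
      by (rule LIMSEQ_le_const2)
         (auto simp: U_def intro!: norm_atom_sum_le[OF \<zeta> elim(1)] radius_seq)
  qed
  have dist: "distribution_fun (boundary_fun atom_sum) x \<le> A * x powr (- p)" if x: "0 < x" for x
  proof -
    have "emeasure circle_measure {\<zeta>\<in>space circle_measure. x < norm (boundary_fun atom_sum \<zeta>)}
        \<le> emeasure circle_measure {\<zeta>\<in>space circle_measure. x < U \<zeta>}"
    proof (rule emeasure_mono_AE)
      show "AE \<zeta> in circle_measure. \<zeta> \<in> {\<zeta>\<in>space circle_measure. x < norm (boundary_fun atom_sum \<zeta>)}
          \<longrightarrow> \<zeta> \<in> {\<zeta>\<in>space circle_measure. x < U \<zeta>}"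
        using bfU by eventually_elim auto
    qed measurable
    also note weak[OF x]
    finally show ?thesis
      using A by (simp add: emeasure_circle_eq_measure distribution_fun_def)
  qed
  have "(SUP s\<in>{0<..}. decreasing_rearrangement (boundary_fun atom_sum) s * ennreal (s powr (1 / p)))
      \<le> ennreal (A powr (1 / p))"
  proof (rule SUP_least)
    fix s :: real assume "s \<in> {0<..}"
    then have s: "0 < s" by simp
    define t where "t = (A / s) powr (1 / p)"
    have t: "0 < t" using A s by (simp add: t_def)
    have "t powr p = A / s" using A s p by (simp add: t_def powr_powr)
    then have "A * t powr (- p) = s"
      using A s by (simp add: powr_minus_divide)
    then have "distribution_fun (boundary_fun atom_sum) t \<le> s" using dist[OF t] by simp
    then have "decreasing_rearrangement (boundary_fun atom_sum) s \<le> ennreal t"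
      unfolding decreasing_rearrangement_def using t by (intro INF_lower) auto
    then have "decreasing_rearrangement (boundary_fun atom_sum) s * ennreal (s powr (1 / p))
        \<le> ennreal t * ennreal (s powr (1 / p))"
      by (intro mult_right_mono) auto
    also have "\<dots> = ennreal (t * s powr (1 / p))"
      using t by (simp add: ennreal_mult)
    also have "t * s powr (1 / p) = A powr (1 / p)"
      using A s by (simp add: t_def powr_divide)
    finally show "decreasing_rearrangement (boundary_fun atom_sum) s * ennreal (s powr (1 / p)) \<le> ennreal (A powr (1 / p))" .
  qed
  also have "\<dots> < \<infinity>" by simp
  finally show ?thesis
    using nev conv by (simp add: weak_hardy_def smirnov_class_def p_def)
qed

end


section \<open>The Abel dual of the weak Hardy space\<close>

lemma abel_summable_disk_seqs: "abel_summable a \<Longrightarrow> a \<in> disk_seqs"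
  by (rule disk_seqsI) (simp add: abel_summable_def)

lemma abel_summable_bounded:
  assumes "abel_summable a"
  obtains K where "\<And>m. norm (powser a (of_real (radius_seq m))) \<le> K"
proof -
  obtain L where "((\<lambda>r::real. \<Sum>n. a n * of_real r ^ n) \<longlongrightarrow> L) (at_left 1)"
    using assms by (auto simp: abel_summable_def)
  from filterlim_compose[OF this filterlim_radius_seq]
  have "(\<lambda>m. powser a (of_real (radius_seq m))) \<longlonglongrightarrow> L"
    by (simp add: powser_def)
  then have "Bseq (\<lambda>m. powser a (of_real (radius_seq m)))"
    by (intro convergent_imp_Bseq convergentI)
  then show ?thesis
    using that by (auto simp: Bseq_def)
qed

text \<open>Multipliers in a dual are only known through products with test sequences. If for every \<open>t < 1\<close> some test sequence
  decays no faster than \<open>t\<^sup>n\<close>, the multiplier itself is the coefficient sequence of a function on the disk.\<close>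

lemma disk_seqs_cancel:
  assumes "\<And>t. 0 < t \<Longrightarrow> t < 1 \<Longrightarrow>
    \<exists>m c. 0 < c \<and> (\<lambda>n. l n * m n) \<in> disk_seqs \<and> (\<forall>n. c * t ^ n \<le> norm (m n))"
  shows "l \<in> disk_seqs"
  unfolding disk_seqs_def
proof safe
  fix r :: real assume r: "0 < r" "r < 1"
  have t: "0 < sqrt r" "sqrt r < 1" using r by auto
  obtain m c where m: "0 < c" "(\<lambda>n. l n * m n) \<in> disk_seqs" "\<And>n. c * sqrt r ^ n \<le> norm (m n)"
    using assms[OF t] by blast
  show "summable (\<lambda>n. norm (l n) * r ^ n)"
  proof (rule summable_comparison_test')
    show "summable (\<lambda>n. norm (l n * m n) * sqrt r ^ n / c)"
      by (intro summable_divide disk_seqsD_real m) (use t in auto)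
    show "norm (norm (l n) * r ^ n) \<le> norm (l n * m n) * sqrt r ^ n / c" for n
    proof -
      have "r ^ n = sqrt r ^ n * sqrt r ^ n"
        using r by (simp flip: power_mult_distrib)
      then have "norm (norm (l n) * r ^ n) = norm (l n) * (c * sqrt r ^ n) * sqrt r ^ n / c"
        using m(1) r by (simp add: abs_mult)
      also have "\<dots> \<le> norm (l n) * norm (m n) * sqrt r ^ n / c"
        using m t by (intro divide_right_mono mult_right_mono mult_left_mono) auto
      finally show ?thesis by (simp add: norm_mult)
    qed
  qed
qed

lemma norm_powser_le:
  assumes d: "d \<in> disk_seqs" and z: "norm z \<le> r" "r < 1"
  shows "norm (powser d z) \<le> (\<Sum>n. norm (d n) * r ^ n)"
proof -
  have z1: "norm z < 1" and r: "0 \<le> r" using z norm_ge_zero[of z] by linarith+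
  have "norm (powser d z) \<le> (\<Sum>n. norm (d n * z ^ n))"
    unfolding powser_def by (rule summable_norm[OF disk_seqsD[OF d z1]])
  also have "\<dots> \<le> (\<Sum>n. norm (d n) * r ^ n)"
    by (intro suminf_le disk_seqsD[OF d z1] disk_seqsD_real[OF d r z(2)])
       (use z in \<open>auto simp: norm_mult norm_power intro!: mult_left_mono power_mono\<close>)
  finally show ?thesis .
qed

text \<open>The Beta integrals \<open>\<Gamma>(b)/B\<^sub>n\<close> decrease in \<open>n\<close>.\<close>

lemma deriv_weight_ge:
  assumes b: "1 < b"
  shows "deriv_weight b 0 \<le> deriv_weight b n"
proof -
  have b0: "0 < b" using b by simp
  let ?M = "restrict_space lborel {0<..<1::real}"
  have "(\<integral>u. (1 - u) powr (b - 1) * u ^ n \<partial>?M) \<le> (\<integral>u. (1 - u) powr (b - 1) * u ^ 0 \<partial>?M)"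
    by (intro integral_mono integral_beta_power b0 mult_left_mono)
       (auto simp: space_restrict_space power_le_one)
  then have "Gamma b / deriv_weight b n \<le> Gamma b / deriv_weight b 0"
    unfolding integral_beta_power[OF b0] .
  then show ?thesis
    using deriv_weight_pos[OF b0, of n] deriv_weight_pos[OF b0, of 0] Gamma_real_pos[OF b0]
    by (simp add: divide_simps split: if_splits)
qed

lemma integral_mean_inf_attained:
  assumes F: "F holomorphic_on unit_disk" and t: "0 < t" "t < 1"
  obtains \<zeta> where "norm \<zeta> = 1" "integral_mean \<infinity> t F = norm (F (of_real t * \<zeta>))"
proof -
  have "continuous_on unit_circle (\<lambda>\<zeta>. norm (F (of_real t * \<zeta>)))"
    using t by (intro continuous_on_norm continuous_on_compose2[OF holomorphic_on_imp_continuous_on[OF F]]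
        continuous_intros) (auto simp: norm_mult)
  then obtain \<zeta> where \<zeta>: "\<zeta> \<in> unit_circle"
      "\<And>\<xi>. \<xi> \<in> unit_circle \<Longrightarrow> norm (F (of_real t * \<xi>)) \<le> norm (F (of_real t * \<zeta>))"
    using continuous_attains_sup[of unit_circle "\<lambda>\<zeta>. norm (F (of_real t * \<zeta>))"] by auto
  have "(SUP \<xi>\<in>unit_circle. norm (F (of_real t * \<xi>))) = norm (F (of_real t * \<zeta>))"
    using \<zeta> by (intro cSup_eq_maximum) auto
  then show ?thesis
    using \<zeta> by (intro that[of \<zeta>]) (auto simp: integral_mean_def)
qed

lemma integral_mean_inf_le:
  assumes "\<And>\<zeta>. norm \<zeta> = 1 \<Longrightarrow> norm (F (of_real t * \<zeta>)) \<le> K"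
  shows "integral_mean \<infinity> t F \<le> K"
proof -
  have "(SUP \<zeta>\<in>unit_circle. norm (F (of_real t * \<zeta>))) \<le> K"
    using assms by (intro cSUP_least) (auto intro: exI[of _ 1])
  then show ?thesis by (simp add: integral_mean_def)
qed

text \<open>The intervals \<open>[1 - 2\<^sup>-\<^sup>k, 1 - 2\<^sup>-\<^sup>k\<^sup>-\<^sup>1]\<close> cover the unit interval, and an increasing function is largest at the
  right end.\<close>

lemma nn_integral_le_dyadic_sum:
  fixes G :: "real \<Rightarrow> real"
  assumes mono: "mono_on {0<..<1} G" and G0: "\<And>t. 0 < t \<Longrightarrow> t < 1 \<Longrightarrow> 0 \<le> G t"
    and K: "\<And>n. (\<Sum>k<n. dyadic k * G (1 - dyadic k)) \<le> K"
  shows "(\<integral>\<^sup>+u\<in>{0<..<1}. ennreal (G u) \<partial>lborel) \<le> ennreal K"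
proof -
  note x = dyadic_pos dyadic_less_1
  have "(\<integral>\<^sup>+u\<in>{0<..<1}. ennreal (G u) \<partial>lborel)
      \<le> (\<integral>\<^sup>+u. (\<Sum>k. ennreal (G (1 - dyadic k)) * indicator {1 - 2 * dyadic k .. 1 - dyadic k} u) \<partial>lborel)"
  proof (rule nn_integral_mono)
    fix u :: real
    let ?h = "\<lambda>k. ennreal (G (1 - dyadic k)) * indicator {1 - 2 * dyadic k .. 1 - dyadic k} u"
    show "ennreal (G u) * indicator {0<..<1} u \<le> suminf ?h"
    proof (cases "u \<in> {0<..<1}")
      case True
      then have "1 \<le> 1 / (1 - u)" by simp
      then obtain k :: nat where k: "2 ^ k \<le> 1 / (1 - u)" "1 / (1 - u) < 2 * 2 ^ k"
        by (rule dyadic_floor)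
      have u: "1 - 2 * dyadic k \<le> u" "u \<le> 1 - dyadic k"
      proof -
        have "2 ^ k * (1 - u) \<le> 1" "1 < 2 * 2 ^ k * (1 - u)"
          using k True by (simp_all add: le_divide_eq divide_less_eq)
        then show "1 - 2 * dyadic k \<le> u" "u \<le> 1 - dyadic k"
          by (simp_all add: dyadic_def power_divide field_simps)
      qed
      have "ennreal (G u) \<le> ennreal (G (1 - dyadic k))"
        using u True x[of k] by (intro ennreal_leI mono_onD[OF mono]) auto
      also have "\<dots> = sum ?h {k}" using u by simp
      also have "\<dots> \<le> suminf ?h" by (rule sum_le_suminf) auto
      finally show ?thesis using True by simp
    qed auto
  qed
  also have "\<dots> = (\<Sum>k. ennreal (G (1 - dyadic k)) * ennreal (dyadic k))"
    by (subst nn_integral_suminf) (auto simp: nn_integral_cmult_indicator x less_imp_le intro!: suminf_cong)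
  also have "\<dots> = (\<Sum>k. ennreal (dyadic k * G (1 - dyadic k)))"
    using x G0 by (intro suminf_cong) (simp add: ennreal_mult[symmetric] less_imp_le mult.commute)
  also have "\<dots> = (SUP n. \<Sum>k<n. ennreal (dyadic k * G (1 - dyadic k)))"
    by (rule suminf_eq_SUP)
  also have "\<dots> \<le> ennreal K"
  proof (rule SUP_least)
    fix n
    have "(\<Sum>k<n. ennreal (dyadic k * G (1 - dyadic k))) = ennreal (\<Sum>k<n. dyadic k * G (1 - dyadic k))"
      using x G0 by (intro sum_ennreal) (simp add: less_imp_le)
    also have "\<dots> \<le> ennreal K"
      using K[of n] by (intro ennreal_leI) simp
    finally show "(\<Sum>k<n. ennreal (dyadic k * G (1 - dyadic k))) \<le> ennreal K" .
  qed
  finally show ?thesis .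
qed

lemma coeff_space_mixed_norm_derivI:
  assumes "l \<in> disk_seqs"
    and "powser (\<lambda>n. of_real (deriv_weight b n) * l n) \<in> mixed_norm_space \<infinity> 1 1"
  shows "l \<in> coeff_space (mixed_norm_deriv_space \<infinity> 1 1 b)"
  unfolding coeff_space_def
proof (rule image_eqI)
  show "l = taylor_coeff (powser l)"
    by (simp add: taylor_coeff_powser assms)
  show "powser l \<in> mixed_norm_deriv_space \<infinity> 1 1 b"
    using assms by (simp add: mixed_norm_deriv_space_def frac_deriv_eq_powser taylor_coeff_powser powser_holomorphic)
qed

text \<open>With \<open>w\<^sub>k = 1 - 2\<^sup>-\<^sup>k\<^sup>-\<^sup>1\<close> and \<open>c\<^sub>k = 1\<close> the coefficients of the test function are positive, and each of its summands
  bounds them from below; the summand with \<open>w\<^sub>k > t\<close> decays no faster than \<open>t\<^sup>n\<close>.\<close>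

lemma abel_dual_weak_hardy_disk_seqs:
  assumes b: "1 < b" and l: "l \<in> abel_dual (coeff_space (weak_hardy (1 / b)))"
  shows "l \<in> disk_seqs"
proof (rule disk_seqs_cancel)
  fix t :: real assume t: "0 < t" "t < 1"
  note x = dyadic_pos dyadic_less_1
  interpret dyadic_atoms b "\<lambda>k. of_real (1 - dyadic k)" "\<lambda>_. 1"
  proof
    show "norm (complex_of_real (1 - dyadic k)) = 1 - dyadic k" for k
      unfolding norm_of_real using x[of k] by simp
  qed (use b in auto)
  let ?\<alpha> = "taylor_coeff atom_sum"
  have "abel_summable (\<lambda>n. l n * ?\<alpha> n)"
    using l atom_sum_weak_hardy by (auto simp: abel_dual_def coeff_space_def)
  then have "(\<lambda>n. l n * ?\<alpha> n) \<in> disk_seqs"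
    by (rule abel_summable_disk_seqs)
  moreover obtain k where k: "dyadic k < 1 - t"
  proof -
    have "dyadic \<longlonglongrightarrow> 0"
      unfolding dyadic_def by (intro LIMSEQ_Suc LIMSEQ_power_zero) simp
    then have "eventually (\<lambda>k. dyadic k < 1 - t) sequentially"
      using t by (intro order_tendstoD) auto
    then show ?thesis using that by (auto simp: eventually_sequentially)
  qed
  moreover have "dyadic k * t ^ n \<le> norm (?\<alpha> n)" for n
  proof -
    have summ: "summable (\<lambda>k. dyadic k * (1 - dyadic k) ^ n)"
    proof (rule summable_comparison_test')
      show "summable dyadic" by (rule summable_dyadic)
      show "norm (dyadic k * (1 - dyadic k) ^ n) \<le> dyadic k" for k
        using x[of k] mult_left_le[of "(1 - dyadic k) ^ n" "dyadic k"] by (simp add: abs_mult power_le_one)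
    qed
    have coef: "coef k = of_real (dyadic k)" for k by (simp add: coef_def)
    have "moment n = (\<Sum>k. of_real (dyadic k * (1 - dyadic k) ^ n))"
      unfolding moment_def coef by simp
    also have "\<dots> = of_real (\<Sum>k. dyadic k * (1 - dyadic k) ^ n)"
      by (rule suminf_of_real[OF summ, symmetric])
    finally have m: "moment n = of_real (\<Sum>k. dyadic k * (1 - dyadic k) ^ n)" .
    have "dyadic k * t ^ n \<le> dyadic k * (1 - dyadic k) ^ n"
      using x[of k] k t by (intro mult_left_mono power_mono) auto
    also have "\<dots> = (\<Sum>k\<in>{k}. dyadic k * (1 - dyadic k) ^ n)" by simp
    also have "\<dots> \<le> (\<Sum>k. dyadic k * (1 - dyadic k) ^ n)"
      using x by (intro sum_le_suminf summ) (auto simp: less_imp_le)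
    also have "\<dots> \<le> norm (moment n)" unfolding m by simp
    also have "\<dots> \<le> deriv_weight b n / Gamma (b + 1) * norm (moment n)"
    proof -
      have G: "0 < Gamma (b + 1)" using b by (intro Gamma_real_pos) auto
      have "Gamma (b + 1) \<le> deriv_weight b n"
        using deriv_weight_ge[OF b, of n] by (simp add: deriv_weight_def)
      then have "1 \<le> deriv_weight b n / Gamma (b + 1)" using G by (simp add: le_divide_eq)
      from mult_right_mono[OF this norm_ge_zero[of "moment n"]] show ?thesis
        by (simp only: mult_1_left)
    qed
    also have "\<dots> = norm (?\<alpha> n)"
    proof -
      have "0 < deriv_weight b n / Gamma (b + 1)"
        using b by (intro divide_pos_pos deriv_weight_pos Gamma_real_pos) auto
      then show ?thesis
        unfolding taylor_coeff_atom_sum norm_mult norm_of_real by (simp only: abs_of_pos)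
    qed
    finally show ?thesis .
  qed
  ultimately show "\<exists>m c. 0 < c \<and> (\<lambda>n. l n * m n) \<in> disk_seqs \<and> (\<forall>n. c * t ^ n \<le> norm (m n))"
    using x[of k] by blast
qed

text \<open>The Abel means at radius \<open>\<rho>\<close> of the pairing with a sum of kernels are \<open>\<Gamma>(b+1)\<^sup>-\<^sup>1 \<Sum> 2\<^sup>-\<^sup>k\<^sup>-\<^sup>1 c\<^sub>k F(\<rho> w\<^sub>k)\<close>.
  They converge for every bounded \<open>c\<close>, so the uniform boundedness principle bounds the sums of the moduli,
  uniformly in \<open>\<rho>\<close>.\<close>

lemma abel_dual_weak_hardy_dyadic_bound:
  assumes b: "1 < b" and l: "l \<in> abel_dual (coeff_space (weak_hardy (1 / b)))"
    and w: "\<And>k. norm (w k) = 1 - dyadic k"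
  obtains K where "\<And>n. (\<Sum>k<n. dyadic k * norm (powser (\<lambda>n. of_real (deriv_weight b n) * l n) (w k))) \<le> K"
proof -
  define d where "d n = of_real (deriv_weight b n) * l n" for n
  note x0 = dyadic_pos
  note xs = summable_dyadic
  have b0: "0 < b" using b by simp
  have ld: "l \<in> disk_seqs" by (rule abel_dual_weak_hardy_disk_seqs[OF b l])
  have d: "d \<in> disk_seqs"
    unfolding d_def by (intro disk_seqs_mult deriv_weight_disk_seqs b0 ld)
  define a where "a m k = of_real (dyadic k) * powser d (w k * of_real (radius_seq m))" for m k
  have w1: "norm (w k) < 1" for k by (simp add: w dyadic_pos)
  have wr: "norm (w k * of_real (radius_seq m)) \<le> radius_seq m" for k m
    using w1[of k] radius_seq[of m] mult_right_mono[of "norm (w k)" 1 "radius_seq m"]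
    by (simp add: norm_mult)
  have summ: "summable (\<lambda>k. norm (a m k))" for m
  proof (rule summable_comparison_test')
    show "summable (\<lambda>k. dyadic k * (\<Sum>n. norm (d n) * radius_seq m ^ n))"
      by (intro summable_mult2 xs)
    show "norm (norm (a m k)) \<le> dyadic k * (\<Sum>n. norm (d n) * radius_seq m ^ n)" for k
      using mult_left_mono[OF norm_powser_le[OF d wr radius_seq(2)], of "dyadic k" k m] x0[of k]
      by (simp add: a_def norm_mult)
  qed
  have "\<exists>K. \<forall>m. norm (\<Sum>k. a m k * c k) \<le> K" if c: "\<And>k. norm (c k) \<le> 1" for c
  proof -
    interpret dyadic_atoms b w c
      by unfold_locales (use b w c in auto)
    have G: "Gamma (b + 1) \<noteq> 0"
      using b by (intro Gamma_plus1_neq_0) simp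
    have "abel_summable (\<lambda>n. l n * taylor_coeff atom_sum n)"
      using l atom_sum_weak_hardy by (auto simp: abel_dual_def coeff_space_def)
    then obtain K where K: "\<And>m. norm (powser (\<lambda>n. l n * taylor_coeff atom_sum n) (of_real (radius_seq m))) \<le> K"
      using abel_summable_bounded by blast
    have "norm (\<Sum>k. a m k * c k) \<le> \<bar>Gamma (b + 1)\<bar> * K" for m
    proof -
      have r: "norm (complex_of_real (radius_seq m)) < 1"
        using radius_seq[of m] by simp
      have "(\<Sum>k. a m k * c k) = (\<Sum>k. coef k * powser d (w k * of_real (radius_seq m)))"
        by (simp add: a_def coef_def mult_ac)
      also have "\<dots> = powser (\<lambda>n. d n * moment n) (of_real (radius_seq m))"
        using powser_moment_sums[OF d r] by (simp add: sums_iff)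
      also have "(\<lambda>n. d n * moment n) = (\<lambda>n. of_real (Gamma (b + 1)) * (l n * taylor_coeff atom_sum n))"
        using G by (simp add: taylor_coeff_atom_sum d_def fun_eq_iff)
      also have "powser \<dots> (of_real (radius_seq m))
          = of_real (Gamma (b + 1)) * powser (\<lambda>n. l n * taylor_coeff atom_sum n) (of_real (radius_seq m))"
        using sums_mult[OF powser_sums[OF disk_seqs_mult[OF ld taylor_coeff_disk_seqs[OF atom_sum_holomorphic]] r],
            of "of_real (Gamma (b + 1))"]
        by (simp add: powser_def sums_iff mult.assoc)
      finally show ?thesis
        using K[of m] by (simp add: norm_mult mult_left_mono)
    qed
    then show ?thesis by blast
  qed
  from uniform_boundedness_rows[OF summ this] obtain K where K: "\<And>m. (\<Sum>k. norm (a m k)) \<le> K" by blast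
  have "(\<Sum>k<n. dyadic k * norm (powser d (w k))) \<le> K" for n
  proof (rule LIMSEQ_le_const2)
    have "(\<lambda>m. powser d (w k * of_real (radius_seq m))) \<longlonglongrightarrow> powser d (w k)" for k
    proof (rule isCont_tendsto_compose[of _ "powser d"])
      show "isCont (powser d) (w k)"
        by (rule isCont_powser[OF d w1])
      have "(\<lambda>m. w k * of_real (radius_seq m)) \<longlonglongrightarrow> w k * of_real 1"
        by (intro tendsto_intros radius_seq_tendsto)
      then show "(\<lambda>m. w k * of_real (radius_seq m)) \<longlonglongrightarrow> w k" by simp
    qed
    then show "(\<lambda>m. \<Sum>k<n. dyadic k * norm (powser d (w k * of_real (radius_seq m))))
        \<longlonglongrightarrow> (\<Sum>k<n. dyadic k * norm (powser d (w k)))"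
      by (intro tendsto_intros)
    have "(\<Sum>k<n. dyadic k * norm (powser d (w k * of_real (radius_seq m)))) \<le> K" for m
    proof -
      have "(\<Sum>k<n. dyadic k * norm (powser d (w k * of_real (radius_seq m)))) = (\<Sum>k<n. norm (a m k))"
        using x0 by (simp add: a_def norm_mult less_imp_le)
      also have "\<dots> \<le> (\<Sum>k. norm (a m k))"
        by (intro sum_le_suminf summ) auto
      also note K
      finally show ?thesis .
    qed
    then show "\<exists>N. \<forall>m\<ge>N. (\<Sum>k<n. dyadic k * norm (powser d (w k * of_real (radius_seq m)))) \<le> K" by blast
  qed
  then show ?thesis
    using that unfolding d_def by blast
qed

text \<open>The points \<open>w\<^sub>k\<close> are placed where \<open>|F|\<close> attains its maximum on the circle of radius \<open>1 - 2\<^sup>-\<^sup>k\<^sup>-\<^sup>1\<close>.\<close>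

lemma abel_dual_weak_hardy_subset:
  assumes b: "1 < b" and l: "l \<in> abel_dual (coeff_space (weak_hardy (1 / b)))"
  shows "l \<in> coeff_space (mixed_norm_deriv_space \<infinity> 1 1 b)"
proof (rule coeff_space_mixed_norm_derivI)
  show ld: "l \<in> disk_seqs" by (rule abel_dual_weak_hardy_disk_seqs[OF b l])
  define F where "F = powser (\<lambda>n. of_real (deriv_weight b n) * l n)"
  have F: "F holomorphic_on unit_disk"
    unfolding F_def using b by (intro powser_holomorphic disk_seqs_mult deriv_weight_disk_seqs ld) simp
  note x = dyadic_pos dyadic_less_1
  have "\<exists>\<zeta>. norm \<zeta> = 1 \<and> integral_mean \<infinity> (1 - dyadic k) F = norm (F (of_real (1 - dyadic k) * \<zeta>))" for k
    using integral_mean_inf_attained[OF F, of "1 - dyadic k"] x[of k] by auto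
  then obtain \<zeta> where \<zeta>: "\<And>k. norm (\<zeta> k) = 1"
      "\<And>k. integral_mean \<infinity> (1 - dyadic k) F = norm (F (of_real (1 - dyadic k) * \<zeta> k))" by metis
  have w: "norm (of_real (1 - dyadic k) * \<zeta> k) = 1 - dyadic k" for k
    using x[of k] unfolding norm_mult norm_of_real \<zeta>(1) by simp
  obtain K where "\<And>n. (\<Sum>k<n. dyadic k * norm (F (of_real (1 - dyadic k) * \<zeta> k))) \<le> K"
    unfolding F_def using abel_dual_weak_hardy_dyadic_bound[OF b l w] by blast
  then have "(\<integral>\<^sup>+u\<in>{0<..<1}. ennreal (integral_mean \<infinity> u F) \<partial>lborel) \<le> ennreal K"
    unfolding \<zeta>(2)[symmetric]
    by (intro nn_integral_le_dyadic_sum integral_mean_inf_mono integral_mean_inf_nonneg F)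
  also have "\<dots> < \<infinity>" by simp
  finally show "powser (\<lambda>n. of_real (deriv_weight b n) * l n) \<in> mixed_norm_space \<infinity> 1 1"
    using mixed_norm_inf_1_iff[OF F] by (simp add: F_def)
qed


section \<open>The second Abel dual\<close>

text \<open>The fractional derivative is analytic in the disk of radius \<open>1/t\<close>, hence bounded on the unit disk.\<close>

lemma geometric_in_coeff_space:
  assumes b: "1 < b" and t: "0 < t" "t < 1"
  shows "(\<lambda>n. of_real (t ^ n)) \<in> coeff_space (mixed_norm_deriv_space \<infinity> 1 1 b)"
proof (rule coeff_space_mixed_norm_derivI)
  have b0: "0 < b" using b by simp
  let ?l = "\<lambda>n. complex_of_real (t ^ n)"
  let ?d = "\<lambda>n. complex_of_real (deriv_weight b n) * ?l n"
  show l: "?l \<in> disk_seqs"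
    by (rule bounded_disk_seqs[where K = 1]) (use t in \<open>simp add: norm_power power_le_one\<close>)
  have d: "?d \<in> disk_seqs"
    by (intro disk_seqs_mult deriv_weight_disk_seqs b0 l)
  have hol: "powser ?d holomorphic_on unit_disk" by (rule powser_holomorphic[OF d])
  define K where "K = (\<Sum>n. norm (complex_of_real (deriv_weight b n)) * t ^ n)"
  have le: "integral_mean \<infinity> u (powser ?d) \<le> K" if u: "0 < u" "u < 1" for u
  proof (rule integral_mean_inf_le)
    fix \<zeta> :: complex assume \<zeta>: "norm \<zeta> = 1"
    have eq: "powser ?d (of_real u * \<zeta>) = powser (\<lambda>n. of_real (deriv_weight b n)) (of_real t * (of_real u * \<zeta>))"
      by (simp add: powser_def power_mult_distrib mult_ac)
    have n: "norm (of_real t * (of_real u * \<zeta>)) \<le> t"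
      using u t \<zeta> mult_left_le[of u t] by (simp add: norm_mult)
    show "norm (powser ?d (of_real u * \<zeta>)) \<le> K"
      unfolding eq K_def by (rule norm_powser_le[OF deriv_weight_disk_seqs[OF b0] n t(2)])
  qed
  have "(\<integral>\<^sup>+u\<in>{0<..<1}. ennreal (integral_mean \<infinity> u (powser ?d)) \<partial>lborel)
      \<le> (\<integral>\<^sup>+u. ennreal K * indicator {0<..<1::real} u \<partial>lborel)"
  proof (rule nn_integral_mono)
    fix u :: real
    show "ennreal (integral_mean \<infinity> u (powser ?d)) * indicator {0<..<1} u \<le> ennreal K * indicator {0<..<1} u"
    proof (cases "u \<in> {0<..<1}")
      case True
      then have "0 < u" "u < 1" by auto
      from ennreal_leI[OF le[OF this]] show ?thesis by (rule mult_right_mono) simp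
    qed (auto simp: indicator_def)
  qed
  also have "\<dots> = ennreal K" by (simp add: nn_integral_cmult_indicator)
  also have "\<dots> < \<infinity>" by simp
  finally show "powser ?d \<in> mixed_norm_space \<infinity> 1 1"
    using mixed_norm_inf_1_iff[OF hol] by simp
qed

lemma abel_dual_mixed_norm_deriv_disk_seqs:
  assumes b: "1 < b" and \<mu>: "\<mu> \<in> abel_dual (coeff_space (mixed_norm_deriv_space \<infinity> 1 1 b))"
  shows "\<mu> \<in> disk_seqs"
proof (rule disk_seqs_cancel)
  fix t :: real assume t: "0 < t" "t < 1"
  have "(\<lambda>n. \<mu> n * of_real (t ^ n)) \<in> disk_seqs"
    using \<mu> geometric_in_coeff_space[OF b t] by (auto simp: abel_dual_def intro: abel_summable_disk_seqs)
  then show "\<exists>m c. 0 < c \<and> (\<lambda>n. \<mu> n * m n) \<in> disk_seqs \<and> (\<forall>n. c * t ^ n \<le> norm (m n))"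
    using t by (intro exI[of _ "\<lambda>n. of_real (t ^ n)"] exI[of _ 1]) (simp add: norm_power)
qed

text \<open>The function is a constant times the integral of \<open>\<phi>(\<zeta>) (1 - r z \<zeta>) powr (-(b+1))\<close> over the circle, to which the
  estimate for Cauchy kernels applies.\<close>

lemma norm_cauchy_transform_le:
  fixes \<phi> :: "complex \<Rightarrow> complex"
  assumes b: "1 < b" and \<phi>: "\<phi> \<in> borel_measurable circle_measure"
    and \<phi>1: "\<And>\<zeta>. \<zeta> \<in> unit_circle \<Longrightarrow> norm (\<phi> \<zeta>) \<le> 1"
    and r: "0 \<le> r" "r < 1" and z: "norm z < 1"
  shows "norm (powser (\<lambda>n. of_real (deriv_weight b n) * (of_real (r ^ n) * (\<integral>\<zeta>. \<zeta> ^ n * \<phi> \<zeta> \<partial>circle_measure))) z)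
    \<le> Gamma (b + 1) * (4 * weak_const (b + 1) 1) * (1 - r * norm z) powr (- b)"
proof -
  note [measurable] = \<phi> measurable_circle_ident
  have b0: "0 < b" using b by simp
  have G: "0 < Gamma (b + 1)" using b by (intro Gamma_real_pos) auto
  define w where "w = of_real r * z"
  have nw: "norm w = r * norm z" using r by (simp add: w_def norm_mult)
  have w: "norm w < 1"
    unfolding nw using r z mult_left_le[of "norm z" r] by simp
  define B where "B n = complex_of_real (deriv_weight b n)" for n
  have B: "B \<in> disk_seqs" unfolding B_def by (rule deriv_weight_disk_seqs[OF b0])
  define h where "h \<zeta> = (\<Sum>n. B n * w ^ n * \<zeta> ^ n) * \<phi> \<zeta>" for \<zeta>
  have h: "h \<zeta> = of_real (Gamma (b + 1)) * (1 - w * \<zeta>) powr (- of_real (b + 1)) * \<phi> \<zeta>"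
    if "\<zeta> \<in> unit_circle" for \<zeta>
  proof -
    have "norm (w * \<zeta>) < 1" using w that by (simp add: norm_mult)
    from cauchy_power_sums[OF b0 this] show ?thesis
      by (simp add: h_def B_def sums_iff power_mult_distrib mult.assoc)
  qed
  have "(\<lambda>n. (B n * w ^ n) * (\<integral>\<zeta>. \<zeta> ^ n * \<phi> \<zeta> \<partial>circle_measure)) sums (\<integral>\<zeta>. h \<zeta> \<partial>circle_measure)"
    unfolding h_def by (rule integral_circle_power_series[OF disk_seqsD[OF B w] \<phi> \<phi>1])
  then have eq: "powser (\<lambda>n. of_real (deriv_weight b n) * (of_real (r ^ n) * (\<integral>\<zeta>. \<zeta> ^ n * \<phi> \<zeta> \<partial>circle_measure))) z
      = (\<integral>\<zeta>. h \<zeta> \<partial>circle_measure)"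
    by (simp add: powser_def sums_iff B_def w_def power_mult_distrib mult_ac)
  have "ennreal (norm (\<integral>\<zeta>. h \<zeta> \<partial>circle_measure)) \<le> (\<integral>\<^sup>+\<zeta>. ennreal (norm (h \<zeta>)) \<partial>circle_measure)"
    by (cases "integrable circle_measure h") (auto simp: integral_norm_bound_ennreal not_integrable_integral_eq)
  also have "\<dots> \<le> (\<integral>\<^sup>+\<zeta>. ennreal (Gamma (b + 1)) * ennreal (norm (1 - w * \<zeta>) powr (- (b + 1))) \<partial>circle_measure)"
  proof (rule nn_integral_mono)
    fix \<zeta> assume "\<zeta> \<in> space circle_measure"
    then have \<zeta>: "\<zeta> \<in> unit_circle" by simp
    have "norm (h \<zeta>) = Gamma (b + 1) * norm (1 - w * \<zeta>) powr (- (b + 1)) * norm (\<phi> \<zeta>)"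
      unfolding h[OF \<zeta>] norm_mult norm_of_real using G by (simp add: norm_powr_real_powr')
    also have "\<dots> \<le> Gamma (b + 1) * norm (1 - w * \<zeta>) powr (- (b + 1)) * 1"
      using G \<phi>1[OF \<zeta>] by (intro mult_left_mono) auto
    finally show "ennreal (norm (h \<zeta>)) \<le> ennreal (Gamma (b + 1)) * ennreal (norm (1 - w * \<zeta>) powr (- (b + 1)))"
      using G by (simp add: ennreal_leI flip: ennreal_mult)
  qed
  also have "\<dots> = ennreal (Gamma (b + 1)) * (\<integral>\<^sup>+\<zeta>. ennreal (norm (1 - w * \<zeta>) powr (- (b + 1))) \<partial>circle_measure)"
    by (rule nn_integral_cmult) measurable
  also have "\<dots> \<le> ennreal (Gamma (b + 1)) * ennreal (4 * weak_const (b + 1) 1 * (1 - norm w) powr (1 - (b + 1)))"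
    using b w by (intro mult_left_mono nn_integral_cauchy_kernel_le) auto
  also have "\<dots> = ennreal (Gamma (b + 1) * (4 * weak_const (b + 1) 1) * (1 - r * norm z) powr (- b))"
    using G b weak_const_nonneg[of "b + 1" 1] by (simp add: nw mult.assoc flip: ennreal_mult)
  finally show ?thesis
    unfolding eq using G b weak_const_nonneg[of "b + 1" 1] by (subst (asm) ennreal_le_iff) auto
qed

text \<open>Since \<open>ru\<close> is at most \<open>r\<close> and at most \<open>u\<close>, \<open>1 - ru \<ge> ((1-r) + (1-u))/2\<close>, and a power of the right side has an
  elementary primitive with a bound that is uniform down to \<open>r = 0\<close>.\<close>

lemma nn_integral_power_kernel_le:
  assumes b: "1 < b" and r: "0 \<le> r" "r < 1"
  shows "(\<integral>\<^sup>+u\<in>{0<..<1}. ennreal ((1 - r * u) powr (- b)) \<partial>lborel)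
    \<le> ennreal (2 powr b / (b - 1) * (1 - r) powr (1 - b))"
proof -
  define F where "F u = (2 - r - u) powr (1 - b) / (b - 1)" for u
  have "(\<integral>\<^sup>+u\<in>{0<..<1}. ennreal ((1 - r * u) powr (- b)) \<partial>lborel)
      \<le> (\<integral>\<^sup>+u. ennreal (2 powr b) * (ennreal ((2 - r - u) powr (- b)) * indicator {0..1} u) \<partial>lborel)"
  proof (rule nn_integral_mono)
    fix u :: real
    show "ennreal ((1 - r * u) powr (- b)) * indicator {0<..<1} u
        \<le> ennreal (2 powr b) * (ennreal ((2 - r - u) powr (- b)) * indicator {0..1} u)"
    proof (cases "u \<in> {0<..<1}")
      case True
      have "r * u \<le> r" "r * u \<le> u"
        using r True by (auto intro: mult_left_le mult_right_le_one_le mult_left_le_one_le)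
      then have "(2 - r - u) / 2 \<le> 1 - r * u" by simp
      then have "(1 - r * u) powr (- b) \<le> ((2 - r - u) / 2) powr (- b)"
        using True r b by (intro powr_mono2') auto
      also have "\<dots> = 2 powr b * (2 - r - u) powr (- b)"
      proof -
        have "(2 :: real) powr (- b) = 1 / 2 powr b" by (rule powr_minus_divide)
        then show ?thesis by (simp only: powr_divide) simp
      qed
      finally show ?thesis
        using True by (simp add: ennreal_leI flip: ennreal_mult)
    qed auto
  qed
  also have "\<dots> = ennreal (2 powr b) * (\<integral>\<^sup>+u. ennreal ((2 - r - u) powr (- b)) * indicator {0..1} u \<partial>lborel)"
    by (rule nn_integral_cmult) measurable
  also have "(\<integral>\<^sup>+u. ennreal ((2 - r - u) powr (- b)) * indicator {0..1} u \<partial>lborel) = ennreal (F 1 - F 0)"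
  proof (rule nn_integral_FTC_Icc)
    fix u :: real assume u: "u \<in> {0..1}"
    then have pos: "0 < 2 - r - u" using r by auto
    have "((\<lambda>u. 2 - r - u) has_real_derivative - 1) (at u)"
      by (auto intro!: derivative_eq_intros)
    from DERIV_cdivide[OF DERIV_chain2[OF has_real_derivative_powr[OF pos] this], of "1 - b" "b - 1"]
    have "(F has_real_derivative (1 - b) * (2 - r - u) powr (1 - b - 1) * - 1 / (b - 1)) (at u)"
      unfolding F_def .
    moreover have "(1 - b) * (2 - r - u) powr (1 - b - 1) * - 1 / (b - 1) = (2 - r - u) powr (- b)"
    proof -
      have "(1 - b) * (2 - r - u) powr (1 - b - 1) * - 1 = (2 - r - u) powr (- b) * (b - 1)"
        by (simp add: algebra_simps)
      then show ?thesis using b by simp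
    qed
    ultimately show "(F has_real_derivative (2 - r - u) powr (- b)) (at u)"
      by (simp only:)
  qed auto
  also have "ennreal (F 1 - F 0) \<le> ennreal ((1 - r) powr (1 - b) / (b - 1))"
    using b by (intro ennreal_leI) (simp add: F_def)
  finally show ?thesis
    using b by (simp add: mult_left_mono flip: ennreal_mult)
qed

text \<open>Suppose the means are unbounded along radii \<open>r\<^sub>j\<close>, with \<open>(1 - r\<^sub>j) powr (b-1) M\<^sub>1(r\<^sub>j) > j 2\<^sup>j\<^sup>+\<^sup>1\<close>. With \<open>\<phi>\<^sub>j\<close> the conjugate phase
  of \<open>f(r\<^sub>j \<zeta>)\<close>, the multiplier \<open>v\<^sub>j\<^sub>n = (1 - r\<^sub>j) powr (b-1) r\<^sub>j\<^sup>n \<integral> \<zeta>\<^sup>n \<phi>\<^sub>j\<close> pairs with \<open>\<mu>\<close> to \<open>(1 - r\<^sub>j) powr (b-1) M\<^sub>1(r\<^sub>j)\<close>.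
  The factor in front makes the multipliers \<open>v\<^sub>j\<close> bounded in the multiplier space, so every mixture with weights
  \<open>|\<gamma>\<^sub>j| \<le> 2\<^sup>-\<^sup>j\<^sup>-\<^sup>1\<close> belongs to it (\<open>member\<close>). The uniform boundedness principle over these mixtures bounds
  \<open>2\<^sup>-\<^sup>j\<^sup>-\<^sup>1 (1 - r\<^sub>j) powr (b-1) M\<^sub>1(r\<^sub>j)\<close>, a contradiction.\<close>

lemma abel_dual_mixed_norm_deriv_growth:
  assumes b: "1 < b" and \<mu>: "\<mu> \<in> abel_dual (coeff_space (mixed_norm_deriv_space \<infinity> 1 1 b))"
  obtains K where "\<And>r. 0 < r \<Longrightarrow> r < 1 \<Longrightarrow>
    (\<integral>\<zeta>. norm (powser \<mu> (of_real r * \<zeta>)) \<partial>circle_measure) * (1 - r) powr (b - 1) \<le> K"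
proof (rule ccontr)
  assume neg: "\<not> thesis"
  define N where "N r = (\<integral>\<zeta>. norm (powser \<mu> (of_real r * \<zeta>)) \<partial>circle_measure)" for r
  note x0 = dyadic_pos
  note xs = summable_dyadic
  have "\<exists>r. 0 < r \<and> r < 1 \<and> real j / dyadic j < N r * (1 - r) powr (b - 1)" for j
    using neg that unfolding N_def by (meson not_le)
  then obtain r where r: "\<And>j. 0 < r j" "\<And>j. r j < 1"
      "\<And>j. real j / dyadic j < N (r j) * (1 - r j) powr (b - 1)" by metis
  have \<mu>d: "\<mu> \<in> disk_seqs" by (rule abel_dual_mixed_norm_deriv_disk_seqs[OF b \<mu>])
  have b0: "0 < b" using b by simp
  have cont\<mu>: "continuous_on unit_disk (powser \<mu>)"
    by (intro holomorphic_on_imp_continuous_on powser_holomorphic \<mu>d)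
  define f where "f j \<zeta> = powser \<mu> (of_real (r j) * \<zeta>)" for j \<zeta>
  \<comment> \<open>at a zero of \<open>f j\<close> the quotient is 0 by convention, so \<open>f j * \<phi> j\<close> is the modulus of \<open>f j\<close> there too\<close>
  define \<phi> where "\<phi> j \<zeta> = cnj (f j \<zeta>) / of_real (norm (f j \<zeta>))" for j \<zeta>
  have fm [measurable]: "f j \<in> borel_measurable circle_measure" for j
    unfolding f_def using r[of j] by (intro measurable_dilation cont\<mu>) auto
  have \<phi>m: "\<phi> j \<in> borel_measurable circle_measure" for j
    unfolding \<phi>_def by measurable
  have \<phi>1: "norm (\<phi> j \<zeta>) \<le> 1" for j \<zeta>
    by (simp add: \<phi>_def norm_divide)
  have f\<phi>: "f j \<zeta> * \<phi> j \<zeta> = of_real (norm (f j \<zeta>))" for j \<zeta>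
    using complex_norm_square[of "f j \<zeta>"] by (cases "f j \<zeta> = 0") (simp_all add: \<phi>_def power2_eq_square field_simps)
  define e where "e j n = (\<integral>\<zeta>. \<zeta> ^ n * \<phi> j \<zeta> \<partial>circle_measure)" for j n
  have e1: "norm (e j n) \<le> 1" for j n
  proof -
    have "norm (e j n) \<le> (\<integral>\<zeta>. norm (\<zeta> ^ n * \<phi> j \<zeta>) \<partial>circle_measure)"
      unfolding e_def by (rule integral_norm_bound)
    also have "\<dots> \<le> (\<integral>\<zeta>. 1 \<partial>circle_measure)"
    proof (rule integral_mono)
      note [measurable] = \<phi>m[of j] measurable_circle_ident
      show "integrable circle_measure (\<lambda>\<zeta>. norm (\<zeta> ^ n * \<phi> j \<zeta>))"
        by (rule circle.integrable_const_bound[where B = 1]) (auto simp: norm_mult norm_power \<phi>1)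
    qed (auto simp: norm_mult norm_power \<phi>1)
    also have "\<dots> = 1" by simp
    finally show ?thesis .
  qed
  define \<delta> where "\<delta> j = (1 - r j) powr (b - 1)" for j
  have \<delta>: "0 < \<delta> j" "\<delta> j \<le> 1" for j
    using r[of j] b by (auto simp: \<delta>_def powr_le1)
  define v where "v j n = of_real (\<delta> j) * (of_real (r j ^ n) * e j n)" for j n
  have v1: "norm (v j n) \<le> 1" for j n
  proof -
    have "\<delta> j * (r j ^ n * norm (e j n)) \<le> 1 * (1 * 1)"
      using \<delta>[of j] r[of j] e1[of j n] by (intro mult_mono) (auto simp: power_le_one)
    then show ?thesis
      using \<delta>[of j] r[of j] by (simp add: v_def norm_mult norm_power)
  qed
  define C where "C = Gamma (b + 1) * (4 * weak_const (b + 1) 1)"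
  have C0: "0 \<le> C"
    unfolding C_def using b weak_const_nonneg[of "b + 1" 1]
    by (intro mult_nonneg_nonneg less_imp_le[OF Gamma_real_pos]) auto
  have B: "(\<lambda>n. complex_of_real (deriv_weight b n)) \<in> disk_seqs"
    by (rule deriv_weight_disk_seqs[OF b0])
  have Bv: "norm (powser (\<lambda>n. of_real (deriv_weight b n) * v j n) z) \<le> \<delta> j * (C * (1 - r j * norm z) powr (- b))"
    if z: "norm z < 1" for j z
  proof -
    let ?y = "\<lambda>n. of_real (deriv_weight b n) * (of_real (r j ^ n) * e j n)"
    have "?y \<in> disk_seqs"
    proof (intro disk_seqs_mult B bounded_disk_seqs[where K = 1])
      show "norm (complex_of_real (r j ^ n)) \<le> 1" for n
        using r[of j] by (simp add: norm_power power_le_one)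
    qed (rule e1)
    from sums_mult[OF powser_sums[OF this z], of "of_real (\<delta> j)"]
    have "powser (\<lambda>n. of_real (deriv_weight b n) * v j n) z = of_real (\<delta> j) * powser ?y z"
      by (simp add: powser_def sums_iff v_def mult_ac)
    moreover have "norm (powser ?y z) \<le> C * (1 - r j * norm z) powr (- b)"
      unfolding e_def C_def using r[of j] by (intro norm_cauchy_transform_le b \<phi>m \<phi>1 z) auto
    ultimately show ?thesis
      using \<delta>[of j] by (simp add: norm_mult mult_left_mono)
  qed
  have member: "(\<lambda>n. \<Sum>j. \<gamma> j * v j n) \<in> coeff_space (mixed_norm_deriv_space \<infinity> 1 1 b)"
    if \<gamma>: "\<And>j. norm (\<gamma> j) \<le> dyadic j" for \<gamma> :: "nat \<Rightarrow> complex"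
  proof (rule coeff_space_mixed_norm_derivI)
    have \<gamma>s: "summable (\<lambda>j. norm (\<gamma> j))"
      by (rule summable_comparison_test'[OF xs]) (simp add: \<gamma>)
    let ?l = "\<lambda>n. \<Sum>j. \<gamma> j * v j n"
    let ?F = "powser (\<lambda>n. of_real (deriv_weight b n) * ?l n)"
    show l: "?l \<in> disk_seqs"
      by (rule bounded_disk_seqs) (rule norm_mixture_le(2)[OF \<gamma>s v1])
    have hol: "?F holomorphic_on unit_disk"
      by (intro powser_holomorphic disk_seqs_mult B l)
    have le: "ennreal (integral_mean \<infinity> u ?F) \<le> (\<Sum>j. ennreal (dyadic j * \<delta> j * C) * ennreal ((1 - r j * u) powr (- b)))"
      if u: "0 < u" "u < 1" for u
    proof -
      define g where "g j = dyadic j * \<delta> j * C * (1 - r j * u) powr (- b)" for j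
      have g0: "0 \<le> g j" for j
        using x0[of j] \<delta>[of j] C0 by (simp add: g_def less_imp_le)
      \<comment> \<open>for fixed \<open>u\<close> the kernels are bounded by \<open>(1 - u) powr (-b)\<close>; only the integral over \<open>u\<close> needs the factor \<open>\<delta> j\<close>\<close>
      have gs: "summable g"
      proof (rule summable_comparison_test')
        show "summable (\<lambda>j. dyadic j * (C * (1 - u) powr (- b)))"
          by (intro summable_mult2 xs)
        show "norm (g j) \<le> dyadic j * (C * (1 - u) powr (- b))" for j
        proof -
          have "r j * u \<le> u" using r[of j] u by (intro mult_left_le_one_le) auto
          then have "(1 - r j * u) powr (- b) \<le> (1 - u) powr (- b)"
            using u b by (intro powr_mono2') auto
          then have "(dyadic j * \<delta> j) * (C * (1 - r j * u) powr (- b)) \<le> (dyadic j * 1) * (C * (1 - u) powr (- b))"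
            using x0[of j] \<delta>[of j] C0 by (intro mult_mono mult_left_mono) (auto simp: less_imp_le)
          then show ?thesis using g0[of j] by (simp add: g_def mult.assoc)
        qed
      qed
      have "integral_mean \<infinity> u ?F \<le> (\<Sum>j. g j)"
      proof (rule integral_mean_inf_le)
        fix \<zeta> :: complex assume \<zeta>: "norm \<zeta> = 1"
        have nz: "norm (of_real u * \<zeta>) = u" using \<zeta> u by (simp add: norm_mult)
        let ?t = "\<lambda>j. \<gamma> j * powser (\<lambda>n. of_real (deriv_weight b n) * v j n) (of_real u * \<zeta>)"
        have sums: "?t sums ?F (of_real u * \<zeta>)"
          using nz u by (intro powser_mixture_sums B \<gamma>s v1) auto
        have t_le: "norm (?t j) \<le> g j" for j
        proof -
          have "norm (?t j) \<le> dyadic j * (\<delta> j * (C * (1 - r j * u) powr (- b)))"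
            unfolding norm_mult using Bv[of "of_real u * \<zeta>" j] nz u \<gamma>[of j] x0[of j]
            by (intro mult_mono) auto
          then show ?thesis by (simp add: g_def mult.assoc)
        qed
        have s: "summable (\<lambda>j. norm (?t j))"
          by (rule summable_comparison_test'[OF gs]) (use t_le in simp)
        have "norm (?F (of_real u * \<zeta>)) = norm (suminf ?t)" using sums by (simp add: sums_iff)
        also have "\<dots> \<le> (\<Sum>j. norm (?t j))" by (rule summable_norm[OF s])
        also have "\<dots> \<le> (\<Sum>j. g j)" by (intro suminf_le t_le s gs)
        finally show "norm (?F (of_real u * \<zeta>)) \<le> (\<Sum>j. g j)" .
      qed
      then have "ennreal (integral_mean \<infinity> u ?F) \<le> ennreal (\<Sum>j. g j)" by (rule ennreal_leI)
      also have "\<dots> = (\<Sum>j. ennreal (g j))" by (rule suminf_ennreal2[symmetric, OF g0 gs])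
      also have "\<dots> = (\<Sum>j. ennreal (dyadic j * \<delta> j * C) * ennreal ((1 - r j * u) powr (- b)))"
        unfolding g_def using x0 \<delta> C0 by (intro suminf_cong ennreal_mult) (auto simp: less_imp_le)
      finally show ?thesis .
    qed
    have "(\<integral>\<^sup>+u\<in>{0<..<1}. ennreal (integral_mean \<infinity> u ?F) \<partial>lborel)
        \<le> (\<integral>\<^sup>+u. (\<Sum>j. ennreal (dyadic j * \<delta> j * C) * (ennreal ((1 - r j * u) powr (- b)) * indicator {0<..<1} u)) \<partial>lborel)"
    proof (rule nn_integral_mono)
      fix u :: real
      show "ennreal (integral_mean \<infinity> u ?F) * indicator {0<..<1} u
          \<le> (\<Sum>j. ennreal (dyadic j * \<delta> j * C) * (ennreal ((1 - r j * u) powr (- b)) * indicator {0<..<1} u))"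
      proof (cases "u \<in> {0<..<1}")
        case True
        then have "0 < u" "u < 1" by auto
        from le[OF this] True show ?thesis by (simp only: indicator_simps mult_1_right)
      qed (auto simp: indicator_def)
    qed
    also have "\<dots> = (\<Sum>j. \<integral>\<^sup>+u. ennreal (dyadic j * \<delta> j * C) * (ennreal ((1 - r j * u) powr (- b)) * indicator {0<..<1} u) \<partial>lborel)"
      by (rule nn_integral_suminf) measurable
    also have "\<dots> \<le> (\<Sum>j. ennreal (dyadic j * (C * (2 powr b / (b - 1)))))"
    proof (intro suminf_le)
      fix j
      have "(\<integral>\<^sup>+u. ennreal (dyadic j * \<delta> j * C) * (ennreal ((1 - r j * u) powr (- b)) * indicator {0<..<1} u) \<partial>lborel)
          = ennreal (dyadic j * \<delta> j * C) * (\<integral>\<^sup>+u\<in>{0<..<1}. ennreal ((1 - r j * u) powr (- b)) \<partial>lborel)"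
        by (rule nn_integral_cmult) measurable
      also have "\<dots> \<le> ennreal (dyadic j * \<delta> j * C) * ennreal (2 powr b / (b - 1) * (1 - r j) powr (1 - b))"
        using r[of j] by (intro mult_left_mono nn_integral_power_kernel_le b) auto
      also have "\<dots> = ennreal (dyadic j * \<delta> j * C * (2 powr b / (b - 1) * (1 - r j) powr (1 - b)))"
        using x0[of j] \<delta>[of j] C0 b by (intro ennreal_mult[symmetric]) (auto simp: less_imp_le)
      also have "dyadic j * \<delta> j * C * (2 powr b / (b - 1) * (1 - r j) powr (1 - b))
          = dyadic j * (C * (2 powr b / (b - 1))) * (\<delta> j * (1 - r j) powr (1 - b))"
        by simp
      also have "\<delta> j * (1 - r j) powr (1 - b) = 1"
        using r[of j] by (simp add: \<delta>_def flip: powr_add)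
      finally show "(\<integral>\<^sup>+u. ennreal (dyadic j * \<delta> j * C) * (ennreal ((1 - r j * u) powr (- b)) * indicator {0<..<1} u) \<partial>lborel)
          \<le> ennreal (dyadic j * (C * (2 powr b / (b - 1))))"
        by simp
    qed auto
    also have "\<dots> = ennreal (\<Sum>j. dyadic j * (C * (2 powr b / (b - 1))))"
      using x0 C0 b by (intro suminf_ennreal2 summable_mult2 xs) (auto simp: less_imp_le)
    also have "\<dots> < \<infinity>" by simp
    finally show "?F \<in> mixed_norm_space \<infinity> 1 1"
      using mixed_norm_inf_1_iff[OF hol] by simp
  qed
  define a where "a m j = of_real (dyadic j) * powser (\<lambda>n. \<mu> n * v j n) (of_real (radius_seq m))" for m j
  have \<mu>v: "(\<lambda>n. \<mu> n * v j n) \<in> disk_seqs" for j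
    by (intro disk_seqs_mult \<mu>d bounded_disk_seqs[where K = 1] v1)
  have rm: "norm (complex_of_real (radius_seq m)) \<le> radius_seq m" for m
    using radius_seq[of m] by simp
  have summ: "summable (\<lambda>j. norm (a m j))" for m
  proof (rule summable_comparison_test')
    let ?S = "\<Sum>n. norm (\<mu> n) * radius_seq m ^ n"
    show "summable (\<lambda>j. dyadic j * ?S)" by (intro summable_mult2 xs)
    fix j
    have R: "0 \<le> radius_seq m" "radius_seq m < 1" using radius_seq[of m] by auto
    have "norm (powser (\<lambda>n. \<mu> n * v j n) (of_real (radius_seq m))) \<le> (\<Sum>n. norm (\<mu> n * v j n) * radius_seq m ^ n)"
      by (rule norm_powser_le[OF \<mu>v rm R(2)])
    also have "\<dots> \<le> ?S"
      using R by (intro suminf_le disk_seqsD_real \<mu>v \<mu>d mult_right_mono mixture_term_le v1) auto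
    finally show "norm (norm (a m j)) \<le> dyadic j * ?S"
      using x0[of j] by (simp add: a_def norm_mult mult_left_mono)
  qed
  have "\<exists>K. \<forall>m. norm (\<Sum>j. a m j * c j) \<le> K" if c: "\<And>j. norm (c j) \<le> 1" for c
  proof -
    define \<gamma> where "\<gamma> j = c j * of_real (dyadic j)" for j
    have \<gamma>: "norm (\<gamma> j) \<le> dyadic j" for j
      using mult_right_mono[OF c, of "dyadic j" j] x0[of j] by (simp add: \<gamma>_def norm_mult)
    have \<gamma>s: "summable (\<lambda>j. norm (\<gamma> j))"
      by (rule summable_comparison_test'[OF xs]) (simp add: \<gamma>)
    have "abel_summable (\<lambda>n. \<mu> n * (\<Sum>j. \<gamma> j * v j n))"
      using \<mu> member[OF \<gamma>] by (auto simp: abel_dual_def)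
    then obtain K where K: "\<And>m. norm (powser (\<lambda>n. \<mu> n * (\<Sum>j. \<gamma> j * v j n)) (of_real (radius_seq m))) \<le> K"
      using abel_summable_bounded by blast
    have "(\<Sum>j. a m j * c j) = powser (\<lambda>n. \<mu> n * (\<Sum>j. \<gamma> j * v j n)) (of_real (radius_seq m))" for m
    proof -
      have "norm (complex_of_real (radius_seq m)) < 1" using radius_seq[of m] by simp
      from powser_mixture_sums[OF \<mu>d this \<gamma>s v1] show ?thesis
        by (simp add: sums_iff a_def \<gamma>_def mult_ac)
    qed
    then show ?thesis using K by auto
  qed
  from uniform_boundedness_rows[OF summ this] obtain K where K: "\<And>m. (\<Sum>j. norm (a m j)) \<le> K" by blast
  \<comment> \<open>the Abel means of the pairing with a single multiplier converge to its value\<close>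
  have bound: "dyadic j * (\<delta> j * N (r j)) \<le> K" for j
  proof (rule LIMSEQ_le_const2)
    define y where "y n = \<mu> n * e j n" for n
    have y: "y \<in> disk_seqs"
      unfolding y_def by (intro disk_seqs_mult \<mu>d bounded_disk_seqs[where K = 1] e1)
    have rj: "norm (complex_of_real (r j)) < 1" using r[of j] by simp
    have "(\<lambda>n. (\<mu> n * of_real (r j) ^ n) * e j n) sums
        (\<integral>\<zeta>. (\<Sum>n. \<mu> n * of_real (r j) ^ n * \<zeta> ^ n) * \<phi> j \<zeta> \<partial>circle_measure)"
      unfolding e_def by (rule integral_circle_power_series[OF disk_seqsD[OF \<mu>d rj] \<phi>m \<phi>1])
    moreover have "(\<Sum>n. \<mu> n * of_real (r j) ^ n * \<zeta> ^ n) * \<phi> j \<zeta> = of_real (norm (f j \<zeta>))" for \<zeta>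
    proof -
      have "(\<Sum>n. \<mu> n * of_real (r j) ^ n * \<zeta> ^ n) = f j \<zeta>"
        by (simp add: f_def powser_def power_mult_distrib mult.assoc)
      then show ?thesis by (simp only: f\<phi>)
    qed
    ultimately have val: "powser y (of_real (r j)) = of_real (N (r j))"
      by (simp add: powser_def sums_iff y_def N_def f_def mult_ac)
    have "(\<lambda>m. powser y (of_real (r j) * of_real (radius_seq m))) \<longlonglongrightarrow> powser y (of_real (r j))"
    proof (rule isCont_tendsto_compose[of _ "powser y"])
      show "isCont (powser y) (of_real (r j))"
        by (rule isCont_powser[OF y rj])
      have "(\<lambda>m. complex_of_real (r j) * of_real (radius_seq m)) \<longlonglongrightarrow> of_real (r j) * of_real 1"
        by (intro tendsto_intros radius_seq_tendsto)
      then show "(\<lambda>m. complex_of_real (r j) * of_real (radius_seq m)) \<longlonglongrightarrow> of_real (r j)" by simp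
    qed
    then have "(\<lambda>m. dyadic j * (\<delta> j * norm (powser y (of_real (r j) * of_real (radius_seq m)))))
        \<longlonglongrightarrow> dyadic j * (\<delta> j * norm (powser y (of_real (r j))))"
      by (intro tendsto_intros)
    moreover have "norm (powser y (of_real (r j))) = N (r j)"
      unfolding val by (simp add: N_def)
    ultimately show "(\<lambda>m. dyadic j * (\<delta> j * norm (powser y (of_real (r j) * of_real (radius_seq m)))))
        \<longlonglongrightarrow> dyadic j * (\<delta> j * N (r j))" by simp
    have "dyadic j * (\<delta> j * norm (powser y (of_real (r j) * of_real (radius_seq m)))) \<le> K" for m
    proof -
      have "norm (complex_of_real (r j) * of_real (radius_seq m)) < 1"
        using r[of j] radius_seq[of m] mult_strict_mono'[of "r j" 1 "radius_seq m" 1] by (simp add: norm_mult)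
      from sums_mult[OF powser_sums[OF y this], of "of_real (\<delta> j)"]
      have "powser (\<lambda>n. \<mu> n * v j n) (of_real (radius_seq m))
          = of_real (\<delta> j) * powser y (of_real (r j) * of_real (radius_seq m))"
        by (simp add: powser_def sums_iff y_def v_def power_mult_distrib mult_ac)
      then have "dyadic j * (\<delta> j * norm (powser y (of_real (r j) * of_real (radius_seq m)))) = norm (a m j)"
        using x0[of j] \<delta>[of j] by (simp add: a_def norm_mult)
      also have "\<dots> = (\<Sum>j\<in>{j}. norm (a m j))" by simp
      also have "\<dots> \<le> (\<Sum>j. norm (a m j))"
        by (intro sum_le_suminf summ) auto
      also note K
      finally show ?thesis .
    qed
    then show "\<exists>M. \<forall>m\<ge>M. dyadic j * (\<delta> j * norm (powser y (of_real (r j) * of_real (radius_seq m)))) \<le> K" by blast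
  qed
  obtain j :: nat where "K < real j" using reals_Archimedean2 by blast
  also have "real j < dyadic j * (\<delta> j * N (r j))"
    using r(3)[of j] x0[of j] by (simp add: divide_less_eq \<delta>_def mult_ac)
  also note bound
  finally show False by simp
qed

lemma abel_dual_mixed_norm_deriv_subset:
  assumes b: "1 < b" and \<mu>: "\<mu> \<in> abel_dual (coeff_space (mixed_norm_deriv_space \<infinity> 1 1 b))"
  shows "\<mu> \<in> coeff_space (mixed_norm_space 1 \<infinity> (b - 1))"
proof -
  have \<mu>d: "\<mu> \<in> disk_seqs" by (rule abel_dual_mixed_norm_deriv_disk_seqs[OF b \<mu>])
  obtain K where K: "\<And>r. 0 < r \<Longrightarrow> r < 1 \<Longrightarrow>
      (\<integral>\<zeta>. norm (powser \<mu> (of_real r * \<zeta>)) \<partial>circle_measure) * (1 - r) powr (b - 1) \<le> K"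
    using abel_dual_mixed_norm_deriv_growth[OF b \<mu>] by blast
  have "(SUP r\<in>{0<..<1}. ennreal (integral_mean 1 r (powser \<mu>) * (1 - r) powr (b - 1))) \<le> ennreal K"
    unfolding integral_mean_1 by (intro SUP_least ennreal_leI K) auto
  also have "\<dots> < \<infinity>" by simp
  finally have "powser \<mu> \<in> mixed_norm_space 1 \<infinity> (b - 1)"
    using powser_holomorphic[OF \<mu>d] by (simp add: mixed_norm_space_def)
  then show ?thesis
    unfolding coeff_space_def using taylor_coeff_powser[OF \<mu>d] by (intro image_eqI[of _ _ "powser \<mu>"]) auto
qed

theorem corollary4p1:
  fixes p :: real
  assumes "0 < p" and "p < 1"
  shows "abel_dual (coeff_space (weak_hardy p)) =
           coeff_space (mixed_norm_deriv_space \<infinity> 1 1 (1 / p)) \<and>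
         abel_dual (abel_dual (coeff_space (weak_hardy p))) =
           coeff_space (mixed_norm_space 1 \<infinity> (1 / p - 1))"
proof -
  have b: "1 < 1 / p" using assms by simp
  have i: "abel_dual (coeff_space (weak_hardy p)) = coeff_space (mixed_norm_deriv_space \<infinity> 1 1 (1 / p))"
  proof (intro equalityI subsetI)
    fix l assume "l \<in> abel_dual (coeff_space (weak_hardy p))"
    then show "l \<in> coeff_space (mixed_norm_deriv_space \<infinity> 1 1 (1 / p))"
      using abel_dual_weak_hardy_subset[OF b, of l] by simp
  next
    fix l assume "l \<in> coeff_space (mixed_norm_deriv_space \<infinity> 1 1 (1 / p))"
    then show "l \<in> abel_dual (coeff_space (weak_hardy p))"
      using abel_summable_pairing[OF b weak_hardy_subset_mixed_norm[OF assms]]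
      by (auto simp: abel_dual_def coeff_space_def)
  qed
  have "abel_dual (coeff_space (mixed_norm_deriv_space \<infinity> 1 1 (1 / p)))
      = coeff_space (mixed_norm_space 1 \<infinity> (1 / p - 1))"
  proof (intro equalityI subsetI)
    fix \<mu> assume "\<mu> \<in> abel_dual (coeff_space (mixed_norm_deriv_space \<infinity> 1 1 (1 / p)))"
    then show "\<mu> \<in> coeff_space (mixed_norm_space 1 \<infinity> (1 / p - 1))"
      by (rule abel_dual_mixed_norm_deriv_subset[OF b])
  next
    fix \<mu> assume "\<mu> \<in> coeff_space (mixed_norm_space 1 \<infinity> (1 / p - 1))"
    then show "\<mu> \<in> abel_dual (coeff_space (mixed_norm_deriv_space \<infinity> 1 1 (1 / p)))"
      using abel_summable_pairing[OF b] by (auto simp: abel_dual_def coeff_space_def mult.commute)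
  qed
  with i show ?thesis by simp
qed

end
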